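(* Let $G$ be a ribbon graph and $e\in E(G)$. Then (1) $D(G\setminus e)=D(G)\setminus e$; (2) $D(G/e)=D(G)/e$.
   Context: A ribbon graph $G=(V,E)$ is a surface with boundary, represented as the union of two finite sets of discs, the vertices $V$ and the edges $E$, such that: the vertices and edges intersect in disjoint line segments; each such line segment lies on the boundary of precisely one vertex and precisely one edge; every edge contains exactly two such line segments. For $A\subseteq E$, $f(A)$ is the number of boundary components of the spanning ribbon subgraph $(V,A)$; $k(G)$ is the number of connected components of $G$. The delta-matroid $D(G)$ has ground set $E$ and feasible sets the $A\subseteq E$ with $f(A)=k(G)$ (the edge sets of spanning quasi-trees). Ribbon graph deletion: $G\setminus e=(V,E-e)$. Ribbon graph contraction: let $u,v$ be the (not necessarily distinct) vertices incident with $e$; consider the boundary component(s) of $e\cup u\cup v$ as curves on $G$; for each resulting curve attach a disc, which becomes a vertex of $G/e$, by identifying its boundary with the curve; then delete $e$, $u$ and $v$. For a delta-matroid $D=(E,\mathcal{F})$, an element $e$ is a coloop if it is in every feasible set and a loop if it is in no feasible set. If $e$ is not a coloop, $D\setminus e=(E-e,\{F\in\mathcal{F}\mid F\subseteq E-e\})$. If $e$ is not a loop, $D/e=(E-e,\{F-e\mid F\in\mathcal{F},\ e\in F\})$. If $e$ is a loop or coloop, then one of $D\setminus e$, $D/e$ has been defined and one sets $D/e=D\setminus e$. *)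

theory Defs
  imports "HOL-Analysis.Analysis"
begin

section \<open>Surfaces\<close>

text \<open>
  Discs and surfaces are subsets of an ambient Hausdorff space. The boundary of a surface is its
  manifold boundary (the points without an open neighbourhood in the surface that is an open disc),
  which is intrinsic to the surface and in general not its topological frontier in the ambient
  space.
\<close>

definition disc :: "'a::topological_space set \<Rightarrow> bool" where
  "disc S \<longleftrightarrow> S homeomorphic cball (0::complex) 1"

definition line_segment :: "'a::topological_space set \<Rightarrow> bool" where
  "line_segment S \<longleftrightarrow> S homeomorphic {0..1::real}"

definition surface_boundary :: "'a::topological_space set \<Rightarrow> 'a set" where
  "surface_boundary S =
     {x \<in> S. \<not> (\<exists>U. openin (top_of_set S) U \<and> x \<in> U \<and> U homeomorphic ball (0::complex) 1)}"

definition boundary_components :: "'a::topological_space set \<Rightarrow> 'a set set" where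
  "boundary_components S = components (surface_boundary S)"

section \<open>Ribbon graphs\<close>

record 'a ribbon =
  vertices :: "'a set set"
  edges :: "'a set set"

definition surface :: "'a ribbon \<Rightarrow> 'a set" where
  "surface G = \<Union> (vertices G) \<union> \<Union> (edges G)"

text \<open>
  The line segments in which the vertices and edges meet are the connected components of the
  intersection, so they are disjoint from one another by construction.
\<close>

definition segments :: "'a::topological_space ribbon \<Rightarrow> 'a set set" where
  "segments G = components (\<Union> (vertices G) \<inter> \<Union> (edges G))"

text \<open>
  That the union is a surface with boundary is not listed as a condition: it holds automatically
  for finitely many discs in a Hausdorff space that meet as described.
\<close>

definition ribbon_graph :: "'a::t2_space ribbon \<Rightarrow> bool" where
  "ribbon_graph G \<longleftrightarrow>
     finite (vertices G) \<and> finite (edges G) \<and>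
     (\<forall>S \<in> vertices G \<union> edges G. disc S) \<and>
     pairwise disjnt (vertices G) \<and> pairwise disjnt (edges G) \<and>
     (\<forall>s \<in> segments G. line_segment s \<and>
        (\<exists>!v. v \<in> vertices G \<and> s \<subseteq> surface_boundary v) \<and>
        (\<exists>!e. e \<in> edges G \<and> s \<subseteq> surface_boundary e)) \<and>
     (\<forall>e \<in> edges G. card {s \<in> segments G. s \<subseteq> e} = 2)"

definition spanning_subgraph :: "'a ribbon \<Rightarrow> 'a set set \<Rightarrow> 'a ribbon" where
  "spanning_subgraph G A = G\<lparr>edges := A\<rparr>"

definition num_boundary_components :: "'a::topological_space ribbon \<Rightarrow> nat" where
  "num_boundary_components G = card (boundary_components (surface G))"

definition num_components :: "'a::topological_space ribbon \<Rightarrow> nat" where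
  "num_components G = card (components (surface G))"

definition delete_edge :: "'a ribbon \<Rightarrow> 'a set \<Rightarrow> 'a ribbon" where
  "delete_edge G e = G\<lparr>edges := edges G - {e}\<rparr>"

definition incident_vertices :: "'a ribbon \<Rightarrow> 'a set \<Rightarrow> 'a set set" where
  "incident_vertices G e = {v \<in> vertices G. v \<inter> e \<noteq> {}}"

text \<open>
  Contraction attaches abstract discs to \<open>G\<close>, which need not fit into the space in which \<open>G\<close> lives,
  and depends on their choice. So \<open>G/e\<close> is rendered as a relation: \<open>is_contraction \<phi> G e H\<close> says
  that \<open>H\<close> is a ribbon graph \<open>G/e\<close>, formed in some Hausdorff space (of any type) into which \<open>\<phi>\<close>
  embeds the surface \<open>G\<close>. The disc \<open>\<delta> c\<close> is attached along the boundary curve \<open>c\<close>: it meets the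
  surface \<open>G\<close> exactly in its boundary \<open>c\<close>, and different attached discs are disjoint. The edge \<open>a\<close>
  of \<open>G\<close> with \<open>a \<noteq> e\<close> is the edge \<open>\<phi> ` a\<close> of \<open>H\<close>. If \<open>\<phi>\<close> is the identity, then \<open>H\<close> is formed in
  the space of \<open>G\<close> and literally has the edges of \<open>G\<close> other than \<open>e\<close>.
\<close>

definition is_contraction ::
  "('a::t2_space \<Rightarrow> 'b::t2_space) \<Rightarrow> 'a ribbon \<Rightarrow> 'a set \<Rightarrow> 'b ribbon \<Rightarrow> bool" where
  "is_contraction \<phi> G e H \<longleftrightarrow>
     (\<exists>\<psi>. homeomorphism (surface G) (\<phi> ` surface G) \<phi> \<psi>) \<and>
     (let I = incident_vertices G e; C = boundary_components (e \<union> \<Union> I)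
      in \<exists>\<delta>. (\<forall>c \<in> C. disc (\<delta> c) \<and> surface_boundary (\<delta> c) = \<phi> ` c \<and>
                       \<delta> c \<inter> \<phi> ` surface G = \<phi> ` c) \<and>
             (\<forall>c \<in> C. \<forall>c' \<in> C. c \<noteq> c' \<longrightarrow> disjnt (\<delta> c) (\<delta> c')) \<and>
             vertices H = (`) \<phi> ` (vertices G - I) \<union> \<delta> ` C \<and>
             edges H = (`) \<phi> ` (edges G - {e}))"

section \<open>Delta-matroids\<close>

text \<open>
  The operations are defined for arbitrary set systems; the symmetric exchange axiom plays no role
  in them.
\<close>

record 'e set_system =
  ground :: "'e set"
  feasible :: "'e set set"

definition coloop :: "'e set_system \<Rightarrow> 'e \<Rightarrow> bool" where
  "coloop D e \<longleftrightarrow> e \<in> ground D \<and> (\<forall>F \<in> feasible D. e \<in> F)"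

definition loop :: "'e set_system \<Rightarrow> 'e \<Rightarrow> bool" where
  "loop D e \<longleftrightarrow> e \<in> ground D \<and> (\<forall>F \<in> feasible D. e \<notin> F)"

definition restrict_avoiding :: "'e set_system \<Rightarrow> 'e \<Rightarrow> 'e set_system" where
  "restrict_avoiding D e =
     \<lparr>ground = ground D - {e}, feasible = {F \<in> feasible D. F \<subseteq> ground D - {e}}\<rparr>"

definition restrict_containing :: "'e set_system \<Rightarrow> 'e \<Rightarrow> 'e set_system" where
  "restrict_containing D e =
     \<lparr>ground = ground D - {e}, feasible = {F - {e} | F. F \<in> feasible D \<and> e \<in> F}\<rparr>"

definition dm_delete :: "'e set_system \<Rightarrow> 'e \<Rightarrow> 'e set_system" where
  "dm_delete D e = (if coloop D e then restrict_containing D e else restrict_avoiding D e)"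

definition dm_contract :: "'e set_system \<Rightarrow> 'e \<Rightarrow> 'e set_system" where
  "dm_contract D e = (if loop D e then restrict_avoiding D e else restrict_containing D e)"

definition relabel :: "('e \<Rightarrow> 'f) \<Rightarrow> 'e set_system \<Rightarrow> 'f set_system" where
  "relabel g D = \<lparr>ground = g ` ground D, feasible = (`) g ` feasible D\<rparr>"

definition delta_matroid_of :: "'a::topological_space ribbon \<Rightarrow> 'a set set_system" where
  "delta_matroid_of G =
     \<lparr>ground = edges G,
      feasible = {A. A \<subseteq> edges G \<and>
                     num_boundary_components (spanning_subgraph G A) = num_components G}\<rparr>"

end

theory Submission
  imports Defs
begin

text \<open>
  Write f(A) for the number of boundary components of the spanning ribbon subgraph (V,A), and k
  for numbers of connected components. Everything follows from knowing when adding an edge e to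
  (V,A) changes f(A) by exactly one.

  The disc e meets the vertices in two disjoint arcs s and s' of its boundary circle; the rest of
  that circle consists of two arcs t and t', each of which joins an end of s to an end of s'. By
  \<open>boundary_spanning_subgraph\<close> the boundary of (V,A) consists of free arcs and
  circles of the vertices, of the sides t, t' of the edges in A and of the segments s, s' of the
  other edges. So adding e exchanges s, s' for t, t' and leaves a remainder X alone.

  The decisive fact is a parity (\<open>common_boundary_parity\<close>): a component of X contains
  an even number of the four ends of s and s'. Indeed the arcs at the vertices pair off all ends
  of segments, and the sides or segments of the edges other than e pair off all ends except those
  four. Hence, if s and s' lie in different boundary components of (V,A), then the two ends of s
  lie in one component of X and the two ends of s' in another one, and exchanging s, s' for t, t'
  merges the two: f(A+e) = f(A)-1. The situation is symmetric in the two pairs of arcs, so f(A+e)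
  = f(A)+1 if t and t' lie in different boundary components of (V,A+e)
  (\<open>card_components_exchange\<close>).

  Deletion. If the two ends of e are connected in G - e, then k(G - e) = k(G), and a spanning
  quasi-tree of G - e, which exists because a spanning forest is one, shows that e is no coloop;
  both sides have the feasible sets A with f(A) = k(G). Otherwise k(G - e) = k(G)+1. Since f(A) is
  at least k(G - e) for every A avoiding e, the edge e is a coloop; and s, s' are separated in
  every (V,A), so that f(A) = k(G - e) says the same as f(A+e) = k(G).

  Contraction. Let W be the union of e and the vertices at e. The circles along which the new
  discs are attached form the boundary of W, so the boundary of the subgraph of G/e with edge set
  A is the boundary of (V,A+e) (\<open>boundary_H\<close>): its number of components is f(A+e).
  Attaching the discs to G gives the same space as filling W into G/e. The former does not change
  the number of components; the latter lowers it by one or not at all, according to whether t and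
  t' are separated in G/e (\<open>num_components_H\<close>). If they are not, then k(G/e) = k(G),
  and a spanning quasi-tree of G/e shows that e is no loop. If they are, then k(G/e) = k(G)+1, the
  edge e is a loop, and f(A+e) = f(A)+1 for all A.

  The topological input is the description of the boundary of a surface: gluing two discs along an
  arc of their boundaries makes the interior of the arc disappear from the boundary, but not its
  ends (\<open>boundary_along_arc\<close>). This rests on invariance of domain and on charts onto
  half discs.
\<close>

section \<open>Counting connected components\<close>

lemma finite_components_Union_connected:
  fixes F :: "'a::topological_space set set"
  assumes "finite F" "\<And>T. T \<in> F \<Longrightarrow> connected T"
  shows "finite (components (\<Union>F))"
proof -
  have "components (\<Union>F) \<subseteq> (\<lambda>T. connected_component_set (\<Union>F) (SOME x. x \<in> T)) ` F"
  proof
    fix K assume "K \<in> components (\<Union>F)"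
    then obtain x where x: "x \<in> \<Union>F" "K = connected_component_set (\<Union>F) x"
      by (auto simp: components_def)
    then obtain T where T: "T \<in> F" "x \<in> T" by auto
    have y: "(SOME x. x \<in> T) \<in> T" using T(2) someI by metis
    have "connected_component (\<Union>F) x (SOME x. x \<in> T)"
      unfolding connected_component_def using T y assms(2) by blast
    then have "K = connected_component_set (\<Union>F) (SOME x. x \<in> T)"
      using x connected_component_eq by fastforce
    then show "K \<in> (\<lambda>T. connected_component_set (\<Union>F) (SOME x. x \<in> T)) ` F"
      using T(1) by blast
  qed
  then show ?thesis using assms(1) finite_surj by blast
qed

lemma components_disjoint_Union:
  fixes F :: "'a::topological_space set set"
  assumes fin: "finite F" and disj: "pairwise disjnt F"
    and F: "\<And>T. T \<in> F \<Longrightarrow> closed T" "\<And>T. T \<in> F \<Longrightarrow> connected T" "\<And>T. T \<in> F \<Longrightarrow> T \<noteq> {}"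
  shows "components (\<Union>F) = F"
proof -
  have comp: "connected_component_set (\<Union>F) x = T" if "T \<in> F" "x \<in> T" for T x
  proof
    show "T \<subseteq> connected_component_set (\<Union>F) x"
      using that F(2) by (intro connected_component_maximal) auto
    let ?K = "connected_component_set (\<Union>F) x" and ?R = "\<Union>(F - {T})"
    have "closed ?R" using fin F(1) by (intro closed_Union) auto
    moreover have "T \<inter> ?R = {}"
      using disj that(1) by (auto simp: pairwise_def disjnt_def)
    moreover have "?K \<subseteq> T \<union> ?R"
      using connected_component_subset[of "\<Union>F" x] that by auto
    moreover have "x \<in> ?K" using that connected_component_refl by fastforce
    ultimately have "?R \<inter> ?K = {}"
      using connected_closedD[OF connected_connected_component, of T ?R "\<Union>F" x] F(1) that by blast
    then show "?K \<subseteq> T" using \<open>?K \<subseteq> T \<union> ?R\<close> by blast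
  qed
  show ?thesis
  proof
    show "components (\<Union>F) \<subseteq> F" using comp by (auto simp: components_def)
    show "F \<subseteq> components (\<Union>F)"
    proof
      fix T assume T: "T \<in> F"
      then obtain x where "x \<in> T" using F(3) by blast
      then show "T \<in> components (\<Union>F)"
        using comp[OF T] T by (metis UnionI componentsI)
    qed
  qed
qed

text \<open>
  The connected set \<open>B\<close> touches only the components of \<open>p\<close> and
  \<open>q\<close>, so it fuses with them into one set; the resulting finite family of disjoint
  closed connected sets must be the family of components. The case in which \<open>p\<close> and
  \<open>q\<close> lie in the same component is included.
\<close>

lemma components_attach:
  fixes X B :: "'a::topological_space set"
  assumes X: "closed X" "finite (components X)" and B: "closed B" "connected B"
    and pq: "p \<in> B" "p \<in> X" "q \<in> B" "q \<in> X"
    and sub: "B \<inter> X \<subseteq> connected_component_set X p \<union> connected_component_set X q"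
  shows "components (X \<union> B) =
    insert (connected_component_set X p \<union> connected_component_set X q \<union> B)
      (components X - {connected_component_set X p, connected_component_set X q})"
proof -
  define Cp Cq where "Cp = connected_component_set X p" and "Cq = connected_component_set X q"
  have in_comp: "Cp \<in> components X" "Cq \<in> components X"
    using pq by (auto simp: Cp_def Cq_def componentsI)
  have mem: "p \<in> Cp" "q \<in> Cq" using pq by (auto simp: Cp_def Cq_def connected_component_refl)
  let ?F = "insert (Cp \<union> Cq \<union> B) (components X - {Cp,Cq})"
  have "\<Union>?F = X \<union> B" using in_comp Union_components[of X] by blast
  moreover have "components (\<Union>?F) = ?F"
  proof (rule components_disjoint_Union)
    have cl: "closed K" if "K \<in> components X" for K
      using that X(1) closed_connected_component by (auto simp: components_def)
    have dis: "K \<inter> L = {}" if "K \<in> components X" "L \<in> components X" "K \<noteq> L" for K L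
      using that by (meson components_nonoverlap)
    have "K \<inter> B = {}" if "K \<in> components X - {Cp,Cq}" for K
      using that sub[folded Cp_def Cq_def] dis[of K Cp] dis[of K Cq] in_comp in_components_subset[of K X] by blast
    then have "K \<inter> (Cp \<union> Cq \<union> B) = {}" if "K \<in> components X - {Cp,Cq}" for K
      using that dis[of K Cp] dis[of K Cq] in_comp by blast
    then show "pairwise disjnt ?F"
      using dis by (auto simp: pairwise_insert pairwise_def disjnt_def Int_commute)
    show "closed T" if "T \<in> ?F" for T using that cl in_comp B by auto
    have "connected (Cp \<union> B)"
    proof (rule connected_Un)
      show "Cp \<inter> B \<noteq> {}" using pq mem by blast
    qed (use B in \<open>auto simp: Cp_def\<close>)
    then have "connected (Cq \<union> (Cp \<union> B))"
    proof (rule connected_Un[rotated])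
      show "Cq \<inter> (Cp \<union> B) \<noteq> {}" using pq mem by blast
    qed (auto simp: Cq_def)
    then show "connected T" if "T \<in> ?F" for T
      using that in_components_connected by (auto simp: Un_ac)
    show "T \<noteq> {}" if "T \<in> ?F" for T
      using that pq(1) in_components_nonempty by blast
  qed (use X in auto)
  ultimately show ?thesis unfolding Cp_def Cq_def by simp
qed

lemma card_components_attach:
  fixes X B :: "'a::topological_space set"
  assumes X: "closed X" "finite (components X)" and B: "closed B" "connected B"
    and pq: "p \<in> B" "p \<in> X" "q \<in> B" "q \<in> X"
    and sub: "B \<inter> X \<subseteq> connected_component_set X p \<union> connected_component_set X q"
  shows "finite (components (X \<union> B))"
    and "connected_component X p q \<Longrightarrow> card (components (X \<union> B)) = card (components X)"
    and "\<not> connected_component X p q \<Longrightarrow> card (components (X \<union> B)) + 1 = card (components X)"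
proof -
  define Cp Cq where "Cp = connected_component_set X p" and "Cq = connected_component_set X q"
  have in_comp: "Cp \<in> components X" "Cq \<in> components X"
    using pq by (auto simp: Cp_def Cq_def componentsI)
  have mem: "p \<in> Cp" "q \<in> Cq" using pq by (auto simp: Cp_def Cq_def connected_component_refl)
  note eq = components_attach[OF assms, folded Cp_def Cq_def]
  show "finite (components (X \<union> B))" using X(2) eq by simp
  have "Cp \<union> Cq \<union> B \<notin> components X - {Cp,Cq}"
    using in_comp mem by (metis Diff_iff Int_iff UnI1 components_nonoverlap emptyE insertI1)
  then have card: "card (components (X \<union> B)) = Suc (card (components X - {Cp,Cq}))"
    using X(2) eq by simp
  show "card (components (X \<union> B)) = card (components X)" if "connected_component X p q"
  proof -
    have "Cp = Cq" using that connected_component_eq by (fastforce simp: Cp_def Cq_def)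
    then show ?thesis using card card_Suc_Diff1[OF X(2) in_comp(2)] by simp
  qed
  show "card (components (X \<union> B)) + 1 = card (components X)" if "\<not> connected_component X p q"
  proof -
    have "q \<notin> Cp" using that by (simp add: Cp_def)
    then have "Cp \<noteq> Cq" using mem(2) by blast
    then have "card {Cp,Cq} = 2" by simp
    moreover have "card {Cp,Cq} \<le> card (components X)" using in_comp X(2) by (intro card_mono) auto
    ultimately show ?thesis using card in_comp X(2) by (simp add: card_Diff_subset)
  qed
qed

text \<open>
  Parity forces the component of \<open>X\<close> that contains \<open>p\<close> to contain a
  second one of the four points. As \<open>s\<close> and \<open>s'\<close> are separated it can
  only be \<open>p'\<close>; likewise \<open>q\<close> goes with \<open>q'\<close>. So
  \<open>s\<close> and \<open>s'\<close> each stay within a component of \<open>X\<close>, whereas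
  \<open>t\<close> fuses the two components and \<open>t'\<close> then joins points that are
  already connected.
\<close>

lemma card_components_exchange:
  fixes X :: "'a::topological_space set"
  assumes X: "closed X" "finite (components X)"
    and s: "closed s" "connected s" "closed s'" "connected s'"
    and t: "closed t" "connected t" "closed t'" "connected t'"
    and meet: "s \<inter> X = {p,p'}" "s' \<inter> X = {q,q'}" "t \<inter> X = {p,q}" "t' \<inter> X = {p',q'}"
    and disj: "s \<inter> s' = {}" "t \<inter> t' = {}"
    and even: "\<And>U. U \<in> components X \<Longrightarrow> even (card (U \<inter> {p,p',q,q'}))"
    and sep: "\<not> connected_component (X \<union> s \<union> s') p q"
  shows "card (components (X \<union> t \<union> t')) + 1 = card (components (X \<union> s \<union> s'))"
proof -
  have inX: "p \<in> X" "p' \<in> X" "q \<in> X" "q' \<in> X" "p \<in> s" "p' \<in> s" "q \<in> s'" "q' \<in> s'"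
    "p \<in> t" "q \<in> t" "p' \<in> t'" "q' \<in> t'"
    using meet by blast+
  have ne: "p \<noteq> p'" "p \<noteq> q" "p \<noteq> q'" "p' \<noteq> q" "p' \<noteq> q'" "q \<noteq> q'"
    using inX disj by blast+
  have mono: "connected_component Y x y" if "connected_component X x y" "X \<subseteq> Y" for x y Y
    using that by (meson connected_component_of_subset)
  have ss: "connected_component (X \<union> s \<union> s') p p'" "connected_component (X \<union> s \<union> s') q q'"
    unfolding connected_component_def using s inX by (meson Un_upper1 Un_upper2 le_supI1)+
  have np: "\<not> connected_component X x y" if "x \<in> {p,p'}" "y \<in> {q,q'}" for x y
  proof
    assume "connected_component X x y"
    then have "connected_component (X \<union> s \<union> s') x y" by (rule mono) auto
    then have "connected_component (X \<union> s \<union> s') p q"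
      using that ss by (auto dest: connected_component_sym intro: connected_component_trans)
    then show False using sep by simp
  qed
  have pp: "connected_component X p p'"
  proof (rule ccontr)
    assume n: "\<not> connected_component X p p'"
    have "connected_component_set X p \<inter> {p,p',q,q'} = {p}"
      using n np inX by (auto simp: connected_component_refl)
    then have "odd (card (connected_component_set X p \<inter> {p,p',q,q'}))" by (simp only:) simp
    then show False using even componentsI[OF inX(1)] by blast
  qed
  have qq: "connected_component X q q'"
  proof (rule ccontr)
    assume n: "\<not> connected_component X q q'"
    have "connected_component_set X q \<inter> {p,p',q,q'} = {q}"
      using n np inX by (auto simp: connected_component_refl dest: connected_component_sym)
    then have "odd (card (connected_component_set X q \<inter> {p,p',q,q'}))" by (simp only:) simp
    then show False using even componentsI[OF inX(3)] by blast
  qed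
  have refl: "connected_component Y x x" if "x \<in> Y" for x Y
    using that connected_component_refl by fastforce
  have c1: "finite (components (X \<union> s))" "card (components (X \<union> s)) = card (components X)"
    using card_components_attach[OF X s(1,2), of p p'] inX meet(1) pp refl[of p X] by simp_all
  have c2: "card (components (X \<union> s \<union> s')) = card (components (X \<union> s))"
  proof (rule card_components_attach(2)[OF _ c1(1) s(3,4), of q q'])
    have "s' \<inter> (X \<union> s) = {q,q'}" using meet(2) disj(1) by blast
    then show "s' \<inter> (X \<union> s) \<subseteq> connected_component_set (X \<union> s) q \<union> connected_component_set (X \<union> s) q'"
      using refl[of q "X \<union> s"] refl[of q' "X \<union> s"] inX by simp
  qed (use X s inX mono[OF qq, of "X \<union> s"] in auto)
  have c3: "finite (components (X \<union> t))" "card (components (X \<union> t)) + 1 = card (components X)"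
    using card_components_attach[OF X t(1,2), of p q] inX meet(3) np[of p q] refl[of p X] refl[of q X] by simp_all
  have "connected_component (X \<union> t) p q" unfolding connected_component_def using t inX by (meson Un_upper2)
  then have "connected_component (X \<union> t) p' q'"
    using mono[OF pp, of "X \<union> t"] mono[OF qq, of "X \<union> t"]
    by (metis Un_upper1 connected_component_sym connected_component_trans)
  then have c4: "card (components (X \<union> t \<union> t')) = card (components (X \<union> t))"
  proof (rule_tac card_components_attach(2)[OF _ c3(1) t(3,4), of p' q'])
    have "t' \<inter> (X \<union> t) = {p',q'}" using meet(4) disj(2) by blast
    then show "t' \<inter> (X \<union> t) \<subseteq> connected_component_set (X \<union> t) p' \<union> connected_component_set (X \<union> t) q'"
      using refl[of p' "X \<union> t"] refl[of q' "X \<union> t"] inX by simp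
  qed (use X t inX in auto)
  show ?thesis using c1 c2 c3 c4 by simp
qed

lemma components_homeomorphic_image:
  assumes "homeomorphism S T f g" "X \<subseteq> S"
  shows "components (f ` X) = (`) f ` components X" "card (components (f ` X)) = card (components X)"
proof -
  have contf: "continuous_on X f" and contg: "continuous_on (f ` X) g"
    using assms unfolding homeomorphism_def by (meson continuous_on_subset image_mono subset_refl, metis continuous_on_subset image_mono)
  have gf: "g (f x) = x" if "x \<in> X" for x using assms that unfolding homeomorphism_def by auto
  have comp: "connected_component_set (f ` X) (f x) = f ` connected_component_set X x" if "x \<in> X" for x
  proof
    let ?K = "connected_component_set (f ` X) (f x)"
    have K: "?K \<subseteq> f ` X" by (rule connected_component_subset)
    have "connected (g ` ?K)"
      using contg K by (meson connected_connected_component connected_continuous_image continuous_on_subset)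
    moreover have "g ` ?K \<subseteq> X" using K gf by auto
    moreover have "x \<in> g ` ?K"
      using gf[OF that] connected_component_refl[of "f x" "f ` X"] that
      by (intro image_eqI[of _ _ "f x"]) auto
    ultimately have "g ` ?K \<subseteq> connected_component_set X x" by (intro connected_component_maximal)
    then have "f ` g ` ?K \<subseteq> f ` connected_component_set X x" by blast
    moreover have "f ` g ` ?K = ?K" using K gf by (force simp: image_image)
    ultimately show "?K \<subseteq> f ` connected_component_set X x" by simp
    have "connected (f ` connected_component_set X x)"
      using contf by (meson connected_connected_component connected_continuous_image continuous_on_subset connected_component_subset)
    then show "f ` connected_component_set X x \<subseteq> ?K"
      using that by (intro connected_component_maximal) (auto simp: connected_component_refl connected_component_subset image_mono)
  qed
  show eq: "components (f ` X) = (`) f ` components X"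
    using comp by (auto simp: components_def image_image)
  have "inj_on ((`) f) (components X)"
  proof (rule inj_onI)
    fix K L assume "K \<in> components X" "L \<in> components X" "f ` K = f ` L"
    moreover have "inj_on f X" using gf by (metis inj_on_inverseI)
    ultimately show "K = L" by (metis inj_on_image_eq_iff in_components_subset)
  qed
  then show "card (components (f ` X)) = card (components X)"
    using eq card_image by metis
qed

section \<open>Arcs and their ends\<close>

text \<open>
  The ends of an arc are its non-cut points. This description does not refer to a parametrisation,
  so it is preserved by homeomorphisms.
\<close>

definition arc_ends :: "'a::topological_space set \<Rightarrow> 'a set" where
  "arc_ends s = {x \<in> s. connected (s - {x})}"

definition arc_interior :: "'a::topological_space set \<Rightarrow> 'a set" where
  "arc_interior s = s - arc_ends s"

lemma arc_ends_subset: "arc_ends s \<subseteq> s"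
  by (auto simp: arc_ends_def)

lemma arc_ends_image:
  assumes h: "homeomorphism S T f g" and s: "s \<subseteq> S"
  shows "arc_ends (f ` s) = f ` arc_ends s"
proof -
  have inj: "inj_on f S" using h by (metis homeomorphism_def inj_on_inverseI)
  have "connected (f ` s - {f x}) \<longleftrightarrow> connected (s - {x})" if "x \<in> s" for x
  proof -
    have "f ` s - {f x} = f ` (s - {x})"
      using inj_on_image_set_diff[OF inj, of s "{x}"] s that by auto
    moreover have "homeomorphism (s - {x}) (f ` (s - {x})) f g"
      using h s by (intro homeomorphism_of_subsets[OF h]) auto
    ultimately show ?thesis by (metis homeomorphic_connectedness homeomorphic_def)
  qed
  then show ?thesis by (auto simp: arc_ends_def)
qed

lemma arc_interior_image:
  assumes h: "homeomorphism S T f g" and s: "s \<subseteq> S"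
  shows "arc_interior (f ` s) = f ` arc_interior s"
proof -
  have "inj_on f S" using h by (metis homeomorphism_def inj_on_inverseI)
  then show ?thesis unfolding arc_interior_def arc_ends_image[OF assms]
    using inj_on_image_set_diff[of f S s "arc_ends s"] s arc_ends_subset[of s] by blast
qed

lemma arc_ends_Icc: "a < b \<Longrightarrow> arc_ends {a..b::real} = {a,b}"
proof -
  assume ab: "a < b"
  have "{a..b} - {a} = {a<..b}" "{a..b} - {b} = {a..<b}" by auto
  then have "connected ({a..b} - {a})" "connected ({a..b} - {b})" by simp_all
  moreover have "\<not> connected ({a..b} - {x})" if "a < x" "x < b" for x
  proof
    assume "connected ({a..b} - {x})"
    then have "is_interval ({a..b} - {x})" by (simp add: is_interval_connected_1)
    then have "x \<in> {a..b} - {x}"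
      using that ab unfolding is_interval_1 by (metis Diff_iff atLeastAtMost_iff empty_iff insert_iff less_eq_real_def less_irrefl)
    then show False by simp
  qed
  ultimately have "connected ({a..b} - {x}) \<longleftrightarrow> x = a \<or> x = b" if "x \<in> {a..b}" for x
    using that by (metis atLeastAtMost_iff less_eq_real_def)
  then show ?thesis using ab unfolding arc_ends_def by force
qed

lemma line_segment_Icc: "a < b \<Longrightarrow> line_segment {a..b::real}"
  unfolding line_segment_def by (simp add: homeomorphic_closed_intervals_real)

lemma homeomorphism_inj_on: "homeomorphism S T f g \<Longrightarrow> inj_on f S"
  by (metis homeomorphism_def inj_on_inverseI)

lemma homeomorphism_restrict:
  "homeomorphism S T f g \<Longrightarrow> X \<subseteq> S \<Longrightarrow> homeomorphism X (f ` X) f g"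
  by (rule homeomorphism_of_subsets[where T''=T]) auto

lemma line_segment_image:
  assumes "homeomorphism S T f g" "s \<subseteq> S"
  shows "line_segment (f ` s) \<longleftrightarrow> line_segment s"
proof -
  have "s homeomorphic f ` s" using homeomorphism_restrict[OF assms] homeomorphic_def by blast
  then show ?thesis unfolding line_segment_def by (meson homeomorphic_sym homeomorphic_trans)
qed

lemma line_segment_param:
  assumes "line_segment s"
  obtains h k where "homeomorphism {0..1::real} s h k"
  using assms unfolding line_segment_def by (metis homeomorphic_def homeomorphic_sym)

lemma arc_ends_param:
  "homeomorphism {0..1::real} s h k \<Longrightarrow> arc_ends s = {h 0, h 1}"
  using arc_ends_image[of "{0..1}" s h k "{0..1}"] arc_ends_Icc[of 0 1]
  by (auto simp: homeomorphism_def)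

lemma line_segment_facts:
  fixes s :: "'a::t2_space set"
  assumes "line_segment s"
  shows "compact s" "closed s" "connected s" "s \<noteq> {}" "card (arc_ends s) = 2" "finite (arc_ends s)"
proof -
  obtain h k where h: "homeomorphism {0..1::real} s h k" using line_segment_param assms by blast
  show c: "compact s" using assms homeomorphic_compactness[of s "{0..1::real}"] by (simp add: line_segment_def)
  then show "closed s" by (rule compact_imp_closed)
  show "connected s" using assms homeomorphic_connectedness[of s "{0..1::real}"] by (simp add: line_segment_def)
  have "h 0 \<noteq> h 1" using homeomorphism_inj_on[OF h] by (auto dest: inj_onD)
  then show "card (arc_ends s) = 2" "finite (arc_ends s)" using arc_ends_param[OF h] by auto
  then show "s \<noteq> {}" by (auto simp: arc_ends_def)
qed

lemma connected_subset_arc: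
  assumes u: "line_segment u" and s: "s \<subseteq> u" "connected s" "arc_ends u \<subseteq> s"
  shows "s = u"
proof -
  obtain h k where h: "homeomorphism {0..1::real} u h k" using line_segment_param u by blast
  have k: "homeomorphism u {0..1::real} k h" using h homeomorphism_symD by blast
  have "connected (k ` s)"
    using homeomorphic_connectedness[of s "k ` s"] homeomorphism_restrict[OF k s(1)] s(2) homeomorphic_def by blast
  moreover have "h 0 \<in> s" "h 1 \<in> s" using s(3) arc_ends_param[OF h] by auto
  moreover have "k (h 0) = 0" "k (h 1) = 1" using h by (auto simp: homeomorphism_def)
  ultimately have "connected (k ` s)" "0 \<in> k ` s" "1 \<in> k ` s" by force+
  then have "{0..1} \<subseteq> k ` s" using connected_contains_Icc by blast
  then have "k ` s = k ` u" using s(1) k by (auto simp: homeomorphism_def)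
  then show ?thesis using homeomorphism_inj_on[OF k] s(1) by (metis inj_on_image_eq_iff subset_refl)
qed

lemma subarc_param:
  fixes t :: "'a::t2_space set"
  assumes h: "homeomorphism {0..1::real} t h k" and s: "s \<subseteq> t" "line_segment s"
  obtains c d where "0 \<le> c" "c < d" "d \<le> 1" "s = h ` {c..d}" "arc_ends s = {h c, h d}"
proof -
  have k: "homeomorphism t {0..1::real} k h" using h homeomorphism_symD by blast
  have ks: "homeomorphism s (k ` s) k h" using homeomorphism_restrict[OF k s(1)] .
  have "line_segment (k ` s)" using line_segment_image[OF k s(1)] s(2) by simp
  from line_segment_facts[OF this] obtain c d where cd: "k ` s = {c..d}"
    by (metis connected_compact_interval_1)
  have "c \<le> d" using line_segment_facts(4)[OF \<open>line_segment (k ` s)\<close>] cd by auto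
  moreover have "c \<noteq> d"
  proof
    assume "c = d"
    then have "arc_ends (k ` s) \<subseteq> {c}" using cd by (auto simp: arc_ends_def)
    then have "card (arc_ends (k ` s)) \<le> 1" by (metis card.empty card_mono finite.emptyI finite.insertI is_singletonI is_singleton_altdef)
    then show False using line_segment_facts(5)[OF \<open>line_segment (k ` s)\<close>] by simp
  qed
  moreover have "k ` s \<subseteq> {0..1}" using s(1) k by (auto simp: homeomorphism_def)
  moreover have "s = h ` {c..d}" using ks cd by (simp add: homeomorphism_def)
  moreover have "arc_ends s = {h c, h d}"
    using arc_ends_image[OF h, of "{c..d}"] arc_ends_Icc[of c d] calculation cd by auto
  ultimately show ?thesis using that[of c d] cd by auto
qed

lemma arc_ends_path_image:
  fixes u :: "real \<Rightarrow> 'a::t2_space"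
  assumes "arc u"
  shows "line_segment (path_image u)" "arc_ends (path_image u) = {pathstart u, pathfinish u}"
proof -
  obtain k where k: "homeomorphism {0..1} (path_image u) u k" using homeomorphism_arc assms by blast
  then show "line_segment (path_image u)"
    unfolding line_segment_def using homeomorphic_sym homeomorphic_def by blast
  show "arc_ends (path_image u) = {pathstart u, pathfinish u}"
    using arc_ends_param[OF k] by (simp add: pathstart_def pathfinish_def)
qed

subsection \<open>Arcs in a circle\<close>

definition circle :: "'a::topological_space set \<Rightarrow> bool" where
  "circle C \<longleftrightarrow> C homeomorphic sphere (0::complex) 1"

lemma unit_circle_simple_path:
  obtains g :: "real \<Rightarrow> complex" where "simple_path g" "pathfinish g = pathstart g" "path_image g = sphere 0 1"
proof
  let ?g = "\<lambda>t::real. cis (2*pi*t)"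
  have "path ?g" unfolding path_def by (intro continuous_intros)
  moreover have "loop_free ?g"
    unfolding loop_free_def
  proof (intro ballI impI)
    fix x y :: real assume xy: "x \<in> {0..1}" "y \<in> {0..1}" "cis (2*pi*x) = cis (2*pi*y)"
    then have "sin (2*pi*x) = sin (2*pi*y) \<and> cos (2*pi*x) = cos (2*pi*y)"
      by (simp add: complex_eq_iff)
    then obtain n::int where "2*pi*x = 2*pi*y + 2*pi*n"
      unfolding sin_cos_eq_iff by blast
    then have "2*pi*x = 2*pi*(y + n)" by (simp add: algebra_simps)
    then have n: "x = y + n" by simp
    then have "real_of_int n \<le> 1" "real_of_int n \<ge> -1" using xy by auto
    then have "n = 0 \<or> n = 1 \<or> n = -1" by linarith
    then show "x = y \<or> x = 0 \<and> y = 1 \<or> x = 1 \<and> y = 0" using n xy by auto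
  qed
  ultimately show "simple_path ?g" by (simp add: simple_path_def)
  show "pathfinish ?g = pathstart ?g" by (simp add: pathfinish_def pathstart_def)
  show "path_image ?g = sphere 0 1"
  proof
    show "path_image ?g \<subseteq> sphere 0 1" by (auto simp: path_image_def)
    show "sphere 0 1 \<subseteq> path_image ?g"
    proof
      fix z :: complex assume "z \<in> sphere 0 1"
      then have "z = cis (Arg2pi z)"
        using Arg2pi_eq[of z] by (simp add: cis_conv_exp)
      moreover have "0 \<le> Arg2pi z / (2*pi)" "Arg2pi z / (2*pi) \<le> 1"
        using Arg2pi_ge_0[of z] Arg2pi_lt_2pi[of z] by auto
      ultimately show "z \<in> path_image ?g"
        unfolding path_image_def by (intro image_eqI[of _ _ "Arg2pi z / (2*pi)"]) auto
    qed
  qed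
qed

text \<open>
  The ends of \<open>s\<close> cut the circle into two arcs. Without its ends \<open>s\<close> is
  connected, so it runs within one of them; being connected and containing both ends of that arc,
  it is all of it.
\<close>

lemma sphere_complementary_arc:
  fixes s :: "complex set"
  assumes s: "s \<subseteq> sphere 0 1" "line_segment s"
  obtains t where "line_segment t" "s \<union> t = sphere 0 1" "s \<inter> t = arc_ends s" "arc_ends t = arc_ends s"
proof -
  obtain h k where h: "homeomorphism {0..1::real} s h k" using line_segment_param s by blast
  define a b where "a = h 0" and "b = h 1"
  have ends: "arc_ends s = {a,b}" using arc_ends_param[OF h] by (simp add: a_def b_def)
  then have ab: "a \<noteq> b" "a \<in> s" "b \<in> s"
    using line_segment_facts(5)[OF s(2)] arc_ends_subset[of s] by auto
  obtain g :: "real \<Rightarrow> complex" where g: "simple_path g" "pathfinish g = pathstart g" "path_image g = sphere 0 1"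
    using unit_circle_simple_path .
  obtain u d where ud: "arc u" "arc d" "pathstart u = a" "pathfinish u = b"
      "pathstart d = b" "pathfinish d = a"
      "path_image u \<inter> path_image d = {a,b}" "path_image u \<union> path_image d = sphere 0 1"
    using exists_double_arc[OF g(1,2), of a b] g(3) ab s(1) by (metis subsetD)
  have lu: "line_segment (path_image u)" "arc_ends (path_image u) = {a,b}"
    and ld: "line_segment (path_image d)" "arc_ends (path_image d) = {a,b}"
    using arc_ends_path_image[OF ud(1)] arc_ends_path_image[OF ud(2)] ud by auto
  have int: "s - {a,b} = h ` {0<..<1}"
  proof -
    have "h ` ({0..1} - {0,1}) = h ` {0..1} - h ` {0,1}"
      using homeomorphism_inj_on[OF h] by (intro inj_on_image_set_diff) auto
    moreover have "{0..1::real} - {0,1} = {0<..<1}" by auto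
    ultimately show ?thesis using h by (simp add: homeomorphism_def a_def b_def)
  qed
  have "connected (s - {a,b})"
  proof -
    have "continuous_on {0<..<1} h" using h by (auto simp: homeomorphism_def intro: continuous_on_subset)
    then show ?thesis unfolding int by (intro connected_continuous_image) auto
  qed
  moreover have "closed (path_image u)" "closed (path_image d)"
    using line_segment_facts lu ld by auto
  moreover have "s - {a,b} \<subseteq> path_image u \<union> path_image d" using ud(8) s(1) by blast
  moreover have "path_image u \<inter> path_image d \<inter> (s - {a,b}) = {}" using ud(7) by blast
  ultimately have "path_image u \<inter> (s - {a,b}) = {} \<or> path_image d \<inter> (s - {a,b}) = {}"
    using connected_closedD by metis
  then have "s - {a,b} \<subseteq> path_image d \<or> s - {a,b} \<subseteq> path_image u"
    using \<open>s - {a,b} \<subseteq> path_image u \<union> path_image d\<close> by (elim disjE) blast+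
  moreover have "{a,b} \<subseteq> path_image u" "{a,b} \<subseteq> path_image d" using ud(7) by auto
  ultimately have "s \<subseteq> path_image d \<or> s \<subseteq> path_image u"
    by (metis Diff_subset_conv Un_absorb1)
  \<comment> \<open>Both arcs have the same ends, so the one that contains \<open>s\<close> equals
    \<open>s\<close>.\<close>
  moreover have "s = path_image d" if "s \<subseteq> path_image d"
    using connected_subset_arc[OF ld(1) that line_segment_facts(3)[OF s(2)]] ld(2) ab(2,3) by simp
  moreover have "s = path_image u" if "s \<subseteq> path_image u"
    using connected_subset_arc[OF lu(1) that line_segment_facts(3)[OF s(2)]] lu(2) ab(2,3) by simp
  ultimately have "s = path_image d \<or> s = path_image u" by blast
  then show ?thesis
  proof
    assume "s = path_image d"
    then show ?thesis using ud(7,8) lu(2) ends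
      by (intro that[OF lu(1)]) (simp_all only: Un_commute Int_commute)
  next
    assume "s = path_image u"
    then show ?thesis using ud(7,8) ld(2) ends by (intro that[OF ld(1)]) (simp_all only:)
  qed
qed

lemma circle_complementary_arc:
  fixes C :: "'a::t2_space set"
  assumes C: "circle C" and s: "s \<subseteq> C" "line_segment s"
  obtains t where "line_segment t" "s \<union> t = C" "s \<inter> t = arc_ends s" "arc_ends t = arc_ends s"
proof -
  obtain f g where f: "homeomorphism C (sphere (0::complex) 1) f g"
    using C by (auto simp: circle_def homeomorphic_def)
  then have g: "homeomorphism (sphere (0::complex) 1) C g f" by (rule homeomorphism_symD)
  have fs: "f ` s \<subseteq> sphere 0 1" "line_segment (f ` s)"
    using s f line_segment_image[OF f s(1)] by (auto simp: homeomorphism_def)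
  obtain t where t: "line_segment t" "f ` s \<union> t = sphere 0 1" "f ` s \<inter> t = arc_ends (f ` s)"
      "arc_ends t = arc_ends (f ` s)"
    using sphere_complementary_arc[OF fs] .
  have gfs: "g ` f ` s = s" using s(1) f by (force simp: homeomorphism_def image_image)
  have ts: "t \<subseteq> sphere 0 1" using t(2) by blast
  show ?thesis
  proof (rule that[of "g ` t"])
    show "line_segment (g ` t)" using line_segment_image[OF g ts] t(1) by simp
    show "s \<union> g ` t = C" using t(2) gfs g by (metis homeomorphism_def image_Un)
    have "g ` (f ` s \<inter> t) = g ` f ` s \<inter> g ` t"
      using inj_on_image_Int[OF homeomorphism_inj_on[OF g] fs(1) ts] .
    moreover have "g ` arc_ends (f ` s) = arc_ends s" using arc_ends_image[OF g fs(1)] gfs by simp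
    ultimately show "s \<inter> g ` t = arc_ends s" using t(3) gfs by simp
    show "arc_ends (g ` t) = arc_ends s"
      using arc_ends_image[OF g ts] t(4) \<open>g ` arc_ends (f ` s) = arc_ends s\<close> by simp
  qed
qed

subsection \<open>Gaps between disjoint arcs\<close>

lemma homeomorphism_image_back:
  "homeomorphism S T f g \<Longrightarrow> X \<subseteq> S \<Longrightarrow> g ` f ` X = X"
  by (force simp: homeomorphism_def image_image subset_eq)

text \<open>
  The gaps between finitely many disjoint intervals are again disjoint intervals, and all ends
  occur. Splitting at one of the given intervals reduces the claim to the two sides of it, each
  with fewer intervals.
\<close>

lemma interval_gaps:
  fixes a b :: real
  assumes "finite F" "a < b" "pairwise disjnt F"
    "\<forall>I\<in>F. \<exists>c d. a < c \<and> c < d \<and> d < b \<and> I = {c..d}"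
  shows "\<exists>T. finite T \<and> pairwise disjnt T \<and> (\<forall>J\<in>T. \<exists>c d. c < d \<and> J = {c..d}) \<and>
    \<Union>T = {a..b} - \<Union>(arc_interior ` F) \<and> \<Union>(arc_ends ` T) = {a,b} \<union> \<Union>(arc_ends ` F)"
  using assms
proof (induction "card F" arbitrary: F a b rule: less_induct)
  case less
  show ?case
  proof (cases "F = {}")
    case True
    show ?thesis
      using less.prems(2) True by (intro exI[of _ "{{a..b}}"]) (auto simp: arc_ends_Icc)
  next
    case False
    then obtain I where I: "I \<in> F" by blast
    then obtain c d where cd: "a < c" "c < d" "d < b" "I = {c..d}" using less.prems(4) by blast
    define F1 F2 where "F1 = {J \<in> F. J \<subseteq> {a<..<c}}" and "F2 = {J \<in> F. J \<subseteq> {d<..<b}}"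
    have split: "J \<in> F1 \<or> J \<in> F2" if J: "J \<in> F" "J \<noteq> I" for J
    proof -
      obtain x y where xy: "a < x" "x < y" "y < b" "J = {x..y}" using less.prems(4) J(1) by blast
      have "disjnt J I" using less.prems(3) I J by (auto simp: pairwise_def)
      then have "max x c > min y d" using xy cd by (auto simp: disjnt_iff) (smt (verit) not_le)
      then have "y < c \<or> d < x" using xy cd by linarith
      then show ?thesis using xy cd J by (auto simp: F1_def F2_def)
    qed
    have F: "F = insert I (F1 \<union> F2)" using split I by (auto simp: F1_def F2_def)
    have "c \<in> I" "c \<notin> {a<..<c}" "c \<notin> {d<..<b}" using cd by auto
    then have nI: "I \<notin> F1" "I \<notin> F2" unfolding F1_def F2_def by blast+
    have fin: "finite F1" "finite F2" using less.prems(1) by (auto simp: F1_def F2_def)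
    have lt: "card F1 < card F" "card F2 < card F"
      using less.prems(1) I nI by (auto intro!: psubset_card_mono simp: F1_def F2_def)
    have pw: "pairwise disjnt F1" "pairwise disjnt F2"
      using less.prems(3) by (auto simp: F1_def F2_def intro: pairwise_mono)
    have i1: "\<forall>J\<in>F1. \<exists>x y. a < x \<and> x < y \<and> y < c \<and> J = {x..y}"
    proof
      fix J assume J: "J \<in> F1"
      obtain x y where xy: "a < x" "x < y" "y < b" "J = {x..y}" using less.prems(4) J unfolding F1_def by blast
      moreover from this have "y \<in> J" by simp
      moreover have "J \<subseteq> {a<..<c}" using J by (simp add: F1_def)
      ultimately have "y \<in> {a<..<c}" by blast
      then show "\<exists>x y. a < x \<and> x < y \<and> y < c \<and> J = {x..y}" using xy by auto
    qed
    have i2: "\<forall>J\<in>F2. \<exists>x y. d < x \<and> x < y \<and> y < b \<and> J = {x..y}"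
    proof
      fix J assume J: "J \<in> F2"
      obtain x y where xy: "a < x" "x < y" "y < b" "J = {x..y}" using less.prems(4) J unfolding F2_def by blast
      moreover from this have "x \<in> J" by simp
      moreover have "J \<subseteq> {d<..<b}" using J by (simp add: F2_def)
      ultimately have "x \<in> {d<..<b}" by blast
      then show "\<exists>x y. d < x \<and> x < y \<and> y < b \<and> J = {x..y}" using xy by auto
    qed
    obtain T1 where T1: "finite T1" "pairwise disjnt T1" "\<forall>J\<in>T1. \<exists>c d. c < d \<and> J = {c..d}"
      "\<Union>T1 = {a..c} - \<Union>(arc_interior ` F1)" "\<Union>(arc_ends ` T1) = {a,c} \<union> \<Union>(arc_ends ` F1)"
      using less.hyps[OF lt(1) fin(1) cd(1) pw(1) i1] by blast
    obtain T2 where T2: "finite T2" "pairwise disjnt T2" "\<forall>J\<in>T2. \<exists>c d. c < d \<and> J = {c..d}"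
      "\<Union>T2 = {d..b} - \<Union>(arc_interior ` F2)" "\<Union>(arc_ends ` T2) = {d,b} \<union> \<Union>(arc_ends ` F2)"
      using less.hyps[OF lt(2) fin(2) cd(3) pw(2) i2] by blast
    have I_int: "arc_interior I = {c<..<d}" and I_ends: "arc_ends I = {c,d}"
      using cd by (auto simp: arc_interior_def arc_ends_Icc)
    have A: "\<Union>(arc_interior ` F1) \<subseteq> {a<..<c}" and B: "\<Union>(arc_interior ` F2) \<subseteq> {d<..<b}"
      by (auto simp: F1_def F2_def arc_interior_def)
    have "\<Union>(arc_interior ` F) = {c<..<d} \<union> (\<Union>(arc_interior ` F1) \<union> \<Union>(arc_interior ` F2))"
      using F I_int by blast
    then have "{a..b} - \<Union>(arc_interior ` F) = \<Union>T1 \<union> \<Union>T2"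
      unfolding T1(4) T2(4) using A B cd(1-3)
      by (simp only:) (rule set_eqI, auto)
    moreover have "pairwise disjnt (T1 \<union> T2)"
    proof -
      have "\<Union>T1 \<subseteq> {a..c}" "\<Union>T2 \<subseteq> {d..b}" unfolding T1(4) T2(4) by blast+
      then have "\<Union>T1 \<inter> \<Union>T2 = {}" using cd(2) by fastforce
      then have "disjnt x y" if "x \<in> T1" "y \<in> T2" for x y using that by (auto simp: disjnt_def)
      then show ?thesis using T1(2) T2(2) by (auto simp: pairwise_def disjnt_sym)
    qed
    moreover have "\<Union>(arc_ends ` (T1 \<union> T2)) = {a,b} \<union> \<Union>(arc_ends ` F)"
      unfolding image_Un Union_Un_distrib T1(5) T2(5) using F I_ends by auto
    ultimately show ?thesis using T1(1,3) T2(1,3) by (intro exI[of _ "T1 \<union> T2"]) auto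
  qed
qed

definition arc_system :: "'a::topological_space set set \<Rightarrow> bool" where
  "arc_system T \<longleftrightarrow> finite T \<and> pairwise disjnt T \<and> (\<forall>t\<in>T. line_segment t)"

text \<open>
  Removing one of the arcs leaves its complementary arc, which is parametrised by an interval. So
  the gaps are the images of the gaps in that interval, the ends of which account for the ends of
  the removed arc.
\<close>

lemma circle_gaps:
  fixes C :: "'a::t2_space set"
  assumes C: "circle C" and F: "arc_system F" "F \<noteq> {}" "\<Union>F \<subseteq> C"
  obtains T where "arc_system T" "\<Union>T = C - \<Union>(arc_interior ` F)" "\<Union>(arc_ends ` T) = \<Union>(arc_ends ` F)"
proof -
  obtain s0 where s0: "s0 \<in> F" using F(2) by blast
  then have "line_segment s0" "s0 \<subseteq> C" using F by (auto simp: arc_system_def)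
  then obtain t where t: "line_segment t" "s0 \<union> t = C" "s0 \<inter> t = arc_ends s0" "arc_ends t = arc_ends s0"
    using circle_complementary_arc[OF C] by metis
  obtain h k where h: "homeomorphism {0..1::real} t h k" using line_segment_param t(1) by blast
  then have k: "homeomorphism t {0..1::real} k h" by (rule homeomorphism_symD)
  have hends: "arc_ends s0 = {h 0, h 1}" using arc_ends_param[OF h] t(4) by simp
  define F' where "F' = F - {s0}"
  have F': "s \<subseteq> t" "s \<inter> arc_ends s0 = {}" "line_segment s" if "s \<in> F'" for s
  proof -
    have "s \<inter> s0 = {}" using that s0 F(1) by (auto simp: F'_def arc_system_def pairwise_def disjnt_def)
    then show "s \<subseteq> t" "s \<inter> arc_ends s0 = {}" using that F(3) t(2) arc_ends_subset[of s0] by (auto simp: F'_def)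
    show "line_segment s" using that F(1) by (auto simp: F'_def arc_system_def)
  qed
  have hk: "h ` k ` s = s" if "s \<in> F'" for s
    using homeomorphism_image_back[OF k F'(1)[OF that]] .
  have inj: "inj_on k t" "inj_on h {0..1}" using homeomorphism_inj_on h k by blast+
  let ?F = "(`) k ` F'"
  have 1: "\<forall>I\<in>?F. \<exists>c d. 0 < c \<and> c < d \<and> d < 1 \<and> I = {c..d}"
  proof
    fix I assume I: "I \<in> ?F"
    obtain s where s: "s \<in> F'" "I = k ` s" using I by blast
    obtain c d where cd: "0 \<le> c" "c < d" "d \<le> 1" "s = h ` {c..d}"
      using subarc_param[OF h F'(1,3)[OF s(1)]] by metis
    have "I = {c..d}"
      using homeomorphism_image_back[OF h, of "{c..d}"] cd s(2) by simp
    moreover have "c \<noteq> 0" "d \<noteq> 1" using F'(2)[OF s(1)] cd hends by auto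
    ultimately show "\<exists>c d. 0 < c \<and> c < d \<and> d < 1 \<and> I = {c..d}" using cd by force
  qed
  have pw: "pairwise disjnt ?F"
  proof (rule pairwise_imageI)
    fix x y assume "x \<in> F'" "y \<in> F'" "x \<noteq> y"
    then have "x \<inter> y = {}" using F(1) by (auto simp: F'_def arc_system_def pairwise_def disjnt_def)
    then show "disjnt (k ` x) (k ` y)"
      using inj_on_image_Int[OF inj(1) F'(1)[OF \<open>x \<in> F'\<close>] F'(1)[OF \<open>y \<in> F'\<close>]] by (auto simp: disjnt_def)
  qed
  have fin: "finite ?F" using F(1) by (auto simp: F'_def arc_system_def)
  obtain T where T: "finite T" "pairwise disjnt T" "\<forall>J\<in>T. \<exists>c d. c < d \<and> J = {c..d}"
      "\<Union>T = {0..1} - \<Union>(arc_interior ` ?F)" "\<Union>(arc_ends ` T) = {0,1} \<union> \<Union>(arc_ends ` ?F)"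
    using interval_gaps[OF fin zero_less_one pw 1] by (elim exE conjE) (rule that)
  have Tsub: "J \<subseteq> {0..1}" if "J \<in> T" for J using that T(4) by blast
  have img: "k ` s \<subseteq> {0..1}" if "s \<in> F'" for s using F'(1)[OF that] k by (auto simp: homeomorphism_def)
  have int: "arc_interior s = h ` arc_interior (k ` s)" "arc_ends s = h ` arc_ends (k ` s)" if "s \<in> F'" for s
    using arc_interior_image[OF h img[OF that]] arc_ends_image[OF h img[OF that]] hk[OF that] by auto
  show ?thesis
  proof (rule that[of "(`) h ` T"])
    show "arc_system ((`) h ` T)"
      unfolding arc_system_def
    proof (intro conjI ballI)
      show "pairwise disjnt ((`) h ` T)"
      proof (rule pairwise_imageI)
        fix x y assume "x \<in> T" "y \<in> T" "x \<noteq> y"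
        then have "x \<inter> y = {}" using T(2) by (simp add: disjnt_def pairwise_def)
        then show "disjnt (h ` x) (h ` y)"
          using inj_on_image_Int[OF inj(2) Tsub[OF \<open>x \<in> T\<close>] Tsub[OF \<open>y \<in> T\<close>]] by (simp add: disjnt_def)
      qed
      fix s assume "s \<in> (`) h ` T"
      then obtain J where J: "J \<in> T" "s = h ` J" by blast
      then have "line_segment J" using T(3) line_segment_Icc by metis
      then show "line_segment s" using line_segment_image[OF h Tsub[OF J(1)]] J(2) by simp
    qed (use T(1) in auto)
    have "\<Union>((`) h ` T) = h ` \<Union>T" by blast
    also have "\<dots> = h ` {0..1} - h ` (\<Union>(arc_interior ` ?F))"
      unfolding T(4) using img
      by (intro inj_on_image_set_diff[OF inj(2)]) (auto simp: arc_interior_def)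
    also have "h ` {0..1} = t" using h by (simp add: homeomorphism_def)
    also have "h ` (\<Union>(arc_interior ` ?F)) = \<Union>(arc_interior ` F')"
      using int(1) by (simp add: image_UN)
    also have "t - \<Union>(arc_interior ` F') = C - \<Union>(arc_interior ` F)"
    proof -
      have "C - arc_interior s0 = t" using t(2,3) by (auto simp: arc_interior_def)
      moreover have "F = insert s0 F'" using s0 by (auto simp: F'_def)
      ultimately show ?thesis by auto
    qed
    finally show "\<Union>((`) h ` T) = C - \<Union>(arc_interior ` F)" .
    have "\<Union>(arc_ends ` (`) h ` T) = h ` \<Union>(arc_ends ` T)"
      using arc_ends_image[OF h Tsub] by (auto simp: image_UN)
    also have "\<dots> = {h 0, h 1} \<union> \<Union>(arc_ends ` F')"
      unfolding T(5) using int(2) by (auto simp: image_UN image_Un)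
    also have "\<dots> = \<Union>(arc_ends ` F)" using hends s0 by (auto simp: F'_def)
    finally show "\<Union>(arc_ends ` (`) h ` T) = \<Union>(arc_ends ` F)" .
  qed
qed

text \<open>
  For two arcs the gaps run crosswise: each of them joins an end of the one arc to an end of the
  other. This is the shape of the boundary of an edge disc.
\<close>

lemma circle_two_gaps:
  fixes C :: "'a::t2_space set"
  assumes C: "circle C" and s: "line_segment s" "s \<subseteq> C" "line_segment s'" "s' \<subseteq> C" "s \<inter> s' = {}"
  obtains t t' p p' q q' where "line_segment t" "line_segment t'" "t \<inter> t' = {}"
    "t \<union> t' = C - (arc_interior s \<union> arc_interior s')"
    "arc_ends s = {p,p'}" "arc_ends s' = {q,q'}" "arc_ends t = {p,q}" "arc_ends t' = {p',q'}"
proof -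
  obtain u where u: "line_segment u" "s \<union> u = C" "s \<inter> u = arc_ends s" "arc_ends u = arc_ends s"
    using circle_complementary_arc[OF C s(2,1)] by metis
  obtain h k where h: "homeomorphism {0..1::real} u h k" using line_segment_param u(1) by blast
  have hends: "arc_ends s = {h 0, h 1}" using arc_ends_param[OF h] u(4) by simp
  have "s' \<subseteq> u" using u(2) s by blast
  then obtain c d where cd: "0 \<le> c" "c < d" "d \<le> 1" "s' = h ` {c..d}" "arc_ends s' = {h c, h d}"
    using subarc_param[OF h _ s(3)] by metis
  have ne: "c \<noteq> 0" "d \<noteq> 1" using s(5) cd hends arc_ends_subset[of s] by auto
  have inj: "inj_on h {0..1}" using homeomorphism_inj_on h by blast
  have sub: "{0..c} \<subseteq> {0..1}" "{d..1} \<subseteq> {0..1}" using cd by auto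
  show ?thesis
  proof (rule that[of "h ` {0..c}" "h ` {d..1}" "h 0" "h 1" "h c" "h d"])
    show "line_segment (h ` {0..c})" "line_segment (h ` {d..1})"
      using line_segment_image[OF h sub(1)] line_segment_image[OF h sub(2)] line_segment_Icc cd ne by auto
    show "h ` {0..c} \<inter> h ` {d..1} = {}"
      using inj_on_image_Int[OF inj sub] cd by auto
    show "arc_ends s = {h 0, h 1}" "arc_ends s' = {h c, h d}" using hends cd by auto
    show "arc_ends (h ` {0..c}) = {h 0, h c}" "arc_ends (h ` {d..1}) = {h 1, h d}"
      using arc_ends_image[OF h sub(1)] arc_ends_image[OF h sub(2)] cd ne by (auto simp: arc_ends_Icc)
    have "arc_interior s' = h ` {c<..<d}"
    proof -
      have "arc_interior s' = h ` arc_interior {c..d}"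
        unfolding cd(4) using cd by (intro arc_interior_image[OF h]) auto
      moreover have "arc_interior {c..d} = {c<..<d}"
        using cd by (auto simp: arc_interior_def arc_ends_Icc)
      ultimately show ?thesis by simp
    qed
    moreover have "h ` ({0..1} - {c<..<d}) = h ` {0..1} - h ` {c<..<d}"
      using cd by (intro inj_on_image_set_diff[OF inj]) auto
    moreover have "{0..1} - {c<..<d} = {0..c} \<union> {d..1}" using cd by auto
    moreover have "h ` {0..1} = u" using h by (simp add: homeomorphism_def)
    ultimately have "h ` {0..c} \<union> h ` {d..1} = u - arc_interior s'" by (simp add: image_Un)
    moreover have "C - arc_interior s = u" using u(2,3) by (auto simp: arc_interior_def)
    ultimately show "h ` {0..c} \<union> h ` {d..1} = C - (arc_interior s \<union> arc_interior s')" by blast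
  qed
qed

text \<open>
  A set that contains each arc entirely or misses it contains both or none of the ends of the arc.
\<close>

lemma arc_system_parity:
  fixes T :: "'a::t2_space set set"
  assumes T: "arc_system T" and U: "\<And>t. t \<in> T \<Longrightarrow> t \<subseteq> U \<or> t \<inter> U = {}"
  shows "even (card (U \<inter> \<Union>(arc_ends ` T)))"
proof -
  let ?T = "{t \<in> T. t \<subseteq> U}"
  have "arc_ends t \<inter> U = {}" if "t \<in> T" "\<not> t \<subseteq> U" for t
    using U[OF that(1)] that arc_ends_subset[of t] by blast
  then have "U \<inter> \<Union>(arc_ends ` T) = (\<Union>t\<in>?T. arc_ends t)"
    using arc_ends_subset by blast
  also have "card \<dots> = (\<Sum>t\<in>?T. card (arc_ends t))"
  proof (rule card_UN_disjoint)
    show "finite ?T" using T by (simp add: arc_system_def)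
    show "\<forall>i\<in>?T. finite (arc_ends i)" using T line_segment_facts(6) by (auto simp: arc_system_def)
    show "\<forall>i\<in>?T. \<forall>j\<in>?T. i \<noteq> j \<longrightarrow> arc_ends i \<inter> arc_ends j = {}"
    proof (intro ballI impI)
      fix i j assume "i \<in> ?T" "j \<in> ?T" "i \<noteq> j"
      then have "i \<inter> j = {}" using T by (auto simp: arc_system_def pairwise_def disjnt_def)
      then show "arc_ends i \<inter> arc_ends j = {}" using arc_ends_subset[of i] arc_ends_subset[of j] by blast
    qed
  qed
  also have "\<dots> = (\<Sum>t\<in>?T. 2)"
    using T line_segment_facts(5) by (intro sum.cong) (auto simp: arc_system_def)
  finally show ?thesis by simp
qed

lemma component_contains_or_misses:
  assumes "U \<in> components X" "connected t" "t \<subseteq> X"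
  shows "t \<subseteq> U \<or> t \<inter> U = {}"
  using components_maximal[OF assms] by blast

section \<open>The boundary of a surface\<close>

lemma surface_boundary_subset: "surface_boundary S \<subseteq> S"
  by (auto simp: surface_boundary_def)

lemma surface_boundary_image:
  assumes "homeomorphism S T f g" "X \<subseteq> S"
  shows "surface_boundary (f ` X) = f ` surface_boundary X"
proof -
  have tr: "\<exists>V. openin (top_of_set B) V \<and> f x \<in> V \<and> V homeomorphic ball (0::complex) 1"
    if hom: "homeomorphism A B f g" and U: "openin (top_of_set A) U" "x \<in> U" "U homeomorphic ball (0::complex) 1"
    for A :: "'c::topological_space set" and B :: "'d::topological_space set" and f g x U
  proof (intro exI conjI)
    have "U \<subseteq> A" using U(1) openin_imp_subset by blast
    then have "U homeomorphic f ` U" using homeomorphism_restrict[OF hom] homeomorphic_def by blast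
    then show "f ` U homeomorphic ball (0::complex) 1" using U(3) by (meson homeomorphic_sym homeomorphic_trans)
    show "openin (top_of_set B) (f ` U)" using homeomorphism_imp_open_map[OF hom U(1)] .
  qed (use U in auto)
  have h: "homeomorphism X (f ` X) f g" by (rule homeomorphism_restrict[OF assms])
  then have h': "homeomorphism (f ` X) X g f" by (rule homeomorphism_symD)
  have gf: "g (f x) = x" if "x \<in> X" for x using h that by (simp add: homeomorphism_def)
  have "f x \<in> surface_boundary (f ` X) \<longleftrightarrow> x \<in> surface_boundary X" if "x \<in> X" for x
    using tr[OF h, of _ x] tr[OF h', of _ "f x"] that unfolding surface_boundary_def gf[OF that]
    by blast
  moreover have "surface_boundary (f ` X) \<subseteq> f ` X" "surface_boundary X \<subseteq> X"
    by (rule surface_boundary_subset)+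
  ultimately show ?thesis by blast
qed

text \<open>
  Whether a point lies on the boundary depends only on a neighbourhood of it: an open disc around
  the point can be shrunk, inside its own chart, to one that lies in the neighbourhood.
\<close>

lemma surface_boundary_local:
  fixes S :: "'a::topological_space set"
  assumes N: "N \<subseteq> S" and W: "openin (top_of_set S) W" "x \<in> W" "W \<subseteq> N"
  shows "x \<in> surface_boundary S \<longleftrightarrow> x \<in> surface_boundary N"
proof -
  have shrink: "\<exists>V\<subseteq>W. openin (top_of_set X) V \<and> x \<in> V \<and> V homeomorphic ball (0::complex) 1"
    if U: "openin (top_of_set X) U" "x \<in> U" "U homeomorphic ball (0::complex) 1"
      and W: "openin (top_of_set X) W" "x \<in> W" for X W U
  proof -
    obtain h k where h: "homeomorphism U (ball (0::complex) 1) h k"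
      using U(3) homeomorphic_def by blast
    then have k: "homeomorphism (ball (0::complex) 1) U k h" by (rule homeomorphism_symD)
    have "openin (top_of_set U) (U \<inter> W)"
      by (rule openin_subset_trans[OF openin_Int[OF U(1) W(1)] _ openin_imp_subset[OF U(1)]]) simp
    then have "openin (top_of_set (ball 0 1)) (h ` (U \<inter> W))"
      by (rule homeomorphism_imp_open_map[OF h])
    then have "open (h ` (U \<inter> W))" using openin_open_eq[of "ball 0 1"] open_ball by blast
    moreover have "h x \<in> h ` (U \<inter> W)" using U W by blast
    ultimately obtain r where r: "r > 0" "ball (h x) r \<subseteq> h ` (U \<inter> W)"
      using openE by blast
    have "h ` (U \<inter> W) \<subseteq> ball 0 1" using h unfolding homeomorphism_def by blast
    then have sub: "ball (h x) r \<subseteq> ball 0 1" using r(2) by blast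
    have "k ` ball (h x) r \<subseteq> k ` h ` (U \<inter> W)" using r(2) by blast
    moreover have "k ` h ` (U \<inter> W) = U \<inter> W" by (rule homeomorphism_image_back[OF h]) simp
    ultimately have "k ` ball (h x) r \<subseteq> W" by blast
    moreover have "openin (top_of_set U) (k ` ball (h x) r)"
      using homeomorphism_imp_open_map[OF k] sub by (metis open_ball openin_open_eq)
    then have "openin (top_of_set X) (k ` ball (h x) r)" using U(1) openin_trans by blast
    moreover have "x \<in> k ` ball (h x) r"
      using r(1) h U(2) by (intro image_eqI[of _ _ "h x"]) (auto simp: homeomorphism_def)
    moreover have "k ` ball (h x) r homeomorphic ball (0::complex) 1"
      using homeomorphism_restrict[OF k sub] r(1) homeomorphic_balls(1)[of r 1 "h x" 0]
      by (meson homeomorphic_def homeomorphic_sym homeomorphic_trans zero_less_one)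
    ultimately show ?thesis by blast
  qed
  have WN: "openin (top_of_set N) W" using openin_subset_trans[OF W(1,3) N] .
  have "(\<exists>U. openin (top_of_set S) U \<and> x \<in> U \<and> U homeomorphic ball (0::complex) 1) \<longleftrightarrow>
    (\<exists>U. openin (top_of_set N) U \<and> x \<in> U \<and> U homeomorphic ball (0::complex) 1)"
  proof
    assume "\<exists>U. openin (top_of_set S) U \<and> x \<in> U \<and> U homeomorphic ball (0::complex) 1"
    then obtain V where V: "V \<subseteq> W" "openin (top_of_set S) V" "x \<in> V" "V homeomorphic ball (0::complex) 1"
      using shrink[of S _ W] W(1,2) by blast
    then have "openin (top_of_set N) V" using openin_subset_trans[of S V N] N W(3) by blast
    then show "\<exists>U. openin (top_of_set N) U \<and> x \<in> U \<and> U homeomorphic ball (0::complex) 1" using V by blast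
  next
    assume "\<exists>U. openin (top_of_set N) U \<and> x \<in> U \<and> U homeomorphic ball (0::complex) 1"
    then obtain V where V: "V \<subseteq> W" "openin (top_of_set N) V" "x \<in> V" "V homeomorphic ball (0::complex) 1"
      using shrink[of N _ W] WN W(2) by blast
    then have "openin (top_of_set W) V" using openin_subset_trans[of N V W] W(3) by blast
    then have "openin (top_of_set S) V" using W(1) openin_trans by blast
    then show "\<exists>U. openin (top_of_set S) U \<and> x \<in> U \<and> U homeomorphic ball (0::complex) 1" using V by blast
  qed
  then show ?thesis using W N unfolding surface_boundary_def by blast
qed

text \<open>
  In the plane the manifold boundary can be read off: by invariance of domain an open disc in
  \<open>T\<close> is open in the plane.
\<close>

lemma surface_boundary_plane:
  fixes T :: "complex set"
  shows "surface_boundary T = T - interior T"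
proof -
  have "(\<exists>U. openin (top_of_set T) U \<and> x \<in> U \<and> U homeomorphic ball (0::complex) 1) \<longleftrightarrow> x \<in> interior T" for x
  proof
    assume "\<exists>U. openin (top_of_set T) U \<and> x \<in> U \<and> U homeomorphic ball (0::complex) 1"
    then obtain U h k where U: "openin (top_of_set T) U" "x \<in> U" "homeomorphism U (ball (0::complex) 1) h k"
      unfolding homeomorphic_def by (elim exE conjE) (rule that)
    have "open (k ` ball 0 1)"
      using U(3) by (intro invariance_of_domain homeomorphism_inj_on[OF homeomorphism_symD[OF U(3)]])
        (auto simp: homeomorphism_def)
    then have "open U" using U(3) by (simp add: homeomorphism_def)
    then show "x \<in> interior T" using interior_maximal[OF openin_imp_subset[OF U(1)]] U(2) by blast
  next
    assume "x \<in> interior T"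
    then obtain r where r: "r > 0" "ball x r \<subseteq> T" using mem_interior by blast
    then have "openin (top_of_set T) (ball x r)" by (intro open_subset) auto
    then show "\<exists>U. openin (top_of_set T) U \<and> x \<in> U \<and> U homeomorphic ball (0::complex) 1"
      using r homeomorphic_balls(1)[of r 1 x 0] by (intro exI[of _ "ball x r"]) auto
  qed
  then show ?thesis by (auto simp: surface_boundary_def)
qed

lemma disc_param:
  assumes "disc D"
  obtains h k where "homeomorphism D (cball (0::complex) 1) h k" "surface_boundary D = k ` sphere 0 1"
proof -
  obtain h k where h: "homeomorphism D (cball (0::complex) 1) h k"
    using assms by (auto simp: disc_def homeomorphic_def)
  have "surface_boundary (k ` cball 0 1) = k ` surface_boundary (cball 0 1)"
    by (rule surface_boundary_image[OF homeomorphism_symD[OF h]]) simp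
  moreover have "k ` cball 0 1 = D" using h by (simp add: homeomorphism_def)
  moreover have "surface_boundary (cball (0::complex) 1) = sphere 0 1"
    by (auto simp: surface_boundary_plane)
  ultimately show ?thesis using h that by simp
qed

lemma disc_facts:
  fixes D :: "'a::t2_space set"
  assumes "disc D"
  shows "compact D" "closed D" "connected D" "D \<noteq> {}" "circle (surface_boundary D)"
proof -
  obtain h k where h: "homeomorphism D (cball (0::complex) 1) h k" "surface_boundary D = k ` sphere 0 1"
    using disc_param assms by blast
  show "compact D" using assms homeomorphic_compactness[of D "cball (0::complex) 1"] by (simp add: disc_def)
  then show "closed D" by (rule compact_imp_closed)
  show "connected D" using assms homeomorphic_connectedness[of D "cball (0::complex) 1"] by (simp add: disc_def)
  show "D \<noteq> {}" using assms homeomorphic_empty by (force simp: disc_def)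
  have "homeomorphism (sphere 0 1) (k ` sphere 0 1) k h"
    by (rule homeomorphism_restrict[OF homeomorphism_symD[OF h(1)]]) auto
  then show "circle (surface_boundary D)"
    unfolding circle_def h(2) using homeomorphic_def homeomorphic_sym by blast
qed

lemma circle_facts:
  fixes C :: "'a::t2_space set"
  assumes "circle C"
  shows "compact C" "closed C" "connected C" "C \<noteq> {}"
proof -
  show "compact C" using assms homeomorphic_compactness[of C "sphere (0::complex) 1"] by (simp add: circle_def)
  then show "closed C" by (rule compact_imp_closed)
  show "connected C" using assms homeomorphic_connectedness[of C "sphere (0::complex) 1"]
    by (simp add: circle_def connected_sphere)
  have "(1::complex) \<in> sphere 0 1" by simp
  then have "sphere (0::complex) 1 \<noteq> {}" by blast
  then show "C \<noteq> {}" using assms homeomorphic_empty by (metis circle_def)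
qed

text \<open>
  Coning a homeomorphism of the circle extends it to the disc (the Alexander trick).
\<close>

lemma cone_extension:
  fixes k :: "complex \<Rightarrow> complex"
  assumes k: "continuous_on (sphere 0 1) k" "inj_on k (sphere 0 1)" "k ` sphere 0 1 = sphere 0 1"
  obtains K where "continuous_on (cball 0 1) K" "inj_on K (cball 0 1)" "K ` cball 0 1 = cball 0 1"
    "\<And>z. z \<in> sphere 0 1 \<Longrightarrow> K z = k z" "\<And>z. z \<in> cball 0 1 \<Longrightarrow> norm (K z) = norm z"
proof -
  define K where "K z = norm z *\<^sub>R k (sgn z)" for z
  have nk: "norm (k z) = 1" if "norm z = 1" for z using k(3) that by force
  have sg: "norm (sgn z) = 1" if "z \<noteq> 0" for z :: complex using that by (simp add: norm_sgn)
  have nK: "norm (K z) = norm z" for z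
    using nk sg by (cases "z = 0") (auto simp: K_def)
  have cont: "continuous (at z within cball 0 1) K" if z: "z \<in> cball 0 1" for z
  proof (cases "z = 0")
    case True
    have "((\<lambda>w. norm (K w)) \<longlongrightarrow> 0) (at 0 within cball 0 1)"
      unfolding nK by (intro tendsto_eq_intros) auto
    then have "(K \<longlongrightarrow> 0) (at 0 within cball 0 1)" by (rule tendsto_norm_zero_cancel)
    moreover have "K 0 = 0" by (simp add: K_def)
    ultimately show ?thesis unfolding True continuous_within by simp
  next
    case False
    have "continuous_on (cball 0 1 - {0}) (\<lambda>z. k (sgn z))"
      by (rule continuous_on_compose2[OF k(1)]) (auto intro!: continuous_intros simp: norm_sgn split: if_splits)
    then have "continuous_on (cball 0 1 - {0}) K" unfolding K_def by (intro continuous_intros)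
    then have "continuous (at z within (cball 0 1 - {0})) K"
      using z False by (auto simp: continuous_on_eq_continuous_within)
    moreover have "at z within cball 0 1 = at z within (cball 0 1 - {0})"
      using False by (intro at_within_nhd[of _ "- {0}"]) auto
    ultimately show ?thesis by simp
  qed
  have inj: "inj_on K (cball 0 1)"
  proof (rule inj_onI)
    fix x y assume "K x = K y"
    then have n: "norm x = norm y" using nK by metis
    show "x = y"
    proof (cases "x = 0")
      case True then show ?thesis using n by simp
    next
      case False
      then have "y \<noteq> 0" using n by auto
      have "k (sgn x) = k (sgn y)" using \<open>K x = K y\<close> n False \<open>y \<noteq> 0\<close> by (simp add: K_def)
      then have "sgn x = sgn y" using k(2) sg[OF False] sg[OF \<open>y \<noteq> 0\<close>] by (simp add: inj_on_def)
      then show ?thesis using n by (metis sgn_div_norm scaleR_scaleR False norm_eq_zero right_inverse scaleR_one)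
    qed
  qed
  have onto: "K ` cball 0 1 = cball 0 1"
  proof
    show "K ` cball 0 1 \<subseteq> cball 0 1" using nK by auto
    show "cball 0 1 \<subseteq> K ` cball 0 1"
    proof
      fix w :: complex assume w: "w \<in> cball 0 1"
      show "w \<in> K ` cball 0 1"
      proof (cases "w = 0")
        case True then show ?thesis by (intro image_eqI[of _ _ 0]) (auto simp: K_def)
      next
        case False
        then have "sgn w \<in> k ` sphere 0 1" using k(3) sg by simp
        then obtain u where u: "norm u = 1" "k u = sgn w" by auto
        have "sgn (norm w *\<^sub>R u) = u" using False u by (simp add: sgn_div_norm)
        then have "K (norm w *\<^sub>R u) = w" using u by (simp add: K_def sgn_div_norm False)
        then show ?thesis using w u by (intro image_eqI[of _ _ "norm w *\<^sub>R u"]) auto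
      qed
    qed
  qed
  show ?thesis
  proof (rule that[OF _ inj onto])
    show "continuous_on (cball 0 1) K" using cont by (simp add: continuous_on_eq_continuous_within)
    show "K z = k z" if "z \<in> sphere 0 1" for z using that by (simp add: K_def sgn_div_norm)
  qed (rule nK)
qed

text \<open>
  A disc with a parametrised arc on its boundary can be flattened to the upper half disc so that
  the arc becomes the diameter with the given parametrisation. First the boundary circle is mapped
  to the unit circle with the arc on the lower semicircle, the complementary arc on the upper one;
  this map is coned over the disc; finally the disc is pushed onto its upper half. Prescribing the
  parametrisation makes the charts of two discs with a common boundary arc match.
\<close>

lemma half_disc_chart:
  fixes D :: "'a::t2_space set"
  assumes D: "disc D" and s: "s \<subseteq> surface_boundary D"
    and g: "homeomorphism s {-1..1::real} g g'"
  obtains K where "continuous_on D K" "inj_on K D" "K ` D = {z. norm z \<le> 1 \<and> 0 \<le> Im z}"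
    "\<forall>x\<in>s. K x = complex_of_real (g x)" "\<forall>x\<in>D. Im (K x) = 0 \<longleftrightarrow> x \<in> s"
proof -
  obtain h h' where h: "homeomorphism D (cball (0::complex) 1) h h'" "surface_boundary D = h' ` sphere 0 1"
    using disc_param D by blast
  have h': "homeomorphism (cball (0::complex) 1) D h' h" using h(1) by (rule homeomorphism_symD)
  have sD: "s \<subseteq> D" using s surface_boundary_subset by blast
  define S where "S = h ` s"
  have S_sub: "S \<subseteq> sphere 0 1"
  proof -
    have "h ` s \<subseteq> h ` h' ` sphere 0 1" using s h(2) by blast
    also have "h ` h' ` sphere 0 1 = sphere 0 1" by (rule homeomorphism_image_back[OF h']) auto
    finally show ?thesis by (simp add: S_def)
  qed
  have hS: "homeomorphism S s h' h"
    unfolding S_def by (rule homeomorphism_symD[OF homeomorphism_restrict[OF h(1) sD]])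
  have g1: "homeomorphism S {-1..1} (g \<circ> h') (h \<circ> g')" by (rule homeomorphism_compose[OF hS g])
  define u where "u = g \<circ> h'"
  note u = g1[folded u_def]
  have lS: "line_segment S"
    using u homeomorphic_closed_intervals_real[of "-1" 1 0 1] unfolding line_segment_def
    by (meson homeomorphic_def homeomorphic_trans neg_less_0_iff_less zero_less_one less_trans)
  obtain t where t: "line_segment t" "S \<union> t = sphere 0 1" "S \<inter> t = arc_ends S" "arc_ends t = arc_ends S"
    using sphere_complementary_arc[OF S_sub lS] .
  have ends11: "arc_ends {-1..1::real} = {-1,1}" by (simp add: arc_ends_Icc)
  have ends: "w ` arc_ends Y = {-1,1}" if "homeomorphism Y {-1..1::real} w w'" for w w' and Y :: "complex set"
    using arc_ends_image[OF that, of Y] that ends11 by (simp add: homeomorphism_def)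
  obtain v0 v0' where v0: "homeomorphism t {-1..1::real} v0 v0'"
    using t(1) homeomorphic_closed_intervals_real[of 0 1 "-1" 1] unfolding line_segment_def
    by (meson homeomorphic_def homeomorphic_trans neg_less_0_iff_less zero_less_one less_trans)
  \<comment> \<open>Reversing the complementary arc if necessary, both parametrisations agree at the ends.\<close>
  obtain v v' where v: "homeomorphism t {-1..1::real} v v'" "\<And>x. x \<in> arc_ends S \<Longrightarrow> v x = u x"
  proof -
    obtain a b where ab: "arc_ends S = {a,b}" "a \<noteq> b"
      using line_segment_facts(5)[OF lS] by (meson card_2_iff)
    have "{v0 a, v0 b} = {-1,1}" "{u a, u b} = {-1,1}"
      using ends[OF v0] ends[OF u] t(4) ab by auto
    then consider "v0 a = u a" "v0 b = u b" | "- v0 a = u a" "- v0 b = u b"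
      by (auto simp: doubleton_eq_iff)
    then show ?thesis
    proof cases
      case 1 then show ?thesis using that[OF v0] ab by auto
    next
      case 2
      have "homeomorphism {-1..1::real} {-1..1} uminus uminus"
        by (auto simp: homeomorphism_def intro!: continuous_intros)
      from that[OF homeomorphism_compose[OF v0 this]] show ?thesis using 2 ab by auto
    qed
  qed
  \<comment> \<open>The lower and the upper unit semicircle, parametrised by the real part.\<close>
  define low up where "low = (\<lambda>r. Complex r (- sqrt (1 - r\<^sup>2)))" and "up = (\<lambda>r. Complex r (sqrt (1 - r\<^sup>2)))"
  have low_up: "low r = up r" if "r \<in> {-1,1}" for r using that by (auto simp: low_def up_def)
  have norm: "norm (low r) = 1" "norm (up r) = 1" if "r \<in> {-1..1}" for r
    using that by (auto simp: low_def up_def cmod_def abs_square_le_1)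
  have cont: "continuous_on {-1..1} low" "continuous_on {-1..1} up"
    unfolding low_def up_def by (auto intro!: continuous_intros simp: Complex_eq)
  have ru: "u x \<in> {-1..1}" if "x \<in> S" for x using u that by (auto simp: homeomorphism_def)
  have rv: "v x \<in> {-1..1}" if "x \<in> t" for x using v(1) that by (auto simp: homeomorphism_def)
  define k where "k x = (if x \<in> S then low (u x) else up (v x))" for x
  have k_t: "k x = up (v x)" if "x \<in> t" for x
  proof (cases "x \<in> S")
    case True
    then have "x \<in> arc_ends S" using t(3) that by blast
    moreover from this have "u x \<in> {-1,1}" using ends[OF u] by blast
    ultimately show ?thesis using v(2) low_up True by (simp add: k_def)
  qed (simp add: k_def)
  have k_cont: "continuous_on (sphere 0 1) k"
    unfolding t(2)[symmetric]
  proof (rule continuous_on_closed_Un)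
    have "continuous_on S (\<lambda>x. low (u x))"
      using u ru by (intro continuous_on_compose2[OF cont(1)]) (auto simp: homeomorphism_def)
    then show "continuous_on S k" by (simp add: k_def cong: continuous_on_cong)
    have "continuous_on t (\<lambda>x. up (v x))"
      using v(1) rv by (intro continuous_on_compose2[OF cont(2)]) (auto simp: homeomorphism_def)
    then show "continuous_on t k" using k_t by (simp cong: continuous_on_cong)
  qed (use line_segment_facts t(1) lS in auto)
  have up_S: "x \<in> S" if "x \<in> t" "up (v x) = low r" "r \<in> {-1..1}" for x r
  proof -
    have "v x = r" "sqrt (1 - (v x)\<^sup>2) = - sqrt (1 - r\<^sup>2)" using that by (auto simp: low_def up_def)
    then have "sqrt (1 - r\<^sup>2) = 0" by simp
    then have "r\<^sup>2 = 1" by simp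
    then have "v x \<in> {-1,1}" using \<open>v x = r\<close> by (auto simp: power2_eq_1_iff)
    then obtain y where y: "y \<in> arc_ends t" "v x = v y" using ends[OF v(1)] by (metis imageE)
    then have "x = y" using homeomorphism_inj_on[OF v(1)] that arc_ends_subset[of t] by (metis inj_onD subsetD)
    then show ?thesis using y t(3,4) by blast
  qed
  have k_inj: "inj_on k (sphere 0 1)"
  proof (rule inj_onI)
    fix x y assume xy: "x \<in> sphere 0 1" "y \<in> sphere 0 1" "k x = k y"
    have iu: "x = y" if "x \<in> S" "y \<in> S" "u x = u y" for x y
      using homeomorphism_inj_on[OF u] that by (simp add: inj_onD)
    have iv: "x = y" if "x \<in> t" "y \<in> t" "v x = v y" for x y
      using homeomorphism_inj_on[OF v(1)] that by (simp add: inj_onD)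
    consider "x \<in> S" "y \<in> S" | "x \<in> S" "y \<in> t" "y \<notin> S" | "x \<in> t" "x \<notin> S" "y \<in> S" | "x \<in> t" "y \<in> t"
      using xy t(2) by blast
    then show "x = y"
    proof cases
      case 1 then show ?thesis using xy iu by (simp add: k_def low_def)
    next
      case 2 then show ?thesis using xy(3) up_S[of y "u x"] ru[of x] by (simp add: k_def)
    next
      case 3 then show ?thesis using xy(3) up_S[of x "u y"] ru[of y] by (simp add: k_def)
    next
      case 4 then show ?thesis using xy(3) iv by (simp add: k_t up_def)
    qed
  qed
  have k_onto: "k ` sphere 0 1 = sphere 0 1"
  proof
    have "norm (k x) = 1" if "x \<in> S \<union> t" for x
      using that norm ru rv k_t by (cases "x \<in> S") (simp_all add: k_def)
    then show "k ` sphere 0 1 \<subseteq> sphere 0 1" using t(2) by auto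
    show "sphere 0 1 \<subseteq> k ` sphere 0 1"
    proof
      fix z :: complex assume "z \<in> sphere 0 1"
      then have z: "(Re z)\<^sup>2 + (Im z)\<^sup>2 = 1" by (simp add: cmod_def)
      then have eq: "(Im z)\<^sup>2 = 1 - (Re z)\<^sup>2" by simp
      have "(Re z)\<^sup>2 \<le> 1" using z zero_le_power2[of "Im z"] by linarith
      then have re: "Re z \<in> {-1..1}" by (simp add: abs_square_le_1 abs_le_iff)
      show "z \<in> k ` sphere 0 1"
      proof (cases "Im z \<le> 0")
        case True
        then have "sqrt (1 - (Re z)\<^sup>2) = - Im z" unfolding eq[symmetric] by simp
        then have "z = low (Re z)" by (simp add: low_def complex_eq_iff)
        moreover obtain x where "x \<in> S" "u x = Re z" using homeomorphism_image1[OF u] re by (metis imageE)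
        ultimately show ?thesis using t(2) by (intro image_eqI[of _ _ x]) (auto simp: k_def)
      next
        case False
        then have "sqrt (1 - (Re z)\<^sup>2) = Im z" unfolding eq[symmetric] by simp
        then have "z = up (Re z)" by (simp add: up_def complex_eq_iff)
        moreover obtain x where "x \<in> t" "v x = Re z" using homeomorphism_image1[OF v(1)] re by (metis imageE)
        ultimately show ?thesis using t(2) by (intro image_eqI[of _ _ x]) (auto simp: k_t)
      qed
    qed
  qed
  obtain K0 where K0: "continuous_on (cball 0 1) K0" "inj_on K0 (cball 0 1)" "K0 ` cball 0 1 = cball 0 1"
    "\<And>z. z \<in> sphere 0 1 \<Longrightarrow> K0 z = k z" "\<And>z. z \<in> cball 0 1 \<Longrightarrow> norm (K0 z) = norm z"
    using cone_extension[OF k_cont k_inj k_onto] by metis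
  \<comment> \<open>Moving every vertical chord of the disc affinely onto its upper half flattens the lower semicircle.\<close>
  define P where "P z = Complex (Re z) ((Im z + sqrt (1 - (Re z)\<^sup>2)) / 2)" for z
  have disc_eq: "norm z \<le> 1 \<longleftrightarrow> (Re z)\<^sup>2 \<le> 1 \<and> \<bar>Im z\<bar> \<le> sqrt (1 - (Re z)\<^sup>2)" for z :: complex
  proof -
    have "norm z \<le> 1 \<longleftrightarrow> (Re z)\<^sup>2 + (Im z)\<^sup>2 \<le> 1" by (simp add: cmod_def)
    also have "\<dots> \<longleftrightarrow> (Im z)\<^sup>2 \<le> 1 - (Re z)\<^sup>2" by linarith
    also have "\<dots> \<longleftrightarrow> (Re z)\<^sup>2 \<le> 1 \<and> \<bar>Im z\<bar> \<le> sqrt (1 - (Re z)\<^sup>2)"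
    proof
      assume a: "(Im z)\<^sup>2 \<le> 1 - (Re z)\<^sup>2"
      then have "sqrt ((Im z)\<^sup>2) \<le> sqrt (1 - (Re z)\<^sup>2)" by (rule real_sqrt_le_mono)
      moreover have "(Re z)\<^sup>2 \<le> 1" using a zero_le_power2[of "Im z"] by linarith
      ultimately show "(Re z)\<^sup>2 \<le> 1 \<and> \<bar>Im z\<bar> \<le> sqrt (1 - (Re z)\<^sup>2)" by simp
    next
      assume a: "(Re z)\<^sup>2 \<le> 1 \<and> \<bar>Im z\<bar> \<le> sqrt (1 - (Re z)\<^sup>2)"
      then have "\<bar>Im z\<bar>\<^sup>2 \<le> (sqrt (1 - (Re z)\<^sup>2))\<^sup>2" by (intro power_mono) auto
      then show "(Im z)\<^sup>2 \<le> 1 - (Re z)\<^sup>2" using a by simp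
    qed
    finally show ?thesis .
  qed
  have P_cont: "continuous_on (cball 0 1) P"
    unfolding P_def Complex_eq by (intro continuous_intros) auto
  have P_inj: "inj_on P (cball 0 1)"
    by (rule inj_onI) (auto simp: P_def complex_eq_iff)
  have P_onto: "P ` cball 0 1 = {z. norm z \<le> 1 \<and> 0 \<le> Im z}"
  proof
    show "P ` cball 0 1 \<subseteq> {z. norm z \<le> 1 \<and> 0 \<le> Im z}"
    proof
      fix w assume "w \<in> P ` cball 0 1"
      then obtain z where z: "norm z \<le> 1" "w = P z" by auto
      then have "0 \<le> Im w" "\<bar>Im w\<bar> \<le> sqrt (1 - (Re w)\<^sup>2)" "(Re w)\<^sup>2 \<le> 1"
        using disc_eq[of z] by (auto simp: P_def)
      then show "w \<in> {z. norm z \<le> 1 \<and> 0 \<le> Im z}" using disc_eq[of w] by simp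
    qed
    show "{z. norm z \<le> 1 \<and> 0 \<le> Im z} \<subseteq> P ` cball 0 1"
    proof
      fix w :: complex assume w: "w \<in> {z. norm z \<le> 1 \<and> 0 \<le> Im z}"
      define z where "z = Complex (Re w) (2 * Im w - sqrt (1 - (Re w)\<^sup>2))"
      have "norm z \<le> 1" using w disc_eq[of w] disc_eq[of z] by (auto simp: z_def)
      moreover have "P z = w" by (simp add: P_def z_def complex_eq_iff)
      ultimately show "w \<in> P ` cball 0 1" by (intro image_eqI[of _ _ z]) auto
    qed
  qed
  have P_low: "P (low r) = of_real r" for r by (simp add: P_def low_def complex_eq_iff)
  have P_0: "z = low (Re z)" if "Im (P z) = 0" for z
    using that by (simp add: P_def low_def complex_eq_iff)
  have h_ran: "h x \<in> cball 0 1" if "x \<in> D" for x using h(1) that by (auto simp: homeomorphism_def)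
  have hD: "h ` D = cball 0 1" using h(1) by (simp add: homeomorphism_def)
  define K where "K = P \<circ> K0 \<circ> h"
  show ?thesis
  proof (rule that[of K])
    have ch: "continuous_on D h" using h(1) by (simp add: homeomorphism_def)
    show "continuous_on D K" unfolding K_def
      using ch K0(1) P_cont hD K0(3) by (intro continuous_on_compose) (simp_all add: image_comp[symmetric])
    show "inj_on K D" unfolding K_def
      using homeomorphism_inj_on[OF h(1)] K0(2) P_inj hD K0(3) by (intro comp_inj_on) (simp_all add: image_comp[symmetric])
    show "K ` D = {z. norm z \<le> 1 \<and> 0 \<le> Im z}"
      unfolding K_def image_comp[symmetric] hD K0(3) P_onto ..
    have Ks: "K x = complex_of_real (g x)" if "x \<in> s" for x
    proof -
      have "h x \<in> S" using that by (simp add: S_def)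
      moreover have "h' (h x) = x" using h(1) that sD by (auto simp: homeomorphism_def)
      ultimately show ?thesis using S_sub K0(4)[of "h x"] P_low by (auto simp: K_def k_def u_def)
    qed
    then show "\<forall>x\<in>s. K x = complex_of_real (g x)" by blast
    have "Im (K x) = 0 \<longleftrightarrow> x \<in> s" if x: "x \<in> D" for x
    proof
      assume "x \<in> s" then show "Im (K x) = 0" using Ks by simp
    next
      assume "Im (K x) = 0"
      then have l: "K0 (h x) = low (Re (K0 (h x)))" using P_0 by (simp add: K_def)
      have "norm (K0 (h x)) \<le> 1" using K0(5)[OF h_ran[OF x]] h_ran[OF x] by simp
      then have r: "Re (K0 (h x)) \<in> {-1..1}" using abs_Re_le_cmod[of "K0 (h x)"] by auto
      then have "norm (K0 (h x)) = 1" using l norm(1) by metis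
      then have sp: "h x \<in> sphere 0 1" using K0(5)[OF h_ran[OF x]] by simp
      have "h x \<in> S"
      proof (rule ccontr)
        assume "h x \<notin> S"
        then have "h x \<in> t" using sp t(2) by blast
        moreover have "up (v (h x)) = low (Re (K0 (h x)))" using l K0(4)[OF sp] k_t[OF \<open>h x \<in> t\<close>] by simp
        ultimately show False using up_S r \<open>h x \<notin> S\<close> by blast
      qed
      then obtain y where "y \<in> s" "h x = h y" by (auto simp: S_def)
      then show "x \<in> s" using homeomorphism_inj_on[OF h(1)] x sD by (metis inj_onD subsetD)
    qed
    then show "\<forall>x\<in>D. Im (K x) = 0 \<longleftrightarrow> x \<in> s" by blast
  qed
qed

lemma openin_Diff_closed: "closed R \<Longrightarrow> openin (top_of_set S) (S - R)"
  by (simp add: Diff_eq openin_open_Int open_Compl)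

text \<open>
  The half-disc charts of the two discs, one of them reflected, fit together along
  \<open>s\<close>. They map a neighbourhood of \<open>x\<close> onto a plane region in which the
  inner points of \<open>s\<close> are interior, while the ends of \<open>s\<close> go to
  \<open>1\<close> and \<open>-1\<close> on the frontier. The set \<open>s'\<close> accounts for
  other arcs along which the same two discs meet, \<open>R\<close> for the rest of the surface.
\<close>

lemma boundary_along_arc:
  fixes S :: "'a::t2_space set"
  assumes D: "disc D" "disc D'" "D \<union> D' \<subseteq> S" "S \<subseteq> D \<union> D' \<union> R" "closed R"
    and s: "line_segment s" "s \<subseteq> surface_boundary D" "s \<subseteq> surface_boundary D'"
    and s': "closed s'" "s \<inter> s' = {}" "D \<inter> D' \<subseteq> s \<union> s'"
    and x: "x \<in> s" "x \<notin> R"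
  shows "x \<in> surface_boundary S \<longleftrightarrow> x \<in> arc_ends s"
proof -
  have "s homeomorphic {-1..1::real}"
    using s(1) homeomorphic_closed_intervals_real[of 0 1 "-1" 1] unfolding line_segment_def
    by (meson homeomorphic_trans neg_less_0_iff_less zero_less_one less_trans)
  then obtain g g' where g: "homeomorphism s {-1..1::real} g g'" by (auto simp: homeomorphic_def)
  obtain K1 where K1: "continuous_on D K1" "inj_on K1 D" "K1 ` D = {z. norm z \<le> 1 \<and> 0 \<le> Im z}"
    and K1': "\<forall>x\<in>s. K1 x = complex_of_real (g x)" "\<forall>x\<in>D. Im (K1 x) = 0 \<longleftrightarrow> x \<in> s"
    using half_disc_chart[OF D(1) s(2) g] .
  note K1 = K1 K1'[rule_format]
  obtain K2 where K2: "continuous_on D' K2" "inj_on K2 D'" "K2 ` D' = {z. norm z \<le> 1 \<and> 0 \<le> Im z}"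
    and K2': "\<forall>x\<in>s. K2 x = complex_of_real (g x)" "\<forall>x\<in>D'. Im (K2 x) = 0 \<longleftrightarrow> x \<in> s"
    using half_disc_chart[OF D(2) s(3) g] .
  note K2 = K2 K2'[rule_format]
  have sD: "s \<subseteq> D" "s \<subseteq> D'" using s surface_boundary_subset by blast+
  have Im1: "norm (K1 y) \<le> 1" "0 \<le> Im (K1 y)" if "y \<in> D" for y using K1(3) that by blast+
  have Im2: "norm (K2 y) \<le> 1" "0 \<le> Im (K2 y)" if "y \<in> D'" for y using K2(3) that by blast+
  have cIm: "continuous_on D' (\<lambda>y. Im (K2 y))" using K2(1) by (intro continuous_intros)
  \<comment> \<open>Only a strip of the second disc along \<open>s\<close> is used, so that it meets the first disc in \<open>s\<close> alone.\<close>
  obtain \<delta> where \<delta>: "\<delta> > 0" "\<And>y. y \<in> s' \<inter> D' \<Longrightarrow> \<delta> < Im (K2 y)"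
  proof (cases "s' \<inter> D' = {}")
    case True then show ?thesis using that[of 1] by simp
  next
    case False
    have "compact (s' \<inter> D')" using s'(1) disc_facts(1)[OF D(2)] by (rule closed_Int_compact)
    then obtain y0 where y0: "y0 \<in> s' \<inter> D'" "\<And>y. y \<in> s' \<inter> D' \<Longrightarrow> Im (K2 y0) \<le> Im (K2 y)"
      using continuous_attains_inf[OF _ False, of "\<lambda>y. Im (K2 y)"] continuous_on_subset[OF cIm] by blast
    have "y0 \<notin> s" using y0(1) s'(2) by blast
    then have "Im (K2 y0) > 0" using Im2(2)[of y0] K2(5)[of y0] y0(1) by force
    then show ?thesis using that[of "Im (K2 y0) / 2"] y0(2) by force
  qed
  define B where "B = {y \<in> D'. Im (K2 y) \<le> \<delta>}"
  have comp: "compact {y \<in> D'. Im (K2 y) \<in> J}" if "closed J" for J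
  proof -
    have "closed (D' \<inter> (\<lambda>y. Im (K2 y)) -` J)"
      using continuous_on_closed_vimage[OF disc_facts(2)[OF D(2)], of "\<lambda>y. Im (K2 y)"] cIm that
      by (simp add: Int_commute)
    then have "compact (D' \<inter> (D' \<inter> (\<lambda>y. Im (K2 y)) -` J))"
      by (rule compact_Int_closed[OF disc_facts(1)[OF D(2)]])
    moreover have "D' \<inter> (D' \<inter> (\<lambda>y. Im (K2 y)) -` J) = {y \<in> D'. Im (K2 y) \<in> J}" by auto
    ultimately show ?thesis by simp
  qed
  have B: "compact B" using comp[of "{..\<delta>}"] by (simp add: B_def)
  have DB: "D \<inter> B = s"
  proof
    show "D \<inter> B \<subseteq> s" using s'(3) \<delta>(2) unfolding B_def by fastforce
    show "s \<subseteq> D \<inter> B" using sD K2(5) \<delta>(1) unfolding B_def by fastforce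
  qed
  define K where "K y = (if y \<in> D then K1 y else cnj (K2 y))" for y
  have KB: "K y = cnj (K2 y)" if "y \<in> B" for y
    using that DB K1(4) K2(4) by (cases "y \<in> D") (auto simp: K_def)
  have K_cont: "continuous_on (D \<union> B) K"
  proof (rule continuous_on_closed_Un)
    show "continuous_on D K" using K1(1) by (simp add: K_def cong: continuous_on_cong)
    have "continuous_on B (\<lambda>y. cnj (K2 y))"
      using continuous_on_subset[OF K2(1), of B] by (intro continuous_intros) (auto simp: B_def)
    then show "continuous_on B K" using KB by (simp cong: continuous_on_cong)
  qed (use disc_facts(2)[OF D(1)] B compact_imp_closed in auto)
  have K_inj: "inj_on K (D \<union> B)"
  proof (rule inj_onI)
    \<comment> \<open>A common value of the chart and the reflected chart is real, hence the image of a point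
      of \<open>s\<close>.\<close>
    have DB': "y = z" if "y \<in> D" "z \<in> B" "K y = K z" for y z
    proof -
      have zD: "z \<in> D'" using that(2) by (simp add: B_def)
      have eq: "K1 y = cnj (K2 z)" using that KB by (simp add: K_def)
      then have "Im (K1 y) = - Im (K2 z)" by simp
      then have "Im (K1 y) = 0" using Im1(2)[OF that(1)] Im2(2)[OF zD] by linarith
      moreover from this have "Im (K2 z) = 0" using eq by simp
      ultimately have "y \<in> s" "z \<in> s" using K1(5) K2(5) that zD by auto
      then have "K2 y = K2 z" using eq K1(4) K2(4) by simp
      then show "y = z" using K2(2) \<open>y \<in> s\<close> sD zD by (auto simp: inj_on_def)
    qed
    fix y z assume yz: "y \<in> D \<union> B" "z \<in> D \<union> B" "K y = K z"
    consider "y \<in> D" "z \<in> D" | "y \<in> D" "z \<in> B" | "y \<in> B" "z \<in> D" | "y \<in> B" "z \<in> B" using yz by blast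
    then show "y = z"
    proof cases
      case 1 then show ?thesis using yz(3) K1(2) by (simp add: K_def inj_on_def)
    next
      case 2 then show ?thesis using DB' yz(3) by blast
    next
      case 3 then show ?thesis using DB'[of z y] yz(3) by simp
    next
      case 4 then show ?thesis using yz(3) KB K2(2) by (simp add: B_def inj_on_def)
    qed
  qed
  define T where "T = {z. norm z \<le> 1 \<and> - \<delta> \<le> Im z}"
  have T: "K ` (D \<union> B) = T"
  proof
    have "K y \<in> T" if "y \<in> D" for y using Im1[OF that] that \<delta>(1) by (simp add: K_def T_def)
    moreover have "K y \<in> T" if "y \<in> B" for y
      using Im2[of y] KB[OF that] that by (simp add: T_def B_def)
    ultimately show "K ` (D \<union> B) \<subseteq> T" by blast
    show "T \<subseteq> K ` (D \<union> B)"
    proof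
      fix z assume z: "z \<in> T"
      show "z \<in> K ` (D \<union> B)"
      proof (cases "0 \<le> Im z")
        case True
        then have "z \<in> K1 ` D" using z K1(3) by (simp add: T_def)
        then show ?thesis by (force simp: K_def)
      next
        case False
        then have "cnj z \<in> K2 ` D'" using z K2(3) by (simp add: T_def)
        then obtain y where y: "y \<in> D'" "cnj z = K2 y" by blast
        then have "Im (K2 y) = - Im z" by (metis cnj.simps(2))
        then have "y \<in> B" using z y(1) by (simp add: T_def B_def)
        moreover have "K y = z" using KB[OF \<open>y \<in> B\<close>] y(2)[symmetric] by simp
        ultimately show ?thesis by blast
      qed
    qed
  qed
  obtain L where L: "homeomorphism (D \<union> B) T K L"
    using homeomorphism_compact[OF compact_Un[OF disc_facts(1)[OF D(1)] B] K_cont T K_inj] by blast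
  have xN: "x \<in> D \<union> B" using x sD by blast
  have Kx: "K x = of_real (g x)" using x(1) sD K1(4) by (auto simp: K_def)
  have "x \<in> surface_boundary S \<longleftrightarrow> x \<in> surface_boundary (D \<union> B)"
  proof (rule surface_boundary_local)
    let ?R = "R \<union> {y \<in> D'. Im (K2 y) \<in> {\<delta>..}}"
    show "D \<union> B \<subseteq> S" using D(3) by (auto simp: B_def)
    show "openin (top_of_set S) (S - ?R)"
      using D(5) comp[of "{\<delta>..}"] compact_imp_closed by (intro openin_Diff_closed) blast
    have "x \<in> S" using D(3) x(1) sD by blast
    then show "x \<in> S - ?R" using x K2(4) \<delta>(1) by simp
    show "S - ?R \<subseteq> D \<union> B" using D(4) by (auto simp: B_def)
  qed
  also have "\<dots> \<longleftrightarrow> K x \<in> surface_boundary T"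
  proof -
    have "surface_boundary T = K ` surface_boundary (D \<union> B)"
      using surface_boundary_image[OF L, of "D \<union> B"] T by simp
    then show ?thesis using K_inj xN surface_boundary_subset[of "D \<union> B"] by (auto simp: inj_on_def)
  qed
  also have "\<dots> \<longleftrightarrow> g x \<in> {-1,1}"
  proof -
    have gx: "g x \<in> {-1..1}" using g x(1) by (auto simp: homeomorphism_def)
    have "K x \<in> T" using T xN by blast
    moreover have "K x \<in> interior T" if "g x \<notin> {-1,1}"
    proof -
      have "open (ball 0 1 \<inter> {z. - \<delta> < Im z})" by (intro open_Int open_ball open_halfspace_Im_gt)
      moreover have "ball 0 1 \<inter> {z. - \<delta> < Im z} \<subseteq> T" by (auto simp: T_def)
      moreover have "K x \<in> ball 0 1 \<inter> {z. - \<delta> < Im z}" using Kx gx that \<delta>(1) by auto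
      ultimately show ?thesis using interior_maximal by blast
    qed
    moreover have "K x \<notin> interior T" if "g x \<in> {-1,1}"
    proof -
      \<comment> \<open>The ends of \<open>s\<close> lie on the unit circle, which bounds the region on the
        outside.\<close>
      have "interior T \<subseteq> interior (cball 0 1)" by (rule interior_mono) (auto simp: T_def)
      then show ?thesis using Kx that by auto
    qed
    ultimately show ?thesis unfolding surface_boundary_plane by blast
  qed
  also have "\<dots> \<longleftrightarrow> x \<in> arc_ends s"
  proof -
    have "g ` arc_ends s = {-1,1}"
      using arc_ends_image[OF g, of s] homeomorphism_image1[OF g] by (simp add: arc_ends_Icc)
    then show ?thesis
      using homeomorphism_inj_on[OF g] x(1) arc_ends_subset[of s] by (auto simp: inj_on_def)
  qed
  finally show ?thesis .
qed

section \<open>Ribbon graphs\<close>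

definition segments_in :: "'a::topological_space ribbon \<Rightarrow> 'a set \<Rightarrow> 'a set set" where
  "segments_in G Y = {s \<in> segments G. s \<subseteq> Y}"

locale ribbon =
  fixes G :: "'a::t2_space ribbon"
  assumes ribbon_graph: "ribbon_graph G"
begin

lemma finite_vertices: "finite (vertices G)" and finite_edges: "finite (edges G)"
  and disc_vertex: "v \<in> vertices G \<Longrightarrow> disc v" and disc_edge: "e \<in> edges G \<Longrightarrow> disc e"
  and card_segments_in_edge: "e \<in> edges G \<Longrightarrow> card (segments_in G e) = 2"
  using ribbon_graph by (auto simp: ribbon_graph_def segments_in_def)

lemma pairwise_disjnt: "pairwise disjnt (vertices G)" "pairwise disjnt (edges G)"
  using ribbon_graph by (simp_all add: ribbon_graph_def)

lemma vertices_disjoint: "v \<in> vertices G \<Longrightarrow> w \<in> vertices G \<Longrightarrow> x \<in> v \<Longrightarrow> x \<in> w \<Longrightarrow> v = w"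
  using pairwise_disjnt unfolding pairwise_def disjnt_def by blast

lemma edges_disjoint: "a \<in> edges G \<Longrightarrow> b \<in> edges G \<Longrightarrow> x \<in> a \<Longrightarrow> x \<in> b \<Longrightarrow> a = b"
  using pairwise_disjnt unfolding pairwise_def disjnt_def by blast

lemma segment_arc: "s \<in> segments G \<Longrightarrow> line_segment s"
  using ribbon_graph by (auto simp: ribbon_graph_def)

lemma Union_segments: "\<Union>(segments G) = \<Union>(vertices G) \<inter> \<Union>(edges G)"
  unfolding segments_def by simp

lemma segments_disjoint: "s \<in> segments G \<Longrightarrow> r \<in> segments G \<Longrightarrow> x \<in> s \<Longrightarrow> x \<in> r \<Longrightarrow> s = r"
  unfolding segments_def using components_nonoverlap by blast

lemma segment_vertex:
  assumes "s \<in> segments G"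
  obtains v where "v \<in> vertices G" "s \<subseteq> surface_boundary v"
proof -
  have "\<exists>!v. v \<in> vertices G \<and> s \<subseteq> surface_boundary v"
    using ribbon_graph assms by (simp add: ribbon_graph_def)
  then show ?thesis by (elim ex1E conjE) (rule that)
qed

lemma segment_edge:
  assumes "s \<in> segments G"
  obtains e where "e \<in> edges G" "s \<subseteq> surface_boundary e"
proof -
  have "\<exists>!e. e \<in> edges G \<and> s \<subseteq> surface_boundary e"
    using ribbon_graph assms by (simp add: ribbon_graph_def)
  then show ?thesis by (elim ex1E conjE) (rule that)
qed

lemma segment_in_vertex_boundary:
  assumes "s \<in> segments G" "v \<in> vertices G" "x \<in> s" "x \<in> v"
  shows "s \<subseteq> surface_boundary v"
proof -
  obtain w where w: "w \<in> vertices G" "s \<subseteq> surface_boundary w" using segment_vertex assms(1) .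
  then have "x \<in> w" using assms(3) surface_boundary_subset by blast
  then have "w = v" using vertices_disjoint w(1) assms by blast
  then show ?thesis using w by simp
qed

lemma segment_in_edge_boundary:
  assumes "s \<in> segments G" "e \<in> edges G" "x \<in> s" "x \<in> e"
  shows "s \<subseteq> surface_boundary e"
proof -
  obtain w where w: "w \<in> edges G" "s \<subseteq> surface_boundary w" using segment_edge assms(1) .
  then have "x \<in> w" using assms(3) surface_boundary_subset by blast
  then have "w = e" using edges_disjoint w(1) assms by blast
  then show ?thesis using w by simp
qed

lemma segment_nonempty: "s \<in> segments G \<Longrightarrow> s \<noteq> {}"
  using segment_arc line_segment_facts(4) by blast

lemma segment_subset_iff_edges:
  assumes "s \<in> segments G" "x \<in> s" "A \<subseteq> edges G"
  shows "s \<subseteq> \<Union>A \<longleftrightarrow> x \<in> \<Union>A"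
proof
  assume "x \<in> \<Union>A"
  then obtain a where "a \<in> A" "x \<in> a" by blast
  then show "s \<subseteq> \<Union>A"
    using segment_in_edge_boundary[OF assms(1) _ assms(2)] assms(3) surface_boundary_subset[of a] by blast
qed (use assms in blast)

lemma finite_segments: "finite (segments G)"
proof -
  have "segments G \<subseteq> (\<Union>e\<in>edges G. segments_in G e)"
  proof
    fix s assume s: "s \<in> segments G"
    then obtain e where "e \<in> edges G" "s \<subseteq> surface_boundary e" by (rule segment_edge)
    then show "s \<in> (\<Union>e\<in>edges G. segments_in G e)"
      using s surface_boundary_subset[of e] by (auto simp: segments_in_def)
  qed
  moreover have "finite (segments_in G e)" if "e \<in> edges G" for e
    using card_segments_in_edge[OF that] by (metis card.infinite zero_neq_numeral)
  ultimately show ?thesis using finite_edges finite_subset by blast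
qed

lemma arc_system_segments: "R \<subseteq> segments G \<Longrightarrow> arc_system R"
  unfolding arc_system_def pairwise_def disjnt_iff
  using finite_subset[OF _ finite_segments] segment_arc segments_disjoint by (meson subsetD)

lemma closed_Union_discs:
  assumes "Y \<subseteq> vertices G \<union> edges G"
  shows "closed (\<Union>Y)"
proof (rule closed_Union)
  show "finite Y" using assms finite_vertices finite_edges finite_subset by blast
  show "\<forall>D\<in>Y. closed D" using assms disc_vertex disc_edge disc_facts(2) by blast
qed

lemma arc_interior_segments_iff:
  assumes "s \<in> segments G" "x \<in> s" "R \<subseteq> segments G"
  shows "x \<in> \<Union>(arc_interior ` R) \<longleftrightarrow> s \<in> R \<and> x \<notin> arc_ends s"
  using assms segments_disjoint[of s] by (auto simp: arc_interior_def)

text \<open>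
  A point on a segment lies in exactly one vertex and one edge, so
  \<open>boundary_along_arc\<close> applies. Any other point lies in a single disc, and all other
  discs stay away from it.
\<close>

lemma surface_boundary_ribbon:
  "surface_boundary (surface G) =
    \<Union>(surface_boundary ` vertices G) \<union> \<Union>(surface_boundary ` edges G) - \<Union>(arc_interior ` segments G)"
  (is "?L = ?R")
proof -
  have "x \<in> ?L \<longleftrightarrow> x \<in> ?R" if x: "x \<in> surface G" for x
  proof (cases "x \<in> \<Union>(segments G)")
    case True
    then obtain s where s: "s \<in> segments G" "x \<in> s" by blast
    obtain v where v: "v \<in> vertices G" "s \<subseteq> surface_boundary v" using segment_vertex s(1) .
    obtain e where e: "e \<in> edges G" "s \<subseteq> surface_boundary e" using segment_edge s(1) .
    have xv: "x \<in> v" and xe: "x \<in> e" using s v e surface_boundary_subset by blast+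
    have "x \<in> ?L \<longleftrightarrow> x \<in> arc_ends s"
    proof (rule boundary_along_arc)
      show "disc v" "disc e" using v e disc_vertex disc_edge by blast+
      show "v \<union> e \<subseteq> surface G" using v e by (auto simp: surface_def)
      show "surface G \<subseteq> v \<union> e \<union> \<Union>(vertices G \<union> edges G - {v,e})" by (auto simp: surface_def)
      show "closed (\<Union>(vertices G \<union> edges G - {v,e}))" by (intro closed_Union_discs) blast
      show "line_segment s" using s segment_arc by blast
      show "s \<subseteq> surface_boundary v" "s \<subseteq> surface_boundary e" by (rule v e)+
      show "closed (\<Union>(segments G - {s}))"
        using finite_segments segment_arc line_segment_facts(2) by (intro closed_Union) auto
      show "s \<inter> \<Union>(segments G - {s}) = {}" using segments_disjoint[OF s(1)] by blast
      show "v \<inter> e \<subseteq> s \<union> \<Union>(segments G - {s})" using Union_segments v e by blast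
      show "x \<notin> \<Union>(vertices G \<union> edges G - {v,e})"
        using vertices_disjoint[OF v(1) _ xv] edges_disjoint[OF e(1) _ xe] by blast
    qed (rule s)
    moreover have "x \<in> ?R \<longleftrightarrow> x \<in> arc_ends s"
      using arc_interior_segments_iff[OF s subset_refl] s v by blast
    ultimately show ?thesis by blast
  next
    case False
    then have no: "x \<notin> \<Union>(vertices G) \<inter> \<Union>(edges G)" using Union_segments by simp
    have nint: "x \<notin> \<Union>(arc_interior ` segments G)" using False by (auto simp: arc_interior_def)
    obtain D where D: "D \<in> vertices G \<union> edges G" "x \<in> D" using x by (auto simp: surface_def)
    have uniq: "D' = D" if "D' \<in> vertices G \<union> edges G" "x \<in> D'" for D'
      using that D no vertices_disjoint[of D' D x] edges_disjoint[of D' D x] by blast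
    have "x \<in> ?L \<longleftrightarrow> x \<in> surface_boundary D"
    proof (rule surface_boundary_local)
      show "openin (top_of_set (surface G)) (surface G - \<Union>(vertices G \<union> edges G - {D}))"
        by (intro openin_Diff_closed closed_Union_discs) blast
      show "x \<in> surface G - \<Union>(vertices G \<union> edges G - {D})" using x uniq by blast
    qed (use D in \<open>auto simp: surface_def\<close>)
    moreover have "x \<in> surface_boundary D' \<longleftrightarrow> D' = D \<and> x \<in> surface_boundary D"
      if "D' \<in> vertices G \<union> edges G" for D'
      using uniq[OF that] surface_boundary_subset[of D'] by blast
    ultimately show ?thesis using nint D(1) by blast
  qed
  moreover have "?L \<subseteq> surface G" by (rule surface_boundary_subset)
  moreover have "?R \<subseteq> surface G" using surface_boundary_subset unfolding surface_def by blast
  ultimately show ?thesis by blast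
qed

end

lemma even_card_disjoint_UN:
  assumes "finite I" "\<And>i. i \<in> I \<Longrightarrow> finite (f i)" "\<And>i. i \<in> I \<Longrightarrow> even (card (f i))"
    and "\<And>i j. i \<in> I \<Longrightarrow> j \<in> I \<Longrightarrow> i \<noteq> j \<Longrightarrow> f i \<inter> f j = {}"
  shows "even (card (\<Union>i\<in>I. f i))"
proof -
  have "card (\<Union>i\<in>I. f i) = (\<Sum>i\<in>I. card (f i))" using assms by (intro card_UN_disjoint) auto
  then show ?thesis using assms(3) by (simp add: dvd_sum)
qed

text \<open>
  The part of the boundary of a vertex or edge disc that stays on the boundary of the surface. For
  an edge it consists of the two sides of the ribbon.
\<close>

definition free_boundary :: "'a::topological_space ribbon \<Rightarrow> 'a set \<Rightarrow> 'a set" where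
  "free_boundary G D = surface_boundary D - \<Union>(arc_interior ` segments_in G D)"

definition ends_in :: "'a::topological_space ribbon \<Rightarrow> 'a set \<Rightarrow> 'a set" where
  "ends_in G D = \<Union>(arc_ends ` segments_in G D)"

abbreviation bdry :: "'a::topological_space ribbon \<Rightarrow> 'a set set \<Rightarrow> 'a set" where
  "bdry G A \<equiv> surface_boundary (surface (spanning_subgraph G A))"

abbreviation num_bdry :: "'a::topological_space ribbon \<Rightarrow> 'a set set \<Rightarrow> nat" where
  "num_bdry G A \<equiv> num_boundary_components (spanning_subgraph G A)"

text \<open>
  A decomposition of the free boundary of a disc into its arcs, or into the whole circle if no
  segment lies on the disc. The two cases are treated alike by recording only what is used of the
  pieces: that they pair off the ends of the segments, and that each of them contains such an end
  if there is one.
\<close>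

definition disc_pieces :: "'a::topological_space ribbon \<Rightarrow> 'a set \<Rightarrow> 'a set set \<Rightarrow> bool" where
  "disc_pieces G D T \<longleftrightarrow> finite T \<and> T \<noteq> {} \<and> \<Union>T = free_boundary G D \<and>
     (\<forall>t\<in>T. closed t \<and> connected t \<and> t \<noteq> {}) \<and>
     (\<forall>U. (\<forall>t\<in>T. t \<subseteq> U \<or> t \<inter> U = {}) \<longrightarrow> even (card (U \<inter> ends_in G D))) \<and>
     (segments_in G D \<noteq> {} \<longrightarrow> (\<forall>t\<in>T. t \<inter> ends_in G D \<noteq> {}))"

context ribbon
begin

lemma segments_in_subset: "segments_in G Y \<subseteq> segments G"
  by (auto simp: segments_in_def)

lemma segments_in_boundary:
  assumes "D \<in> vertices G \<union> edges G" "s \<in> segments_in G D"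
  shows "s \<subseteq> surface_boundary D"
proof -
  have s: "s \<in> segments G" "s \<subseteq> D" using assms(2) by (auto simp: segments_in_def)
  then obtain x where "x \<in> s" using segment_nonempty by blast
  then show ?thesis
    using assms(1) segment_in_vertex_boundary[OF s(1)] segment_in_edge_boundary[OF s(1)] s(2) by blast
qed

lemma segments_in_iff:
  assumes "D \<in> vertices G \<union> edges G" "s \<in> segments G" "x \<in> s"
  shows "s \<in> segments_in G D \<longleftrightarrow> x \<in> D"
proof
  assume "x \<in> D"
  then have "s \<subseteq> surface_boundary D"
    using assms(1) segment_in_vertex_boundary[OF assms(2) _ assms(3)]
      segment_in_edge_boundary[OF assms(2) _ assms(3)] by blast
  then show "s \<in> segments_in G D"
    using assms(2) surface_boundary_subset[of D] by (auto simp: segments_in_def)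
qed (use assms(3) in \<open>auto simp: segments_in_def\<close>)

lemma finite_ends_in: "finite (ends_in G D)"
proof -
  have "finite (arc_ends s)" if "s \<in> segments_in G D" for s
    using that segments_in_subset segment_arc line_segment_facts(6) by blast
  moreover have "finite (segments_in G D)" using finite_segments segments_in_subset finite_subset by blast
  ultimately show ?thesis by (auto simp: ends_in_def)
qed

lemma disc_pieces_exist:
  assumes D: "D \<in> vertices G \<union> edges G"
  shows "\<exists>T. disc_pieces G D T"
proof (cases "segments_in G D = {}")
  case True
  have "circle (surface_boundary D)" using D disc_vertex disc_edge disc_facts(5) by blast
  then have "disc_pieces G D {surface_boundary D}"
    using circle_facts True by (auto simp: disc_pieces_def free_boundary_def ends_in_def)
  then show ?thesis by blast
next
  case False
  have C: "circle (surface_boundary D)" using D disc_vertex disc_edge disc_facts(5) by blast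
  have sub: "\<Union>(segments_in G D) \<subseteq> surface_boundary D" using segments_in_boundary[OF D] by blast
  obtain T where T: "arc_system T" "\<Union>T = surface_boundary D - \<Union>(arc_interior ` segments_in G D)"
    "\<Union>(arc_ends ` T) = \<Union>(arc_ends ` segments_in G D)"
    using circle_gaps[OF C arc_system_segments[OF segments_in_subset] False sub] .
  have ls: "line_segment t" if "t \<in> T" for t using that T(1) by (simp add: arc_system_def)
  have "\<Union>(arc_ends ` T) \<noteq> {}"
  proof -
    obtain s where s: "s \<in> segments_in G D" using False by blast
    then have "card (arc_ends s) = 2" using segments_in_subset segment_arc line_segment_facts(5) by blast
    then have "arc_ends s \<noteq> {}" by auto
    then show ?thesis using s T(3) by blast
  qed
  then have ne: "T \<noteq> {}" by blast
  have meet: "t \<inter> ends_in G D \<noteq> {}" if "t \<in> T" for t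
  proof -
    have "card (arc_ends t) = 2" using ls[OF that] line_segment_facts(5) by blast
    then have "arc_ends t \<noteq> {}" by auto
    moreover have "arc_ends t \<subseteq> ends_in G D" using that T(3) unfolding ends_in_def by blast
    ultimately show ?thesis using arc_ends_subset[of t] by blast
  qed
  have "even (card (U \<inter> ends_in G D))" if "\<forall>t\<in>T. t \<subseteq> U \<or> t \<inter> U = {}" for U
    using arc_system_parity[OF T(1), of U] that unfolding ends_in_def T(3)[symmetric] by blast
  then have "disc_pieces G D T"
    unfolding disc_pieces_def free_boundary_def
    using T(1,2) ne meet line_segment_facts(2-4)[OF ls] by (simp add: arc_system_def)
  then show ?thesis by blast
qed

lemma free_boundary_nonempty: "D \<in> vertices G \<union> edges G \<Longrightarrow> free_boundary G D \<noteq> {}"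
  using disc_pieces_exist[of D] unfolding disc_pieces_def by blast

text \<open>
  Keeping all vertices that meet the chosen edges does not disturb the segments on these edges.
  This covers both the spanning ribbon subgraphs and the neighbourhood of a single edge.
\<close>

lemma subribbon:
  fixes G' :: "'a ribbon"
  assumes sub: "vertices G' \<subseteq> vertices G" "edges G' \<subseteq> edges G"
    and full: "\<Union>(vertices G) \<inter> \<Union>(edges G') \<subseteq> \<Union>(vertices G')"
  shows "segments G' = segments_in G (\<Union>(edges G'))" and "ribbon_graph G'"
proof -
  let ?F = "segments_in G (\<Union>(edges G'))"
  have U: "\<Union>(vertices G') \<inter> \<Union>(edges G') = \<Union>?F"
  proof
    show "\<Union>(vertices G') \<inter> \<Union>(edges G') \<subseteq> \<Union>?F"
    proof
      fix x assume x: "x \<in> \<Union>(vertices G') \<inter> \<Union>(edges G')"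
      then have "x \<in> \<Union>(segments G)" unfolding Union_segments using sub by blast
      then obtain s where s: "s \<in> segments G" "x \<in> s" by blast
      then have "s \<subseteq> \<Union>(edges G')" using segment_subset_iff_edges[OF s sub(2)] x by blast
      then show "x \<in> \<Union>?F" using s by (auto simp: segments_in_def)
    qed
    show "\<Union>?F \<subseteq> \<Union>(vertices G') \<inter> \<Union>(edges G')"
      using full Union_segments unfolding segments_in_def by blast
  qed
  show seg: "segments G' = ?F"
    unfolding segments_def[of G'] U
  proof (rule components_disjoint_Union)
    show "finite ?F" "pairwise disjnt ?F"
      using arc_system_segments[OF segments_in_subset] by (auto simp: arc_system_def)
    show "closed T" "connected T" "T \<noteq> {}" if "T \<in> ?F" for T
      using that segments_in_subset segment_arc line_segment_facts by blast+
  qed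
  have unique: "\<exists>!D. D \<in> Y \<and> s \<subseteq> surface_boundary D"
    if s: "s \<in> ?F" and Y: "Y = vertices G' \<or> Y = edges G'" for s Y
  proof (rule ex_ex1I)
    have sG: "s \<in> segments G" using s segments_in_subset by blast
    then obtain x where x: "x \<in> s" using segment_nonempty by blast
    obtain D where D: "D \<in> Y" "x \<in> D" using U s x Y by blast
    then show "\<exists>D. D \<in> Y \<and> s \<subseteq> surface_boundary D"
      using segment_in_vertex_boundary[OF sG _ x] segment_in_edge_boundary[OF sG _ x] sub Y by blast
    show "D = D'" if "D \<in> Y \<and> s \<subseteq> surface_boundary D" "D' \<in> Y \<and> s \<subseteq> surface_boundary D'" for D D'
    proof -
      have "x \<in> D" "x \<in> D'" using that x surface_boundary_subset by blast+
      then show ?thesis using that vertices_disjoint[of D D' x] edges_disjoint[of D D' x] sub Y by blast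
    qed
  qed
  have two: "card {s \<in> ?F. s \<subseteq> e} = 2" if "e \<in> edges G'" for e
  proof -
    have "{s \<in> ?F. s \<subseteq> e} = segments_in G e" using that by (auto simp: segments_in_def)
    then show ?thesis using card_segments_in_edge that sub(2) by auto
  qed
  have disc: "\<forall>S\<in>vertices G' \<union> edges G'. disc S" using sub disc_vertex disc_edge by blast
  have fin: "finite (vertices G')" "finite (edges G')"
    using sub finite_vertices finite_edges finite_subset by blast+
  have pw: "pairwise disjnt (vertices G')" "pairwise disjnt (edges G')"
    using pairwise_disjnt sub pairwise_mono by blast+
  show "ribbon_graph G'"
    unfolding ribbon_graph_def seg
  proof (intro conjI ballI)
    show "line_segment s" if "s \<in> ?F" for s using that segments_in_subset segment_arc by blast
  qed (rule fin pw unique two disc[rule_format], assumption?, simp?)+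
qed

lemma spanning_subgraph_ribbon:
  assumes "A \<subseteq> edges G"
  shows "ribbon_graph (spanning_subgraph G A)" "segments (spanning_subgraph G A) = segments_in G (\<Union>A)"
  using subribbon[of "spanning_subgraph G A"] assms by (auto simp: spanning_subgraph_def)

lemma surface_spanning_subgraph: "surface (spanning_subgraph G A) = \<Union>(vertices G) \<union> \<Union>A"
  by (simp add: surface_def spanning_subgraph_def)

text \<open>
  The circles of the vertices contribute their free parts whatever \<open>A\<close> is. Where an
  edge is attached its sides appear; where an edge is missing the segments reappear.
\<close>

lemma boundary_spanning_subgraph:
  assumes A: "A \<subseteq> edges G"
  shows "bdry G A =
    \<Union>(free_boundary G ` (vertices G \<union> A)) \<union> \<Union>(segments G - segments_in G (\<Union>A))"
    (is "?L = ?R")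
proof -
  let ?S = "segments_in G (\<Union>A)"
  interpret A: ribbon "spanning_subgraph G A" by standard (rule spanning_subgraph_ribbon[OF A])
  have L: "?L = \<Union>(surface_boundary ` (vertices G \<union> A)) - \<Union>(arc_interior ` ?S)"
    unfolding A.surface_boundary_ribbon spanning_subgraph_ribbon(2)[OF A]
    by (simp add: spanning_subgraph_def)
  have int: "x \<in> \<Union>(arc_interior ` R) \<longleftrightarrow> s \<in> R \<and> x \<notin> arc_ends s"
    if "s \<in> segments G" "x \<in> s" "R \<subseteq> segments G" for s x R
    using arc_interior_segments_iff[OF that] .
  have "x \<in> ?L \<longleftrightarrow> x \<in> ?R" for x
  proof (cases "x \<in> \<Union>(segments G)")
    case False
    have i: "x \<notin> \<Union>(arc_interior ` segments_in G Y)" for Y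
      using False segments_in_subset by (auto simp: arc_interior_def)
    have "x \<in> ?L \<longleftrightarrow> (\<exists>D\<in>vertices G \<union> A. x \<in> surface_boundary D)" unfolding L using i[of "\<Union>A"] by blast
    moreover have "x \<in> free_boundary G D \<longleftrightarrow> x \<in> surface_boundary D" for D
      using i[of D] by (simp add: free_boundary_def)
    moreover have "x \<notin> \<Union>(segments G - ?S)" using False by blast
    ultimately show ?thesis by blast
  next
    case True
    then obtain s where s: "s \<in> segments G" "x \<in> s" by blast
    obtain v where v: "v \<in> vertices G" "s \<subseteq> surface_boundary v" using segment_vertex s(1) .
    have "x \<in> ?L \<longleftrightarrow> \<not> (s \<in> ?S \<and> x \<notin> arc_ends s)"
      unfolding L using int[OF s segments_in_subset] v s by blast
    moreover have "x \<in> \<Union>(segments G - ?S) \<longleftrightarrow> s \<notin> ?S" using s segments_disjoint[OF s(1)] by blast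
    moreover have "x \<in> \<Union>(free_boundary G ` (vertices G \<union> A)) \<longleftrightarrow> x \<in> arc_ends s"
    proof
      assume "x \<in> \<Union>(free_boundary G ` (vertices G \<union> A))"
      then obtain D where D: "D \<in> vertices G \<union> A" "x \<in> free_boundary G D" by blast
      then have DG: "D \<in> vertices G \<union> edges G" using A by blast
      have "x \<in> D" using D(2) surface_boundary_subset[of D] by (auto simp: free_boundary_def)
      then have "s \<in> segments_in G D" using segments_in_iff[OF DG s] by blast
      then show "x \<in> arc_ends s" using D(2) int[OF s segments_in_subset] by (auto simp: free_boundary_def)
    next
      assume "x \<in> arc_ends s"
      then have "x \<in> free_boundary G v"
        using v s int[OF s segments_in_subset[of v]] by (auto simp: free_boundary_def)
      then show "x \<in> \<Union>(free_boundary G ` (vertices G \<union> A))" using v by blast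
    qed
    ultimately show ?thesis by blast
  qed
  then show ?thesis by blast
qed

lemma vertex_free_boundary_on_edge:
  assumes e: "e \<in> edges G"
  shows "\<Union>(free_boundary G ` vertices G) \<inter> e = ends_in G e"
proof
  show "\<Union>(free_boundary G ` vertices G) \<inter> e \<subseteq> ends_in G e"
  proof
    fix x assume "x \<in> \<Union>(free_boundary G ` vertices G) \<inter> e"
    then obtain v where v: "v \<in> vertices G" "x \<in> free_boundary G v" "x \<in> e" by blast
    then have xv: "x \<in> v" using surface_boundary_subset[of v] by (auto simp: free_boundary_def)
    then obtain s where s: "s \<in> segments G" "x \<in> s" using Union_segments v e by blast
    then have "s \<in> segments_in G v" "s \<in> segments_in G e"
      using segments_in_iff[OF _ s] v e xv by blast+
    moreover from this have "x \<in> arc_ends s"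
      using v(2) arc_interior_segments_iff[OF s segments_in_subset] by (auto simp: free_boundary_def)
    ultimately show "x \<in> ends_in G e" by (auto simp: ends_in_def)
  qed
  show "ends_in G e \<subseteq> \<Union>(free_boundary G ` vertices G) \<inter> e"
  proof
    fix x assume x: "x \<in> ends_in G e"
    then obtain s where s: "s \<in> segments_in G e" "x \<in> arc_ends s" by (auto simp: ends_in_def)
    then have xs: "s \<in> segments G" "x \<in> s" "s \<subseteq> e" using arc_ends_subset by (auto simp: segments_in_def)
    obtain v where v: "v \<in> vertices G" "s \<subseteq> surface_boundary v" using segment_vertex xs(1) .
    have "x \<in> free_boundary G v"
      using v s xs arc_interior_segments_iff[OF xs(1,2) segments_in_subset[of v]] by (auto simp: free_boundary_def)
    then show "x \<in> \<Union>(free_boundary G ` vertices G) \<inter> e" using v xs by blast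
  qed
qed

lemma ends_in_disjoint:
  assumes "D \<in> vertices G \<and> D' \<in> vertices G \<or> D \<in> edges G \<and> D' \<in> edges G" "D \<noteq> D'"
  shows "ends_in G D \<inter> ends_in G D' = {}"
proof -
  have "ends_in G D \<subseteq> D" for D using arc_ends_subset by (force simp: ends_in_def segments_in_def)
  moreover have "D \<inter> D' = {}" using assms vertices_disjoint edges_disjoint by blast
  ultimately show ?thesis by blast
qed

lemma Union_ends_in:
  "(\<Union>v\<in>vertices G. ends_in G v) = \<Union>(arc_ends ` segments G)"
  "(\<Union>e\<in>edges G. ends_in G e) = \<Union>(arc_ends ` segments G)"
proof -
  have "\<exists>v\<in>vertices G. s \<in> segments_in G v" "\<exists>v\<in>edges G. s \<in> segments_in G v" if s: "s \<in> segments G" for s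
    using segment_vertex[OF s] segment_edge[OF s] s surface_boundary_subset
    unfolding segments_in_def by (metis (mono_tags, lifting) mem_Collect_eq order_trans)+
  moreover have "(\<Union>D\<in>W. ends_in G D) = \<Union>(arc_ends ` segments G)"
    if W: "\<And>s. s \<in> segments G \<Longrightarrow> \<exists>D\<in>W. s \<in> segments_in G D" for W
  proof
    show "(\<Union>D\<in>W. ends_in G D) \<subseteq> \<Union>(arc_ends ` segments G)"
      by (auto simp: ends_in_def segments_in_def)
    show "\<Union>(arc_ends ` segments G) \<subseteq> (\<Union>D\<in>W. ends_in G D)"
    proof
      fix x assume "x \<in> \<Union>(arc_ends ` segments G)"
      then obtain s where s: "s \<in> segments G" "x \<in> arc_ends s" by blast
      then obtain D where "D \<in> W" "s \<in> segments_in G D" using W by blast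
      then show "x \<in> (\<Union>D\<in>W. ends_in G D)" using s by (auto simp: ends_in_def)
    qed
  qed
  ultimately show "(\<Union>v\<in>vertices G. ends_in G v) = \<Union>(arc_ends ` segments G)"
    "(\<Union>e\<in>edges G. ends_in G e) = \<Union>(arc_ends ` segments G)"
    by blast+
qed

text \<open>The part of the boundary of \<open>(V, A)\<close> that adding \<open>e\<close> does not change.\<close>

definition common_boundary :: "'a set set \<Rightarrow> 'a set \<Rightarrow> 'a set" where
  "common_boundary A e = \<Union>(free_boundary G ` (vertices G \<union> A)) \<union> \<Union>(segments G - segments_in G (\<Union>(insert e A)))"

lemma
  assumes A: "A \<subseteq> edges G"
  shows closed_common_boundary: "closed (common_boundary A e)"
    and finite_components_common_boundary: "finite (components (common_boundary A e))"
proof -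
  have "\<forall>D\<in>vertices G \<union> A. \<exists>T. disc_pieces G D T" using disc_pieces_exist A by blast
  then obtain T where T: "\<forall>D\<in>vertices G \<union> A. disc_pieces G D (T D)" by (metis (mono_tags) bchoice)
  let ?F = "\<Union>(T ` (vertices G \<union> A)) \<union> (segments G - segments_in G (\<Union>(insert e A)))"
  have "finite (vertices G \<union> A)" using finite_vertices finite_edges A finite_subset by blast
  then have fin: "finite ?F" using T finite_segments by (auto simp: disc_pieces_def)
  have F: "closed t \<and> connected t" if "t \<in> ?F" for t
    using that
  proof
    assume "t \<in> \<Union>(T ` (vertices G \<union> A))"
    then obtain D where "D \<in> vertices G \<union> A" "t \<in> T D" by blast
    then show ?thesis using T by (simp add: disc_pieces_def)
  next
    assume "t \<in> segments G - segments_in G (\<Union>(insert e A))"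
    then show ?thesis using line_segment_facts(2,3)[OF segment_arc] by simp
  qed
  have "\<Union>?F = common_boundary A e"
  proof -
    have "\<Union>(\<Union>(T ` (vertices G \<union> A))) = (\<Union>D\<in>vertices G \<union> A. \<Union>(T D))" by blast
    also have "\<dots> = \<Union>(free_boundary G ` (vertices G \<union> A))"
      using T by (intro SUP_cong refl) (simp add: disc_pieces_def)
    finally show ?thesis unfolding common_boundary_def Union_Un_distrib by simp
  qed
  then show "closed (common_boundary A e)" "finite (components (common_boundary A e))"
    using fin F closed_Union[of ?F] finite_components_Union_connected[of ?F] by auto
qed

text \<open>
  All ends of segments together are paired off by the free arcs of the vertices, and the ends on
  an edge other than \<open>e\<close> by its sides or by its segments. All these arcs lie in the
  common boundary, so a component contains an even number of ends altogether and an even number on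
  each edge but \<open>e\<close>.
\<close>

lemma common_boundary_parity:
  assumes A: "A \<subseteq> edges G - {e}" and e: "e \<in> edges G" and U: "U \<in> components (common_boundary A e)"
  shows "even (card (U \<inter> ends_in G e))"
proof -
  let ?X = "common_boundary A e" and ?Q = "\<Union>(arc_ends ` segments G)"
  have "\<forall>D\<in>vertices G \<union> A. \<exists>T. disc_pieces G D T" using disc_pieces_exist A by blast
  then obtain T where "\<forall>D\<in>vertices G \<union> A. disc_pieces G D (T D)" by (metis (mono_tags) bchoice)
  then have T: "disc_pieces G D (T D)" if "D \<in> vertices G \<union> A" for D using that by blast
  have fb: "even (card (U \<inter> ends_in G D))" if D: "D \<in> vertices G \<union> A" for D
  proof -
    have "t \<subseteq> U \<or> t \<inter> U = {}" if "t \<in> T D" for t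
    proof (rule component_contains_or_misses[OF U])
      show "connected t" using T[OF D] that by (simp add: disc_pieces_def)
      have "t \<subseteq> free_boundary G D" using T[OF D] that by (auto simp: disc_pieces_def)
      then show "t \<subseteq> ?X" using D unfolding common_boundary_def by blast
    qed
    then show ?thesis using T[OF D] by (simp add: disc_pieces_def)
  qed
  have sg: "even (card (U \<inter> ends_in G a))" if a: "a \<in> edges G" "a \<notin> A" "a \<noteq> e" for a
    unfolding ends_in_def
  proof (rule arc_system_parity)
    show "arc_system (segments_in G a)" by (rule arc_system_segments[OF segments_in_subset])
    fix s assume s: "s \<in> segments_in G a"
    then have sG: "s \<in> segments G" "s \<subseteq> a" by (auto simp: segments_in_def)
    then obtain x where x: "x \<in> s" using segment_nonempty by blast
    have "x \<notin> \<Union>(insert e A)"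
    proof
      assume "x \<in> \<Union>(insert e A)"
      then obtain b where b: "b \<in> insert e A" "x \<in> b" by blast
      then have "b = a" using edges_disjoint[of b a x] a(1) x sG(2) A e by blast
      then show False using b a by blast
    qed
    then have "s \<notin> segments_in G (\<Union>(insert e A))" using x unfolding segments_in_def by blast
    then have "s \<subseteq> ?X" using sG(1) unfolding common_boundary_def by blast
    then show "s \<subseteq> U \<or> s \<inter> U = {}"
      by (rule component_contains_or_misses[OF U line_segment_facts(3)[OF segment_arc[OF sG(1)]]])
  qed
  have fin: "finite (U \<inter> ends_in G D)" for D using finite_ends_in by blast
  have "even (card (\<Union>v\<in>vertices G. U \<inter> ends_in G v))"
  proof (rule even_card_disjoint_UN)
    show "(U \<inter> ends_in G v) \<inter> (U \<inter> ends_in G w) = {}" if "v \<in> vertices G" "w \<in> vertices G" "v \<noteq> w" for v w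
      using ends_in_disjoint[of v w] that by blast
  qed (use fb fin finite_vertices in auto)
  then have "even (card (U \<inter> ?Q))" unfolding Union_ends_in(1)[symmetric] by simp
  moreover have "U \<inter> ?Q = (U \<inter> ends_in G e) \<union> (\<Union>a\<in>edges G - {e}. U \<inter> ends_in G a)"
    unfolding Union_ends_in(2)[symmetric] using e by blast
  moreover have "card ((U \<inter> ends_in G e) \<union> (\<Union>a\<in>edges G - {e}. U \<inter> ends_in G a)) =
    card (U \<inter> ends_in G e) + card (\<Union>a\<in>edges G - {e}. U \<inter> ends_in G a)"
  proof (rule card_Un_disjoint)
    show "finite (\<Union>a\<in>edges G - {e}. U \<inter> ends_in G a)" using fin finite_edges by blast
    show "(U \<inter> ends_in G e) \<inter> (\<Union>a\<in>edges G - {e}. U \<inter> ends_in G a) = {}"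
      using ends_in_disjoint[of e] e by blast
  qed (rule fin)
  moreover have "even (card (\<Union>a\<in>edges G - {e}. U \<inter> ends_in G a))"
  proof (rule even_card_disjoint_UN)
    show "(U \<inter> ends_in G v) \<inter> (U \<inter> ends_in G w) = {}" if "v \<in> edges G - {e}" "w \<in> edges G - {e}" "v \<noteq> w" for v w
      using ends_in_disjoint[of v w] that by blast
    show "even (card (U \<inter> ends_in G a))" if "a \<in> edges G - {e}" for a
      using fb[of a] sg[of a] that by blast
  qed (use fin finite_edges in auto)
  ultimately show ?thesis by simp
qed

end

lemma spanning_subgraph_eqs [simp]:
  "vertices (spanning_subgraph G A) = vertices G" "edges (spanning_subgraph G A) = A"
  "spanning_subgraph G (edges G) = G" "spanning_subgraph (spanning_subgraph G A) B = spanning_subgraph G B"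
  by (simp_all add: spanning_subgraph_def)

lemma delete_edge_eq: "delete_edge G e = spanning_subgraph G (edges G - {e})"
  by (simp add: delete_edge_def spanning_subgraph_def)

context ribbon
begin

lemma finite_boundary_components: "finite (components (surface_boundary (surface G)))"
proof -
  have "\<Union>(segments G) \<subseteq> \<Union>(edges G)" using Union_segments by blast
  then have "segments_in G (\<Union>(edges G)) = segments G" unfolding segments_in_def by blast
  then have eq: "surface_boundary (surface G) = common_boundary (edges G) {}"
    using boundary_spanning_subgraph[of "edges G"] by (simp add: common_boundary_def)
  show ?thesis unfolding eq by (rule finite_components_common_boundary[OF subset_refl])
qed

lemma surface_closed: "closed (surface G)" and finite_surface_components: "finite (components (surface G))"
proof -
  have eq: "surface G = \<Union>(vertices G \<union> edges G)" by (auto simp: surface_def)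
  have fin: "finite (vertices G \<union> edges G)" using finite_vertices finite_edges by blast
  have D: "connected D" if "D \<in> vertices G \<union> edges G" for D
    using that disc_vertex disc_edge disc_facts(3) by blast
  show "closed (surface G)" unfolding eq by (rule closed_Union_discs[OF subset_refl])
  show "finite (components (surface G))" unfolding eq using fin D by (rule finite_components_Union_connected)
qed

lemma disc_meets_boundary:
  assumes D: "D \<in> vertices G \<union> edges G"
  shows "D \<inter> surface_boundary (surface G) \<noteq> {}"
proof -
  have "free_boundary G D \<subseteq> surface_boundary (surface G)"
    using boundary_spanning_subgraph[of "edges G"] D by auto
  moreover have "free_boundary G D \<subseteq> D" using surface_boundary_subset[of D] by (auto simp: free_boundary_def)
  ultimately show ?thesis using free_boundary_nonempty[OF D] by blast
qed

text \<open>
  Each component of the surface contains a disc and hence a boundary point, so sending a boundary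
  component to the component of the surface around it is onto.
\<close>

lemma num_components_le_num_boundary_components: "num_components G \<le> num_boundary_components G"
proof -
  let ?S = "surface G" and ?B = "surface_boundary (surface G)"
  have "components ?S \<subseteq> (\<lambda>K. connected_component_set ?S (SOME x. x \<in> K)) ` components ?B"
  proof
    fix L assume "L \<in> components ?S"
    then obtain x where x: "x \<in> ?S" "L = connected_component_set ?S x" by (auto simp: components_def)
    then obtain D where D: "D \<in> vertices G \<union> edges G" "x \<in> D" by (auto simp: surface_def)
    then obtain y where y: "y \<in> D" "y \<in> ?B" using disc_meets_boundary by blast
    have "D \<subseteq> ?S" "connected D" using D(1) disc_vertex disc_edge disc_facts(3) by (auto simp: surface_def)
    then have xy: "connected_component ?S x y" unfolding connected_component_def using D(2) y(1) by blast
    let ?K = "connected_component_set ?B y"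
    have K: "?K \<in> components ?B" "y \<in> ?K" using y(2) by (auto simp: componentsI connected_component_refl)
    have "(SOME z. z \<in> ?K) \<in> ?K" using K(2) by (rule someI)
    then have "connected_component ?S y (SOME z. z \<in> ?K)"
      using connected_component_of_subset[OF _ surface_boundary_subset] by blast
    then have "connected_component ?S x (SOME z. z \<in> ?K)" using xy connected_component_trans by blast
    then have "L = connected_component_set ?S (SOME z. z \<in> ?K)" using x(2) connected_component_eq by blast
    then show "L \<in> (\<lambda>K. connected_component_set ?S (SOME x. x \<in> K)) ` components ?B" using K(1) by blast
  qed
  then show ?thesis
    unfolding num_components_def num_boundary_components_def boundary_components_def
    using finite_boundary_components surj_card_le by blast
qed

end

text \<open>
  An edge together with names for the arcs and corners on its boundary: \<open>s\<close> and
  \<open>s'\<close> are the segments, \<open>t\<close> and \<open>t'\<close> the sides.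
\<close>

locale ribbon_edge = ribbon +
  fixes e s s' t t' :: "'a set" and p p' q q' :: 'a
  assumes edge: "e \<in> edges G"
    and segs: "segments_in G e = {s,s'}" and segs_disjoint: "s \<inter> s' = {}"
    and side_arcs: "line_segment t" "line_segment t'" and sides_disjoint: "t \<inter> t' = {}"
    and sides: "free_boundary G e = t \<union> t'"
    and corners: "arc_ends s = {p,p'}" "arc_ends s' = {q,q'}" "arc_ends t = {p,q}" "arc_ends t' = {p',q'}"

lemma (in ribbon) ribbon_edge_exists:
  assumes e: "e \<in> edges G"
  obtains s s' t t' p p' q q' where "ribbon_edge G e s s' t t' p p' q q'"
proof -
  obtain s s' where s: "segments_in G e = {s,s'}" "s \<noteq> s'"
    using card_segments_in_edge[OF e] by (meson card_2_iff)
  then have sG: "s \<in> segments G" "s' \<in> segments G" using segments_in_subset[of e] by auto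
  have "s \<inter> s' = {}" using segments_disjoint[OF sG] s(2) by blast
  moreover have "s \<subseteq> surface_boundary e" "s' \<subseteq> surface_boundary e"
    using segments_in_boundary[of e] e s(1) by auto
  ultimately obtain t t' p p' q q' where "line_segment t" "line_segment t'" "t \<inter> t' = {}"
    "t \<union> t' = surface_boundary e - (arc_interior s \<union> arc_interior s')"
    "arc_ends s = {p,p'}" "arc_ends s' = {q,q'}" "arc_ends t = {p,q}" "arc_ends t' = {p',q'}"
    using circle_two_gaps[OF disc_facts(5)[OF disc_edge[OF e]] segment_arc[OF sG(1)] _ segment_arc[OF sG(2)]] by metis
  then have "ribbon_edge G e s s' t t' p p' q q'"
    using ribbon_graph e s(1) \<open>s \<inter> s' = {}\<close> by unfold_locales (simp_all add: free_boundary_def)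
  then show ?thesis using that by blast
qed

context ribbon_edge
begin

lemma ends_in_edge: "ends_in G e = {p,p',q,q'}"
  by (simp add: ends_in_def segs corners insert_commute)

lemma corner_mem: "p \<in> s" "p' \<in> s" "q \<in> s'" "q' \<in> s'" "p \<in> t" "q \<in> t" "p' \<in> t'" "q' \<in> t'"
  using arc_ends_subset corners by blast+

lemma seg_mem: "s \<in> segments G" "s' \<in> segments G" "s \<subseteq> e" "s' \<subseteq> e"
  using segs by (auto simp: segments_in_def)

lemma seg_arcs: "line_segment s" "line_segment s'"
  using seg_mem segment_arc by auto

lemma side_subset: "t \<subseteq> e" "t' \<subseteq> e"
  using sides surface_boundary_subset[of e] unfolding free_boundary_def by blast+

lemma common_boundary_on_edge:
  assumes A: "A \<subseteq> edges G - {e}"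
  shows "common_boundary A e \<inter> e = {p,p',q,q'}"
proof -
  have "free_boundary G a \<inter> e = {}" if "a \<in> A" for a
    using edges_disjoint[of a e] that A edge surface_boundary_subset[of a] unfolding free_boundary_def by blast
  moreover have "r \<inter> e = {}" if r: "r \<in> segments G - segments_in G (\<Union>(insert e A))" for r
  proof (rule ccontr)
    assume "r \<inter> e \<noteq> {}"
    then obtain x where "x \<in> r" "x \<in> e" by blast
    then have "r \<in> segments_in G e" using segments_in_iff[of e r x] edge r by blast
    then show False using r by (auto simp: segments_in_def)
  qed
  ultimately have "common_boundary A e \<inter> e = \<Union>(free_boundary G ` vertices G) \<inter> e"
    unfolding common_boundary_def by blast
  then show ?thesis using vertex_free_boundary_on_edge[OF edge] ends_in_edge by simp
qed

lemma boundary_without_edge: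
  assumes A: "A \<subseteq> edges G - {e}"
  shows "bdry G A = common_boundary A e \<union> s \<union> s'"
proof -
  have "segments G - segments_in G (\<Union>A) = (segments G - segments_in G (\<Union>(insert e A))) \<union> {s,s'}"
  proof
    show "segments G - segments_in G (\<Union>A) \<subseteq> (segments G - segments_in G (\<Union>(insert e A))) \<union> {s,s'}"
    proof
      fix r assume r: "r \<in> segments G - segments_in G (\<Union>A)"
      then obtain x where x: "x \<in> r" using segment_nonempty by blast
      have "x \<notin> \<Union>A" using segment_subset_iff_edges[of r x A] x r A by (auto simp: segments_in_def)
      then have "r \<in> segments_in G e" if "r \<subseteq> \<Union>(insert e A)"
        using that segments_in_iff[of e r x] edge x r by blast
      then show "r \<in> (segments G - segments_in G (\<Union>(insert e A))) \<union> {s,s'}"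
        using r segs by (auto simp: segments_in_def)
    qed
    have "x \<notin> \<Union>A" if "x \<in> e" for x using edges_disjoint[OF edge _ that] A by blast
    then have "s \<notin> segments_in G (\<Union>A)" "s' \<notin> segments_in G (\<Union>A)"
      using seg_mem corner_mem(1,3) unfolding segments_in_def by blast+
    then show "(segments G - segments_in G (\<Union>(insert e A))) \<union> {s,s'} \<subseteq> segments G - segments_in G (\<Union>A)"
      using seg_mem(1,2) by (auto simp: segments_in_def)
  qed
  moreover have "A \<subseteq> edges G" using A by blast
  ultimately show ?thesis unfolding boundary_spanning_subgraph[OF \<open>A \<subseteq> edges G\<close>] common_boundary_def by auto
qed

lemma boundary_with_edge:
  assumes A: "A \<subseteq> edges G - {e}"
  shows "bdry G (insert e A) = common_boundary A e \<union> t \<union> t'"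
proof -
  have "insert e A \<subseteq> edges G" using A edge by blast
  then show ?thesis
    unfolding boundary_spanning_subgraph[OF \<open>insert e A \<subseteq> edges G\<close>] common_boundary_def using sides by auto
qed

lemma common_boundary_meets:
  assumes A: "A \<subseteq> edges G - {e}"
  shows "s \<inter> common_boundary A e = {p,p'}" "s' \<inter> common_boundary A e = {q,q'}"
    "t \<inter> common_boundary A e = {p,q}" "t' \<inter> common_boundary A e = {p',q'}"
proof -
  note X = common_boundary_on_edge[OF A]
  have "Y \<inter> common_boundary A e = Y \<inter> {p,p',q,q'}" if "Y \<subseteq> e" for Y using X that by blast
  then show "s \<inter> common_boundary A e = {p,p'}" "s' \<inter> common_boundary A e = {q,q'}"
    "t \<inter> common_boundary A e = {p,q}" "t' \<inter> common_boundary A e = {p',q'}"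
    using corner_mem segs_disjoint sides_disjoint seg_mem side_subset by auto
qed

lemma connected_arcs:
  "closed s" "connected s" "closed s'" "connected s'" "closed t" "connected t" "closed t'" "connected t'"
  using line_segment_facts seg_arcs side_arcs by auto

text \<open>
  The superset \<open>Y\<close> allows the separation of \<open>s\<close> and \<open>s'\<close> to
  be checked in a whole surface, where it does not depend on \<open>A\<close>.
\<close>

lemma boundary_merge_adding_edge:
  assumes A: "A \<subseteq> edges G - {e}" and sep: "\<not> connected_component Y p q"
    and Y: "bdry G A \<subseteq> Y"
  shows "num_bdry G A = num_bdry G (insert e A) + 1"
proof -
  have AE: "A \<subseteq> edges G" using A by blast
  have "\<not> connected_component (common_boundary A e \<union> s \<union> s') p q"
    using sep Y unfolding boundary_without_edge[OF A] using connected_component_of_subset by blast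
  then have "card (components (common_boundary A e \<union> t \<union> t')) + 1 = card (components (common_boundary A e \<union> s \<union> s'))"
    using closed_common_boundary[OF AE] finite_components_common_boundary[OF AE]
      common_boundary_parity[OF A edge, unfolded ends_in_edge] common_boundary_meets[OF A]
      connected_arcs segs_disjoint sides_disjoint
    by (intro card_components_exchange)
  then show ?thesis
    unfolding num_boundary_components_def boundary_components_def boundary_without_edge[OF A] boundary_with_edge[OF A]
    by simp
qed

text \<open>
  The exchange is symmetric: the four corners are paired by the segments and by the sides alike,
  so the roles of the two pairs of arcs can be swapped.
\<close>

lemma boundary_merge_removing_edge:
  assumes A: "A \<subseteq> edges G - {e}" and sep: "\<not> connected_component Y p p'"
    and Y: "bdry G (insert e A) \<subseteq> Y"
  shows "num_bdry G (insert e A) = num_bdry G A + 1"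
proof -
  have AE: "A \<subseteq> edges G" using A by blast
  have "\<not> connected_component (common_boundary A e \<union> t \<union> t') p p'"
    using sep Y unfolding boundary_with_edge[OF A] using connected_component_of_subset by blast
  moreover have "{p,q,p',q'} = ends_in G e" unfolding ends_in_edge by blast
  then have "even (card (U \<inter> {p,q,p',q'}))" if "U \<in> components (common_boundary A e)" for U
    using common_boundary_parity[OF A edge that] by simp
  ultimately have "card (components (common_boundary A e \<union> s \<union> s')) + 1 = card (components (common_boundary A e \<union> t \<union> t'))"
    using closed_common_boundary[OF AE] finite_components_common_boundary[OF AE]
      common_boundary_meets[OF A] connected_arcs segs_disjoint sides_disjoint
    by (intro card_components_exchange[of _ _ _ _ _ p q p' q'])
  then show ?thesis
    unfolding num_boundary_components_def boundary_components_def boundary_without_edge[OF A] boundary_with_edge[OF A]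
    by simp
qed

lemma components_adding_edge:
  assumes A: "A \<subseteq> edges G - {e}"
  shows "connected_component (surface (spanning_subgraph G A)) p q \<Longrightarrow>
      num_components (spanning_subgraph G (insert e A)) = num_components (spanning_subgraph G A)"
    and "\<not> connected_component (surface (spanning_subgraph G A)) p q \<Longrightarrow>
      num_components (spanning_subgraph G (insert e A)) + 1 = num_components (spanning_subgraph G A)"
proof -
  let ?X = "surface (spanning_subgraph G A)"
  have AE: "A \<subseteq> edges G" using A by blast
  interpret A: ribbon "spanning_subgraph G A" by standard (rule spanning_subgraph_ribbon[OF AE])
  have eq: "surface (spanning_subgraph G (insert e A)) = ?X \<union> e"
    by (auto simp: surface_spanning_subgraph)
  have meet: "e \<inter> ?X = s \<union> s'"
  proof -
    have "e \<inter> \<Union>A = {}" using A edge edges_disjoint by blast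
    then have "e \<inter> ?X = e \<inter> \<Union>(vertices G)" by (auto simp: surface_spanning_subgraph)
    also have "\<dots> = \<Union>(segments_in G e)"
    proof
      show "e \<inter> \<Union>(vertices G) \<subseteq> \<Union>(segments_in G e)"
        using Union_segments segments_in_iff[of e] edge by blast
      show "\<Union>(segments_in G e) \<subseteq> e \<inter> \<Union>(vertices G)"
        using Union_segments by (auto simp: segments_in_def)
    qed
    finally show ?thesis using segs by simp
  qed
  have sub: "s \<subseteq> connected_component_set ?X p" "s' \<subseteq> connected_component_set ?X q"
  proof -
    have X: "s \<subseteq> ?X" "s' \<subseteq> ?X" using meet by blast+
    show "s \<subseteq> connected_component_set ?X p"
      by (rule connected_component_maximal[OF corner_mem(1) connected_arcs(2) X(1)])
    show "s' \<subseteq> connected_component_set ?X q"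
      by (rule connected_component_maximal[OF corner_mem(3) connected_arcs(4) X(2)])
  qed
  note attach = card_components_attach[OF A.surface_closed A.finite_surface_components
    disc_facts(2,3)[OF disc_edge[OF edge]], of p q]
  have "p \<in> e" "q \<in> e" "p \<in> ?X" "q \<in> ?X" "e \<inter> ?X \<subseteq> connected_component_set ?X p \<union> connected_component_set ?X q"
    using meet sub corner_mem by blast+
  then show "connected_component ?X p q \<Longrightarrow>
      num_components (spanning_subgraph G (insert e A)) = num_components (spanning_subgraph G A)"
    "\<not> connected_component ?X p q \<Longrightarrow>
      num_components (spanning_subgraph G (insert e A)) + 1 = num_components (spanning_subgraph G A)"
    unfolding num_components_def eq using attach(2,3) by blast+
qed

end

section \<open>Spanning quasi-trees and deletion\<close>

text \<open>
  Adding edges never increases the number of components.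
\<close>

lemma num_components_le_spanning:
  assumes G: "ribbon_graph G" and F: "F \<subseteq> edges G"
  shows "num_components G \<le> num_bdry G F"
proof -
  interpret ribbon G by standard (rule G)
  interpret F: ribbon "spanning_subgraph G F" by standard (rule spanning_subgraph_ribbon[OF F])
  have "finite B \<Longrightarrow> B \<subseteq> edges G - F \<Longrightarrow>
    num_components (spanning_subgraph G (F \<union> B)) \<le> num_components (spanning_subgraph G F)" for B
  proof (induction B rule: finite_induct)
    case (insert e B)
    then have e: "e \<in> edges G" "F \<union> B \<subseteq> edges G - {e}" using F by auto
    obtain s s' t t' p p' q q' where "ribbon_edge G e s s' t t' p p' q q'"
      using ribbon_edge_exists[OF e(1)] .
    then interpret ribbon_edge G e s s' t t' p p' q q' .
    have "num_components (spanning_subgraph G (insert e (F \<union> B))) \<le> num_components (spanning_subgraph G (F \<union> B))"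
      using components_adding_edge[OF e(2)] by linarith
    then show ?case using insert by simp
  qed simp
  from this[of "edges G - F"] have "num_components G \<le> num_components (spanning_subgraph G F)"
    using finite_edges F by (simp add: Un_absorb1)
  then show ?thesis using F.num_components_le_num_boundary_components by linarith
qed

lemma edgeless_quasi_tree:
  assumes G: "ribbon_graph G" and E: "edges G = {}"
  shows "num_boundary_components G = num_components G"
proof -
  interpret ribbon G by standard (rule G)
  have seg: "segments G = {}" using E by (simp add: segments_def)
  have B: "surface_boundary (surface G) = \<Union>(surface_boundary ` vertices G)"
    unfolding surface_boundary_ribbon by (simp add: E seg)
  have S: "surface G = \<Union>(vertices G)" by (simp add: surface_def E)
  have C: "circle (surface_boundary v)" if "v \<in> vertices G" for v
    using disc_vertex[OF that] disc_facts(5) by blast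
  have dis: "surface_boundary v \<inter> surface_boundary w = {}" if "v \<in> vertices G" "w \<in> vertices G" "v \<noteq> w" for v w
    using vertices_disjoint that surface_boundary_subset by blast
  have "components (\<Union>(vertices G)) = vertices G"
    using finite_vertices pairwise_disjnt(1) disc_vertex disc_facts(2-4) by (intro components_disjoint_Union) blast+
  moreover have "components (\<Union>(surface_boundary ` vertices G)) = surface_boundary ` vertices G"
  proof (rule components_disjoint_Union)
    show "pairwise disjnt (surface_boundary ` vertices G)"
      using dis by (auto simp: pairwise_def disjnt_def)
  qed (use finite_vertices C circle_facts(2-4) in auto)
  moreover have "inj_on surface_boundary (vertices G)"
    using dis C circle_facts(4) by (metis inf.idem inj_onI)
  ultimately show ?thesis
    unfolding num_components_def num_boundary_components_def boundary_components_def S B[unfolded S]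
    by (simp add: card_image)
qed

text \<open>
  Growing a spanning forest: an edge whose ends are already connected is skipped, and any other
  edge lowers the numbers of components and of boundary components by one each.
\<close>

lemma spanning_quasi_tree_exists:
  assumes "ribbon_graph G"
  shows "\<exists>B\<subseteq>edges G. num_bdry G B = num_components G"
  using assms
proof (induction "card (edges G)" arbitrary: G)
  case 0
  then interpret ribbon G by unfold_locales
  have E: "edges G = {}" using 0 finite_edges by simp
  then have "spanning_subgraph G {} = G" by (metis spanning_subgraph_eqs(3))
  then show ?case using edgeless_quasi_tree[OF 0(2) E] by auto
next
  case (Suc n)
  then interpret ribbon G by unfold_locales
  obtain e where e: "e \<in> edges G" using Suc.hyps(2) by fastforce
  obtain s s' t t' p p' q q' where "ribbon_edge G e s s' t t' p p' q q'"
    using ribbon_edge_exists[OF e] .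
  then interpret ribbon_edge G e s s' t t' p p' q q' .
  let ?G = "spanning_subgraph G (edges G - {e})"
  have sub: "edges G - {e} \<subseteq> edges G" by blast
  have ins: "insert e (edges G - {e}) = edges G" using e by blast
  have "n = card (edges ?G)" using Suc.hyps(2) e finite_edges by simp
  then obtain B where B: "B \<subseteq> edges G - {e}" "num_bdry G B = num_components ?G"
    using Suc.hyps(1)[OF _ spanning_subgraph_ribbon(1)[OF sub]] by auto
  show ?case
  proof (cases "connected_component (surface ?G) p q")
    case True
    then show ?thesis using components_adding_edge(1)[OF subset_refl] ins B by (intro exI[of _ B]) auto
  next
    case False
    have "bdry G B \<subseteq> surface ?G"
      using surface_boundary_subset[of "surface (spanning_subgraph G B)"] B(1) by (auto simp: surface_spanning_subgraph)
    then have "num_bdry G (insert e B) = num_components G"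
      using boundary_merge_adding_edge[OF B(1) False] components_adding_edge(2)[OF subset_refl False] ins B(2) by simp
    then show ?thesis using B(1) e by (intro exI[of _ "insert e B"]) auto
  qed
qed

lemma mem_feasible:
  "A \<in> feasible (delta_matroid_of G) \<longleftrightarrow>
    A \<subseteq> edges G \<and> num_bdry G A = num_components G"
  by (simp add: delta_matroid_of_def)

lemma ground_delta_matroid_of [simp]: "ground (delta_matroid_of G) = edges G"
  by (simp add: delta_matroid_of_def)

lemma mem_restrict_avoiding:
  "A \<in> feasible (restrict_avoiding D e) \<longleftrightarrow> A \<in> feasible D \<and> A \<subseteq> ground D - {e}"
  by (auto simp: restrict_avoiding_def)

lemma mem_restrict_containing:
  assumes "\<And>F. F \<in> feasible D \<Longrightarrow> F \<subseteq> ground D"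
  shows "A \<in> feasible (restrict_containing D e) \<longleftrightarrow> insert e A \<in> feasible D \<and> A \<subseteq> ground D - {e}"
proof
  assume "A \<in> feasible (restrict_containing D e)"
  then obtain F where "F \<in> feasible D" "e \<in> F" "A = F - {e}" by (auto simp: restrict_containing_def)
  then show "insert e A \<in> feasible D \<and> A \<subseteq> ground D - {e}"
    using assms[of F] by (auto simp: insert_absorb)
next
  assume A: "insert e A \<in> feasible D \<and> A \<subseteq> ground D - {e}"
  then have "A = insert e A - {e}" by blast
  then show "A \<in> feasible (restrict_containing D e)" using A unfolding restrict_containing_def by auto
qed

text \<open>
  The case distinction is whether the ends of \<open>e\<close> remain connected without
  \<open>e\<close>, that is, whether \<open>e\<close> fails to be a bridge. Bridges are the
  coloops.
\<close>

theorem delta_matroid_of_delete_edge: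
  assumes G: "ribbon_graph G" and e: "e \<in> edges G"
  shows "delta_matroid_of (delete_edge G e) = dm_delete (delta_matroid_of G) e"
proof -
  interpret ribbon G by standard (rule G)
  obtain s s' t t' p p' q q' where "ribbon_edge G e s s' t t' p p' q q'"
    using ribbon_edge_exists[OF e] .
  then interpret ribbon_edge G e s s' t t' p p' q q' .
  let ?D = "delta_matroid_of G" and ?G = "spanning_subgraph G (edges G - {e})"
  have ins: "insert e (edges G - {e}) = edges G" using e by blast
  have rG: "ribbon_graph ?G" using spanning_subgraph_ribbon(1)[of "edges G - {e}"] by blast
  have feas: "A \<in> feasible (delta_matroid_of (delete_edge G e)) \<longleftrightarrow>
      A \<subseteq> edges G - {e} \<and> num_bdry G A = num_components ?G" for A
    by (simp add: mem_feasible delete_edge_eq)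
  have ground: "ground (dm_delete ?D e) = edges G - {e}"
    by (simp add: dm_delete_def restrict_avoiding_def restrict_containing_def)
  have "feasible (delta_matroid_of (delete_edge G e)) = feasible (dm_delete ?D e)"
  proof (cases "connected_component (surface ?G) p q")
    case True
    then have k: "num_components G = num_components ?G"
      using components_adding_edge(1)[OF subset_refl] ins by simp
    obtain B where "B \<subseteq> edges G - {e}" "num_bdry G B = num_components ?G"
      using spanning_quasi_tree_exists[OF rG] by auto
    then have "B \<in> feasible ?D" "e \<notin> B" using k by (auto simp: mem_feasible)
    then have "\<not> coloop ?D e" by (auto simp: coloop_def)
    then show ?thesis
      using k by (auto simp: dm_delete_def delete_edge_eq mem_restrict_avoiding mem_feasible)
  next
    case False
    then have k: "num_components ?G = num_components G + 1"
      using components_adding_edge(2)[OF subset_refl] ins by simp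
    have "e \<in> F" if F: "F \<in> feasible ?D" for F
    proof (rule ccontr)
      assume "e \<notin> F"
      then have "F \<subseteq> edges ?G" using F by (auto simp: mem_feasible)
      from num_components_le_spanning[OF rG this] show False using F k by (simp add: mem_feasible)
    qed
    then have col: "coloop ?D e" using e by (simp add: coloop_def)
    have merge: "num_bdry G A = num_bdry G (insert e A) + 1"
      if A: "A \<subseteq> edges G - {e}" for A
    proof (rule boundary_merge_adding_edge[OF A False])
      show "bdry G A \<subseteq> surface ?G"
        using surface_boundary_subset[of "surface (spanning_subgraph G A)"] A by (auto simp: surface_spanning_subgraph)
    qed
    have "A \<in> feasible (delta_matroid_of (delete_edge G e)) \<longleftrightarrow> A \<in> feasible (dm_delete ?D e)" for A
      using k merge[of A] e col
      by (subst feas, simp add: dm_delete_def, subst mem_restrict_containing) (auto simp: mem_feasible)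
    then show ?thesis by blast
  qed
  then show ?thesis using ground by (simp add: delete_edge_eq)
qed

section \<open>Contraction\<close>

text \<open>
  The data hidden in \<open>is_contraction\<close>: the embedding \<open>\<phi>\<close> with its
  inverse \<open>\<psi>\<close> and the attached discs \<open>\<delta>\<close>. The set
  \<open>W\<close> is the piece of the surface that is removed, and \<open>C\<close> consists of
  its boundary curves.
\<close>

locale ribbon_contraction = ribbon_edge +
  fixes \<phi> :: "'a \<Rightarrow> 'b::t2_space" and \<psi> :: "'b \<Rightarrow> 'a" and H :: "'b ribbon" and \<delta> :: "'a set \<Rightarrow> 'b set"
    and I :: "'a set set" and W :: "'a set" and C :: "'a set set"
  assumes embedding: "homeomorphism (surface G) (\<phi> ` surface G) \<phi> \<psi>"
    and I_def: "I = incident_vertices G e" and W_def: "W = e \<union> \<Union>I" and C_def: "C = boundary_components W"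
    and disc_\<delta>: "c \<in> C \<Longrightarrow> disc (\<delta> c)" and boundary_\<delta>: "c \<in> C \<Longrightarrow> surface_boundary (\<delta> c) = \<phi> ` c"
    and \<delta>_meets_surface: "c \<in> C \<Longrightarrow> \<delta> c \<inter> \<phi> ` surface G = \<phi> ` c"
    and \<delta>_disjoint: "c \<in> C \<Longrightarrow> c' \<in> C \<Longrightarrow> c \<noteq> c' \<Longrightarrow> disjnt (\<delta> c) (\<delta> c')"
    and vertices_H: "vertices H = (`) \<phi> ` (vertices G - I) \<union> \<delta> ` C"
    and edges_H: "edges H = (`) \<phi> ` (edges G - {e})"
begin

lemma I_subset: "I \<subseteq> vertices G"
  by (auto simp: I_def incident_vertices_def)

lemma I_meets: "v \<in> I \<longleftrightarrow> v \<in> vertices G \<and> v \<inter> e \<noteq> {}"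
  by (auto simp: I_def incident_vertices_def)

lemma W_subset: "W \<subseteq> surface G"
  using I_subset edge by (auto simp: W_def surface_def)

lemma disc_subset_surface: "D \<in> vertices G \<union> edges G \<Longrightarrow> D \<subseteq> surface G"
  by (auto simp: surface_def)

lemma \<phi>_inj: "inj_on \<phi> (surface G)"
  by (rule homeomorphism_inj_on[OF embedding])

lemma \<phi>_mem: "x \<in> surface G \<Longrightarrow> X \<subseteq> surface G \<Longrightarrow> \<phi> x \<in> \<phi> ` X \<longleftrightarrow> x \<in> X"
  using \<phi>_inj by (rule inj_on_image_mem_iff)

lemma \<phi>_subset: "X \<subseteq> surface G \<Longrightarrow> Y \<subseteq> surface G \<Longrightarrow> \<phi> ` X \<subseteq> \<phi> ` Y \<longleftrightarrow> X \<subseteq> Y"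
  using \<phi>_inj by (rule inj_on_image_subset_iff)

text \<open>
  The set \<open>W\<close> is the surface of a ribbon graph of its own, so the results on
  boundaries apply to it.
\<close>

definition star :: "'a ribbon" where
  "star = \<lparr>vertices = I, edges = {e}\<rparr>"

lemma star_sel [simp]: "vertices star = I" "edges star = {e}"
  by (simp_all add: star_def)

lemma star_ribbon: "ribbon_graph star" and segments_star: "segments star = {s,s'}"
proof -
  have "\<Union>(vertices G) \<inter> e \<subseteq> \<Union>I" using I_meets by blast
  then show "ribbon_graph star" "segments star = {s,s'}"
    using subribbon[of star] I_subset edge segs by auto
qed

sublocale star: ribbon star
  by standard (rule star_ribbon)

lemma surface_star: "surface star = W"
  by (auto simp: surface_def W_def)

lemma boundary_W:
  "surface_boundary W = \<Union>(surface_boundary ` I) \<union> surface_boundary e - (arc_interior s \<union> arc_interior s')"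
  using star.surface_boundary_ribbon by (simp add: surface_star segments_star)

lemma boundary_W_subset: "surface_boundary W \<subseteq> surface G"
  using surface_boundary_subset W_subset by blast

lemma finite_C: "finite C"
  using star.finite_boundary_components by (simp add: surface_star C_def boundary_components_def)

lemma Union_C: "\<Union>C = surface_boundary W"
  by (simp add: C_def boundary_components_def)

lemma C_subset: "c \<in> C \<Longrightarrow> c \<subseteq> surface G"
  using Union_C boundary_W_subset by blast

lemma C_connected: "c \<in> C \<Longrightarrow> connected c" "c \<in> C \<Longrightarrow> c \<noteq> {}"
  using in_components_connected in_components_nonempty by (auto simp: C_def boundary_components_def)

lemma connected_in_boundary_W:
  assumes "connected r" "r \<noteq> {}" "r \<subseteq> surface_boundary W"
  obtains c where "c \<in> C" "r \<subseteq> c"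
proof -
  obtain x where x: "x \<in> r" using assms(2) by blast
  then obtain c where c: "c \<in> C" "x \<in> c" using Union_C assms(3) by blast
  then have "r \<subseteq> c \<or> r \<inter> c = {}"
    using component_contains_or_misses[of c "surface_boundary W" r] assms by (simp add: C_def boundary_components_def)
  then show ?thesis using that c x by blast
qed

lemma vertex_off_W: "v \<in> vertices G - I \<Longrightarrow> v \<inter> W = {}"
  using vertices_disjoint I_subset I_meets unfolding W_def by blast

lemma edge_off_e: "a \<in> edges G - {e} \<Longrightarrow> a \<inter> e = {}"
  using edges_disjoint edge by blast

lemma segment_in_boundary_W:
  assumes "r \<in> segments G" "x \<in> r" "x \<notin> e" "v \<in> I" "x \<in> v"
  shows "r \<subseteq> surface_boundary W"
proof -
  have v: "v \<in> vertices G" using assms(4) I_subset by blast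
  have "r \<noteq> s" "r \<noteq> s'" using assms(2,3) seg_mem by blast+
  then have "r \<inter> s = {}" "r \<inter> s' = {}" using segments_disjoint assms(1) seg_mem by blast+
  moreover have "r \<subseteq> surface_boundary v" using segment_in_vertex_boundary[OF assms(1) v assms(2,5)] .
  ultimately show ?thesis using assms(4) unfolding boundary_W arc_interior_def by blast
qed

abbreviation G' :: "'a ribbon" where
  "G' \<equiv> spanning_subgraph G (edges G - {e})"

lemma G'_ribbon: "ribbon_graph G'" "segments G' = segments_in G (\<Union>(edges G - {e}))"
  using spanning_subgraph_ribbon[of "edges G - {e}"] by auto

sublocale G': ribbon G'
  by standard (rule G'_ribbon)

lemma \<delta>_image: "c \<in> C \<Longrightarrow> x \<in> surface G \<Longrightarrow> \<phi> x \<in> \<delta> c \<longleftrightarrow> x \<in> c"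
proof -
  assume c: "c \<in> C" and x: "x \<in> surface G"
  have "\<phi> x \<in> \<delta> c \<longleftrightarrow> \<phi> x \<in> \<phi> ` c" using \<delta>_meets_surface[OF c] x by blast
  then show ?thesis using \<phi>_mem[OF x C_subset[OF c]] by simp
qed

text \<open>
  A point of a remaining edge that lay on a vertex at \<open>e\<close> lies on the boundary of
  \<open>W\<close>, hence on an attached disc. So contraction leaves all segments outside
  \<open>e\<close> in place.
\<close>

lemma vertices_meet_edges_H:
  "\<Union>(vertices H) \<inter> \<Union>(edges H) = \<phi> ` (\<Union>(vertices G) \<inter> \<Union>(edges G - {e}))"
proof -
  have iff: "\<phi> x \<in> \<Union>(vertices H) \<longleftrightarrow> x \<in> \<Union>(vertices G)" if a: "a \<in> edges G - {e}" "x \<in> a" for a x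
  proof -
    have x: "x \<in> surface G" "x \<notin> e" using a edge_off_e by (auto simp: surface_def)
    have "\<phi> x \<in> \<Union>(vertices H) \<longleftrightarrow> (\<exists>v\<in>vertices G - I. \<phi> x \<in> \<phi> ` v) \<or> (\<exists>c\<in>C. \<phi> x \<in> \<delta> c)"
      by (simp only: vertices_H Union_Un_distrib Un_iff UN_iff)
    also have "\<dots> \<longleftrightarrow> (\<exists>v\<in>vertices G - I. x \<in> v) \<or> x \<in> surface_boundary W"
    proof -
      have "\<phi> x \<in> \<phi> ` v \<longleftrightarrow> x \<in> v" if "v \<in> vertices G - I" for v
        using \<phi>_mem[OF x(1) disc_subset_surface] that by simp
      moreover have "(\<exists>c\<in>C. \<phi> x \<in> \<delta> c) \<longleftrightarrow> x \<in> surface_boundary W"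
        unfolding Union_C[symmetric] using \<delta>_image[OF _ x(1)] by blast
      ultimately show ?thesis by simp
    qed
    also have "x \<in> surface_boundary W \<longleftrightarrow> (\<exists>v\<in>I. x \<in> v)"
    proof
      assume "x \<in> surface_boundary W"
      then show "\<exists>v\<in>I. x \<in> v" using surface_boundary_subset[of W] x(2) by (auto simp: W_def)
    next
      assume "\<exists>v\<in>I. x \<in> v"
      then obtain v where v: "v \<in> I" "x \<in> v" by blast
      then have "x \<in> \<Union>(segments G)" using Union_segments I_subset a by blast
      then obtain r where r: "r \<in> segments G" "x \<in> r" by blast
      then show "x \<in> surface_boundary W" using segment_in_boundary_W[OF r x(2) v] by blast
    qed
    also have "(\<exists>v\<in>vertices G - I. x \<in> v) \<or> (\<exists>v\<in>I. x \<in> v) \<longleftrightarrow> x \<in> \<Union>(vertices G)"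
      using I_subset by blast
    finally show ?thesis .
  qed
  have E: "\<Union>(edges H) = \<phi> ` \<Union>(edges G - {e})" unfolding edges_H by blast
  show ?thesis
  proof
    show "\<Union>(vertices H) \<inter> \<Union>(edges H) \<subseteq> \<phi> ` (\<Union>(vertices G) \<inter> \<Union>(edges G - {e}))"
    proof
      fix y assume y: "y \<in> \<Union>(vertices H) \<inter> \<Union>(edges H)"
      then obtain a x where x: "a \<in> edges G - {e}" "x \<in> a" "y = \<phi> x" unfolding E by blast
      then have "x \<in> \<Union>(vertices G)" using iff[OF x(1,2)] y by simp
      then show "y \<in> \<phi> ` (\<Union>(vertices G) \<inter> \<Union>(edges G - {e}))"
        unfolding x(3) using x(1,2) by (intro imageI IntI) auto
    qed
    show "\<phi> ` (\<Union>(vertices G) \<inter> \<Union>(edges G - {e})) \<subseteq> \<Union>(vertices H) \<inter> \<Union>(edges H)"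
    proof
      fix y assume "y \<in> \<phi> ` (\<Union>(vertices G) \<inter> \<Union>(edges G - {e}))"
      then obtain a x where x: "a \<in> edges G - {e}" "x \<in> a" "x \<in> \<Union>(vertices G)" "y = \<phi> x" by blast
      then have "y \<in> \<Union>(vertices H)" using iff[OF x(1,2)] by simp
      moreover have "y \<in> \<Union>(edges H)" unfolding E x(4) using x(1,2) by (intro imageI UnionI)
      ultimately show "y \<in> \<Union>(vertices H) \<inter> \<Union>(edges H)" by (rule IntI)
    qed
  qed
qed

lemma segments_H: "segments H = (`) \<phi> ` segments G'"
proof -
  have "\<Union>(vertices G) \<inter> \<Union>(edges G - {e}) \<subseteq> surface G" by (auto simp: surface_def)
  from components_homeomorphic_image(1)[OF embedding this]
  show ?thesis unfolding segments_def vertices_meet_edges_H by simp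
qed

lemma segment_G'_iff: "r \<in> segments G' \<longleftrightarrow> r \<in> segments G \<and> r \<inter> e = {}"
proof
  assume "r \<in> segments G'"
  then have "r \<in> segments G" "r \<subseteq> \<Union>(edges G - {e})" by (simp_all add: G'_ribbon(2) segments_in_def)
  moreover have "\<Union>(edges G - {e}) \<inter> e = {}" using edge_off_e by blast
  ultimately show "r \<in> segments G \<and> r \<inter> e = {}" by blast
next
  assume r: "r \<in> segments G \<and> r \<inter> e = {}"
  then obtain x where x: "x \<in> r" using segment_nonempty by blast
  obtain a where "a \<in> edges G" "r \<subseteq> surface_boundary a" using segment_edge r by blast
  then have "r \<subseteq> a" "a \<noteq> e" using r x surface_boundary_subset[of a] by blast+
  then have "r \<subseteq> \<Union>(edges G - {e})" using \<open>a \<in> edges G\<close> by blast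
  then show "r \<in> segments G'" using r by (simp add: G'_ribbon(2) segments_in_def)
qed

lemma segment_surface: "r \<in> segments G \<Longrightarrow> r \<subseteq> surface G"
  using Union_segments by (auto simp: surface_def)

lemma disc_image: "D \<in> vertices G \<union> edges G \<Longrightarrow> disc (\<phi> ` D)"
proof -
  assume D: "D \<in> vertices G \<union> edges G"
  then have "disc D" using disc_vertex disc_edge by blast
  moreover have "D homeomorphic \<phi> ` D"
    using homeomorphism_restrict[OF embedding disc_subset_surface[OF D]] homeomorphic_def by blast
  ultimately show ?thesis unfolding disc_def by (meson homeomorphic_sym homeomorphic_trans)
qed

lemma boundary_image: "X \<subseteq> surface G \<Longrightarrow> surface_boundary (\<phi> ` X) = \<phi> ` surface_boundary X"
  by (rule surface_boundary_image[OF embedding])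

lemma vertices_H_disjoint: "pairwise disjnt (vertices H)"
proof -
  have vv: "disjnt (\<phi> ` v) (\<phi> ` w)" if "v \<in> vertices G" "w \<in> vertices G" "v \<noteq> w" for v w
  proof -
    have "v \<inter> w = {}" using vertices_disjoint that by blast
    then show ?thesis
      using inj_on_image_Int[OF \<phi>_inj, of v w] disc_subset_surface that by (auto simp: disjnt_def)
  qed
  have vd: "disjnt (\<phi> ` v) (\<delta> c)" if v: "v \<in> vertices G - I" and c: "c \<in> C" for v c
  proof -
    have "\<phi> x \<notin> \<delta> c" if "x \<in> v" for x
    proof -
      have "x \<in> surface G" using v that by (auto simp: surface_def)
      moreover have "x \<notin> c" using vertex_off_W[OF v] that Union_C surface_boundary_subset[of W] c by blast
      ultimately show ?thesis using \<delta>_image[OF c] by blast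
    qed
    then show ?thesis by (auto simp: disjnt_iff)
  qed
  have dv: "disjnt (\<delta> c) (\<phi> ` v)" if "v \<in> vertices G - I" and "c \<in> C" for v c
    using vd[OF that] by (rule disjnt_sym)
  show ?thesis
  proof (rule pairwiseI)
    fix x y assume xy: "x \<in> vertices H" "y \<in> vertices H" "x \<noteq> y"
    then show "disjnt x y" unfolding vertices_H using vv vd dv \<delta>_disjoint by (auto; metis)
  qed
qed

text \<open>
  A segment on a vertex that survives stays on the boundary of that vertex. A segment on a vertex
  at \<open>e\<close> is a connected subset of the boundary of \<open>W\<close>, so it lies on one
  boundary curve and thus on the boundary of one attached disc.
\<close>

lemma H_ribbon: "ribbon_graph H"
proof -
  have disc: "disc S" if "S \<in> vertices H \<union> edges H" for S
    using that disc_image disc_\<delta> unfolding vertices_H edges_H by blast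
  have pe: "pairwise disjnt (edges H)"
    unfolding edges_H
  proof (rule pairwise_imageI)
    fix a b assume "a \<in> edges G - {e}" "b \<in> edges G - {e}" "a \<noteq> b"
    moreover from this have "a \<inter> b = {}" using edges_disjoint by blast
    ultimately show "disjnt (\<phi> ` a) (\<phi> ` b)"
      using inj_on_image_Int[OF \<phi>_inj, of a b] disc_subset_surface by (auto simp: disjnt_def)
  qed
  have fin: "finite (vertices H)" "finite (edges H)"
    using finite_vertices finite_edges finite_C by (simp_all add: vertices_H edges_H)
  have seg: "line_segment u \<and> (\<exists>!v. v \<in> vertices H \<and> u \<subseteq> surface_boundary v) \<and>
      (\<exists>!a. a \<in> edges H \<and> u \<subseteq> surface_boundary a)" if u: "u \<in> segments H" for u
  proof -
    obtain r where r: "r \<in> segments G" "r \<inter> e = {}" "u = \<phi> ` r"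
      using u unfolding segments_H using segment_G'_iff by blast
    have rS: "r \<subseteq> surface G" using segment_surface r(1) .
    obtain x where x: "x \<in> r" using segment_nonempty r(1) by blast
    then have xe: "x \<notin> e" using r(2) by blast
    have "line_segment u" using line_segment_image[OF embedding rS] segment_arc r by simp
    moreover have "\<exists>v. v \<in> vertices H \<and> u \<subseteq> surface_boundary v"
    proof -
      obtain v where v: "v \<in> vertices G" "r \<subseteq> surface_boundary v" using segment_vertex r(1) .
      show ?thesis
      proof (cases "v \<in> I")
        case False
        then have "\<phi> ` v \<in> vertices H" using v by (simp add: vertices_H)
        moreover have "u \<subseteq> surface_boundary (\<phi> ` v)"
          using boundary_image[of v] disc_subset_surface[of v] v r(3) by blast
        ultimately show ?thesis by blast
      next
        case True
        have "x \<in> v" using v x surface_boundary_subset by blast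
        then have "r \<subseteq> surface_boundary W" using segment_in_boundary_W[OF r(1) x xe True] by blast
        then obtain c where c: "c \<in> C" "r \<subseteq> c"
          using connected_in_boundary_W[of r] line_segment_facts(3,4)[OF segment_arc[OF r(1)]] by blast
        then have "\<delta> c \<in> vertices H" "u \<subseteq> surface_boundary (\<delta> c)"
          using boundary_\<delta>[OF c(1)] r(3) by (auto simp: vertices_H)
        then show ?thesis by blast
      qed
    qed
    moreover have "\<exists>a. a \<in> edges H \<and> u \<subseteq> surface_boundary a"
    proof -
      obtain a where a: "a \<in> edges G" "r \<subseteq> surface_boundary a" using segment_edge r(1) .
      then have "a \<noteq> e" using x xe surface_boundary_subset[of a] by blast
      then have "\<phi> ` a \<in> edges H" using a by (simp add: edges_H)
      moreover have "u \<subseteq> surface_boundary (\<phi> ` a)"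
        using boundary_image[of a] disc_subset_surface[of a] a r(3) by blast
      ultimately show ?thesis by blast
    qed
    moreover have "v = w" if "pairwise disjnt Y" "v \<in> Y" "w \<in> Y" "u \<subseteq> surface_boundary v" "u \<subseteq> surface_boundary w" for v w Y
    proof -
      have "\<phi> x \<in> v \<inter> w" using that(4,5) r(3) x surface_boundary_subset by blast
      then show ?thesis using that(1-3) by (auto simp: pairwise_def disjnt_def)
    qed
    ultimately show ?thesis using vertices_H_disjoint pe by metis
  qed
  have two: "card {u \<in> segments H. u \<subseteq> b} = 2" if b: "b \<in> edges H" for b
  proof -
    obtain a where a: "a \<in> edges G - {e}" "b = \<phi> ` a" using b edges_H by blast
    then have aS: "a \<subseteq> surface G" using disc_subset_surface by blast
    have "r \<in> segments G' \<and> \<phi> ` r \<subseteq> b \<longleftrightarrow> r \<in> segments_in G a" for r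
      using \<phi>_subset[OF segment_surface aS] edge_off_e[OF a(1)] a(2) segment_G'_iff[of r]
      unfolding segments_in_def by blast
    then have "{u \<in> segments H. u \<subseteq> b} = (`) \<phi> ` segments_in G a"
      unfolding segments_H by blast
    moreover have "inj_on ((`) \<phi>) (segments_in G a)"
    proof (rule inj_onI)
      fix x y assume "x \<in> segments_in G a" "y \<in> segments_in G a" "\<phi> ` x = \<phi> ` y"
      moreover from this have "x \<subseteq> surface G" "y \<subseteq> surface G" using aS by (auto simp: segments_in_def)
      ultimately show "x = y" using inj_on_image_eq_iff[OF \<phi>_inj] by blast
    qed
    ultimately show ?thesis using card_segments_in_edge a(1) by (simp add: card_image)
  qed
  show ?thesis
    unfolding ribbon_graph_def
    by (intro conjI ballI; rule fin vertices_H_disjoint pe disc two seg[THEN conjunct1]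
        seg[THEN conjunct2, THEN conjunct1] seg[THEN conjunct2, THEN conjunct2]; assumption?)
qed

sublocale H: ribbon H
  by standard (rule H_ribbon)

lemma segments_in_H:
  assumes A: "A \<subseteq> edges G - {e}"
  shows "segments_in H (\<Union>((`) \<phi> ` A)) = (`) \<phi> ` segments_in G (\<Union>A)"
proof -
  have AS: "\<Union>A \<subseteq> surface G" using A by (auto simp: surface_def)
  have "r \<in> segments G' \<and> \<phi> ` r \<subseteq> \<phi> ` \<Union>A \<longleftrightarrow> r \<in> segments_in G (\<Union>A)" for r
  proof -
    have "\<Union>A \<inter> e = {}" using A edge_off_e by blast
    then show ?thesis
      using \<phi>_subset[OF segment_surface AS] segment_G'_iff[of r] unfolding segments_in_def by blast
  qed
  then have "{\<phi> ` r |r. r \<in> segments G' \<and> \<phi> ` r \<subseteq> \<phi> ` \<Union>A} = (`) \<phi> ` segments_in G (\<Union>A)"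
    by (simp add: Setcompr_eq_image)
  moreover have "segments_in H (\<phi> ` \<Union>A) = {\<phi> ` r |r. r \<in> segments G' \<and> \<phi> ` r \<subseteq> \<phi> ` \<Union>A}"
    unfolding segments_in_def segments_H by blast
  moreover have "\<Union>((`) \<phi> ` A) = \<phi> ` \<Union>A" by blast
  ultimately show ?thesis by simp
qed

text \<open>
  The attached discs contribute the boundary of \<open>W\<close>, which is what \<open>e\<close>
  and the vertices at \<open>e\<close> contribute to the boundary of the subgraph with
  \<open>e\<close>.
\<close>

lemma boundary_H:
  assumes A: "A \<subseteq> edges G - {e}"
  shows "bdry H ((`) \<phi> ` A) =
    \<phi> ` bdry G (insert e A)"
proof -
  have AE: "insert e A \<subseteq> edges G" using A edge by blast
  have AH: "(`) \<phi> ` A \<subseteq> edges H" using A by (auto simp: edges_H)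
  interpret GA: ribbon "spanning_subgraph G (insert e A)"
    by standard (rule spanning_subgraph_ribbon[OF AE])
  interpret HA: ribbon "spanning_subgraph H ((`) \<phi> ` A)"
    by standard (rule H.spanning_subgraph_ribbon[OF AH])
  let ?SA = "segments_in G (\<Union>A)" and ?Y = "\<Union>(surface_boundary ` (vertices G - I)) \<union> surface_boundary W \<union> \<Union>(surface_boundary ` A)"
  let ?N = "\<Union>(arc_interior ` ?SA)"
  have segsA: "segments_in G (\<Union>(insert e A)) = ?SA \<union> {s,s'}"
  proof
    show "segments_in G (\<Union>(insert e A)) \<subseteq> ?SA \<union> {s,s'}"
    proof
      fix r assume r: "r \<in> segments_in G (\<Union>(insert e A))"
      then have rG: "r \<in> segments G" by (simp add: segments_in_def)
      then obtain x where x: "x \<in> r" using segment_nonempty by blast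
      show "r \<in> ?SA \<union> {s,s'}"
      proof (cases "x \<in> e")
        case True
        then show ?thesis using segments_in_iff[of e r x] edge rG x segs by blast
      next
        case False
        then have "x \<in> \<Union>A" using r x by (auto simp: segments_in_def)
        moreover have "A \<subseteq> edges G" using A by blast
        ultimately show ?thesis using segment_subset_iff_edges[OF rG x] rG by (simp add: segments_in_def)
      qed
    qed
    show "?SA \<union> {s,s'} \<subseteq> segments_in G (\<Union>(insert e A))"
      using seg_mem by (auto simp: segments_in_def)
  qed
  have ss': "arc_interior s \<subseteq> e" "arc_interior s' \<subseteq> e" using seg_mem by (auto simp: arc_interior_def)
  have offV: "\<Union>(surface_boundary ` (vertices G - I)) \<inter> e = {}"
  proof -
    have "surface_boundary v \<inter> e = {}" if "v \<in> vertices G - I" for v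
      using vertex_off_W[OF that] surface_boundary_subset[of v] by (auto simp: W_def)
    then show ?thesis by blast
  qed
  have offA: "\<Union>(surface_boundary ` A) \<inter> e = {}"
  proof -
    have "surface_boundary a \<inter> e = {}" if "a \<in> A" for a
      using edge_off_e[of a] A that surface_boundary_subset[of a] by blast
    then show ?thesis by blast
  qed
  have V: "\<Union>(surface_boundary ` vertices G) = \<Union>(surface_boundary ` (vertices G - I)) \<union> \<Union>(surface_boundary ` I)"
    using I_subset by blast
  have G: "bdry G (insert e A) = ?Y - ?N"
  proof -
    have "bdry G (insert e A) =
      (\<Union>(surface_boundary ` (vertices G - I)) \<union> (\<Union>(surface_boundary ` I) \<union> surface_boundary e) \<union> \<Union>(surface_boundary ` A))
        - ?N - (arc_interior s \<union> arc_interior s')"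
      unfolding GA.surface_boundary_ribbon spanning_subgraph_ribbon(2)[OF AE] segsA spanning_subgraph_eqs V by auto
    also have "\<dots> = ?Y - ?N" unfolding boundary_W using ss' offV offA by blast
    finally show ?thesis .
  qed
  have YS: "?Y \<subseteq> surface G"
  proof -
    have "surface_boundary D \<subseteq> surface G" if "D \<in> vertices G \<union> edges G" for D
      using disc_subset_surface[OF that] surface_boundary_subset[of D] by blast
    then show ?thesis using boundary_W_subset A by blast
  qed
  have SAS: "r \<subseteq> surface G" if "r \<in> ?SA" for r
    using that segment_surface by (simp add: segments_in_def)
  have N: "\<Union>(arc_interior ` (`) \<phi> ` ?SA) = \<phi> ` ?N"
    using arc_interior_image[OF embedding SAS] by (simp add: image_UN image_image)
  have NS: "?N \<subseteq> surface G" using SAS unfolding arc_interior_def by blast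
  have bV: "surface_boundary ` (`) \<phi> ` (vertices G - I) = (`) \<phi> ` surface_boundary ` (vertices G - I)"
    using boundary_image disc_subset_surface by (force simp: image_image)
  have bA: "surface_boundary ` (`) \<phi> ` A = (`) \<phi> ` surface_boundary ` A"
    unfolding image_image using boundary_image disc_subset_surface A by (intro image_cong) auto
  have bC: "\<Union>(surface_boundary ` \<delta> ` C) = \<phi> ` surface_boundary W"
    using boundary_\<delta> unfolding Union_C[symmetric] by auto
  have "\<Union>(surface_boundary ` vertices H) \<union> \<Union>(surface_boundary ` (`) \<phi> ` A) = \<phi> ` ?Y"
    unfolding vertices_H image_Un[of surface_boundary] Union_Un_distrib bV bA bC by blast
  then have "bdry H ((`) \<phi> ` A) = \<phi> ` ?Y - \<phi> ` ?N"
    unfolding HA.surface_boundary_ribbon H.spanning_subgraph_ribbon(2)[OF AH] segments_in_H[OF A] N spanning_subgraph_eqs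
    by simp
  also have "\<dots> = \<phi> ` (?Y - ?N)"
    by (rule inj_on_image_set_diff[OF \<phi>_inj subset_trans[OF Diff_subset YS] NS, symmetric])
  finally show ?thesis unfolding G .
qed

end

context ribbon_contraction
begin

lemma num_boundary_components_H:
  assumes A: "A \<subseteq> edges G - {e}"
  shows "num_bdry H ((`) \<phi> ` A) =
    num_bdry G (insert e A)"
proof -
  have "surface (spanning_subgraph G (insert e A)) \<subseteq> surface G"
    using A edge by (auto simp: surface_spanning_subgraph surface_def)
  then have "bdry G (insert e A) \<subseteq> surface G"
    using surface_boundary_subset by blast
  then show ?thesis
    unfolding num_boundary_components_def boundary_components_def boundary_H[OF A]
    by (rule components_homeomorphic_image(2)[OF embedding])
qed

lemma \<phi>_continuous: "X \<subseteq> surface G \<Longrightarrow> continuous_on X \<phi>"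
  by (rule continuous_on_subset[OF homeomorphism_cont1[OF embedding]])

lemma surface_G_compact: "compact (surface G)"
proof -
  have "surface G = \<Union>(vertices G \<union> edges G)" by (auto simp: surface_def)
  moreover have "compact D" if "D \<in> vertices G \<union> edges G" for D
    using that disc_vertex disc_edge disc_facts(1) by blast
  ultimately show ?thesis using finite_vertices finite_edges compact_Union[of "vertices G \<union> edges G"] by auto
qed

lemma \<phi>_closed:
  assumes "closed X" "X \<subseteq> surface G"
  shows "closed (\<phi> ` X)"
proof -
  have "compact (surface G \<inter> X)" by (rule compact_Int_closed[OF surface_G_compact assms(1)])
  then have "compact X" using assms(2) by (simp add: Int_absorb1)
  then show ?thesis
    using compact_continuous_image[OF \<phi>_continuous[OF assms(2)]] compact_imp_closed by blast
qed

text \<open>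
  Each disc is attached along a nonempty connected curve and so joins a single component.
\<close>

lemma attach_discs:
  assumes "C' \<subseteq> C"
  shows "closed (\<phi> ` surface G \<union> \<Union>(\<delta> ` C')) \<and> finite (components (\<phi> ` surface G \<union> \<Union>(\<delta> ` C'))) \<and>
    card (components (\<phi> ` surface G \<union> \<Union>(\<delta> ` C'))) = num_components G"
  using finite_subset[OF assms finite_C] assms
proof (induction C' rule: finite_induct)
  case empty
  then show ?case
    using \<phi>_closed[OF surface_closed subset_refl] components_homeomorphic_image[OF embedding subset_refl]
      finite_surface_components by (simp add: num_components_def)
next
  case (insert c C')
  let ?X = "\<phi> ` surface G \<union> \<Union>(\<delta> ` C')"
  have X: "closed ?X" "finite (components ?X)" "card (components ?X) = num_components G"
    using insert by auto
  have c: "c \<in> C" using insert by blast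
  have "\<delta> c \<inter> \<delta> c' = {}" if "c' \<in> C'" for c'
    using \<delta>_disjoint[OF c, of c'] that insert(2,4) by (auto simp: disjnt_def)
  then have meet: "\<delta> c \<inter> ?X = \<phi> ` c" using \<delta>_meets_surface[OF c] by blast
  obtain x where x: "x \<in> c" using C_connected(2)[OF c] by blast
  then have mem: "\<phi> x \<in> \<delta> c" "\<phi> x \<in> ?X" using meet by blast+
  have "connected (\<phi> ` c)"
    using connected_continuous_image[OF \<phi>_continuous[OF C_subset[OF c]] C_connected(1)[OF c]] .
  moreover have "\<phi> ` c \<subseteq> ?X" using meet by blast
  ultimately have "\<phi> ` c \<subseteq> connected_component_set ?X (\<phi> x)"
    using x by (intro connected_component_maximal) auto
  then have sub: "\<delta> c \<inter> ?X \<subseteq> connected_component_set ?X (\<phi> x) \<union> connected_component_set ?X (\<phi> x)"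
    using meet by simp
  have \<delta>: "closed (\<delta> c)" "connected (\<delta> c)" using disc_facts(2,3)[OF disc_\<delta>[OF c]] .
  have eq: "\<phi> ` surface G \<union> \<Union>(\<delta> ` insert c C') = ?X \<union> \<delta> c" by blast
  have "connected_component ?X (\<phi> x) (\<phi> x)" using mem by (simp add: connected_component_refl)
  then show ?case
    unfolding eq using X \<delta>(1) card_components_attach(1,2)[OF X(1,2) \<delta> mem mem sub] by auto
qed

lemma connected_W: "connected W" and closed_W: "closed W"
proof -
  let ?S = "insert e ((\<union>) e ` I)"
  have e: "connected e" "e \<noteq> {}" using disc_facts(3,4)[OF disc_edge[OF edge]] .
  have "connected (e \<union> v)" if "v \<in> I" for v
    using that e I_meets disc_vertex disc_facts(3) by (intro connected_Un) blast+
  then have "connected (\<Union>?S)" using e by (intro connected_Union) auto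
  moreover have "\<Union>?S = W" by (auto simp: W_def)
  ultimately show "connected W" by simp
  have "closed (\<Union>(insert e I))" using I_subset edge by (intro closed_Union_discs) blast
  then show "closed W" by (simp add: W_def)
qed

lemma side_in_boundary_W: "t \<subseteq> surface_boundary W" "t' \<subseteq> surface_boundary W"
proof -
  have "free_boundary G e \<subseteq> surface_boundary W"
    unfolding free_boundary_def boundary_W segs by auto
  then show "t \<subseteq> surface_boundary W" "t' \<subseteq> surface_boundary W" using sides by blast+
qed

text \<open>
  Every piece of the boundary of \<open>W\<close> contains a corner of \<open>e\<close>, and every
  corner lies on a side of \<open>e\<close>. So a boundary curve of \<open>W\<close> contains
  \<open>t\<close> and with it \<open>p\<close>, or \<open>t'\<close> and with it
  \<open>p'\<close>.
\<close>

lemma C_contains_side: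
  assumes c: "c \<in> C"
  shows "p \<in> c \<or> p' \<in> c"
proof -
  have comp: "c \<in> components (surface_boundary W)" using c by (simp add: C_def boundary_components_def)
  obtain x where x: "x \<in> c" using C_connected(2)[OF c] by blast
  have b: "surface_boundary W = \<Union>(free_boundary star ` (I \<union> {e})) \<union> \<Union>(segments star - segments_in star e)"
  proof -
    have star: "spanning_subgraph star {e} = star" using spanning_subgraph_eqs(3)[of star] unfolding star_sel .
    show ?thesis using star.boundary_spanning_subgraph[of "{e}"] unfolding star surface_star by simp
  qed
  have "segments star - segments_in star e = {}"
    using seg_mem by (auto simp: segments_star segments_in_def)
  then have b: "surface_boundary W = \<Union>(free_boundary star ` (I \<union> {e}))" using b by (simp only: Union_empty Un_empty_right)
  have "x \<in> surface_boundary W" using x c Union_C by blast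
  then obtain D where D: "D \<in> I \<union> {e}" "x \<in> free_boundary star D" unfolding b by blast
  then have DR: "D \<in> vertices star \<union> edges star" by simp
  obtain T where T: "disc_pieces star D T" using star.disc_pieces_exist[OF DR] by blast
  then obtain \<tau> where \<tau>: "\<tau> \<in> T" "x \<in> \<tau>" using D(2) unfolding disc_pieces_def by blast
  have ne: "segments_in star D \<noteq> {}"
  proof -
    have "D \<inter> e \<noteq> {}" using D(1) I_meets disc_facts(4)[OF disc_edge[OF edge]] by auto
    then obtain y where y: "y \<in> D" "y \<in> e" by blast
    show ?thesis
    proof (cases "D = e")
      case True
      then show ?thesis using seg_mem by (auto simp: segments_star segments_in_def)
    next
      case False
      then have "y \<in> \<Union>(segments star)" using star.Union_segments D(1) y by auto
      then obtain r where r: "r \<in> segments star" "y \<in> r" by blast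
      then show ?thesis using star.segments_in_iff[OF DR r] y by blast
    qed
  qed
  have "\<tau> \<inter> ends_in star D \<noteq> {}" using T ne \<tau>(1) unfolding disc_pieces_def by blast
  moreover have "ends_in star D \<subseteq> {p,p',q,q'}"
    unfolding ends_in_def segments_in_def segments_star using corners by auto
  moreover have "\<tau> \<subseteq> c"
  proof -
    have "\<tau> \<subseteq> free_boundary star D" "connected \<tau>" using T \<tau>(1) unfolding disc_pieces_def by blast+
    then have "\<tau> \<subseteq> surface_boundary W" using b D(1) by blast
    then show ?thesis using component_contains_or_misses[OF comp \<open>connected \<tau>\<close>] x \<tau>(2) by blast
  qed
  moreover have "t \<subseteq> c \<or> t \<inter> c = {}" "t' \<subseteq> c \<or> t' \<inter> c = {}"
    using component_contains_or_misses[OF comp] connected_arcs side_in_boundary_W by auto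
  ultimately show ?thesis using corner_mem by blast
qed

text \<open>
  The space \<open>?Z\<close> below is \<open>G\<close> with the new discs attached, which has as
  many components as \<open>G\<close>. It is also \<open>H\<close> with \<open>W\<close> filled
  in, and \<open>W\<close> touches \<open>H\<close> only along curves in the components of
  \<open>\<phi> p\<close> and \<open>\<phi> p'\<close>.
\<close>

lemma num_components_H:
  shows "connected_component (surface H) (\<phi> p) (\<phi> p') \<Longrightarrow> num_components H = num_components G"
    and "\<not> connected_component (surface H) (\<phi> p) (\<phi> p') \<Longrightarrow> num_components H = num_components G + 1"
proof -
  let ?Z = "\<phi> ` surface G \<union> \<Union>(\<delta> ` C)"
  have S: "surface H = \<phi> ` (\<Union>(vertices G - I) \<union> \<Union>(edges G - {e})) \<union> \<Union>(\<delta> ` C)"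
    unfolding surface_def vertices_H edges_H by (simp add: image_Un image_Union Un_ac)
  have "surface G = \<Union>(vertices G - I) \<union> \<Union>(edges G - {e}) \<union> W"
    unfolding surface_def W_def using I_subset edge by blast
  then have Z: "?Z = surface H \<union> \<phi> ` W" unfolding S by (simp add: image_Un Un_ac)
  have \<delta>S: "\<delta> c \<subseteq> surface H" if "c \<in> C" for c using that unfolding S by blast
  have \<phi>\<delta>: "\<phi> ` c \<subseteq> \<delta> c" if "c \<in> C" for c using \<delta>_meets_surface[OF that] by blast
  have pW: "p \<in> surface_boundary W" "p' \<in> surface_boundary W" using side_in_boundary_W corner_mem by blast+
  then have pc: "\<exists>c\<in>C. p \<in> c" "\<exists>c\<in>C. p' \<in> c" using Union_C by blast+
  then have mem: "\<phi> p \<in> \<phi> ` W" "\<phi> p \<in> surface H" "\<phi> p' \<in> \<phi> ` W" "\<phi> p' \<in> surface H"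
    using pW surface_boundary_subset[of W] \<delta>S \<phi>\<delta> by blast+
  have comp: "\<delta> c \<subseteq> connected_component_set (surface H) (\<phi> p) \<union> connected_component_set (surface H) (\<phi> p')"
    if c: "c \<in> C" for c
  proof -
    have "\<delta> c \<subseteq> connected_component_set (surface H) (\<phi> z)" if "z \<in> c" for z
      using that \<phi>\<delta>[OF c] disc_facts(3)[OF disc_\<delta>[OF c]] \<delta>S[OF c] by (intro connected_component_maximal) auto
    then show ?thesis using C_contains_side[OF c] by blast
  qed
  have meet: "\<phi> ` W \<inter> surface H \<subseteq> \<Union>(\<delta> ` C)"
  proof
    fix y assume y: "y \<in> \<phi> ` W \<inter> surface H"
    then obtain w where w: "w \<in> W" "y = \<phi> w" by blast
    then have wS: "w \<in> surface G" using W_subset by blast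
    consider "y \<in> \<Union>(\<delta> ` C)" | "y \<in> \<phi> ` (\<Union>(vertices G - I) \<union> \<Union>(edges G - {e}))" using y S by blast
    then show "y \<in> \<Union>(\<delta> ` C)"
    proof cases
      case 2
      have "\<Union>(vertices G - I) \<union> \<Union>(edges G - {e}) \<subseteq> surface G" by (auto simp: surface_def)
      from \<phi>_mem[OF wS this] have "w \<in> \<Union>(vertices G - I) \<union> \<Union>(edges G - {e})"
        using 2 unfolding w(2) by (rule iffD1)
      moreover have "w \<notin> \<Union>(vertices G - I)" using vertex_off_W w(1) by blast
      ultimately obtain a where a: "a \<in> edges G - {e}" "w \<in> a" by blast
      then have we: "w \<notin> e" using edge_off_e by blast
      then obtain v where v: "v \<in> I" "w \<in> v" using w(1) by (auto simp: W_def)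
      then have "w \<in> \<Union>(segments G)" using Union_segments I_subset a by blast
      then obtain r where r: "r \<in> segments G" "w \<in> r" by blast
      then have "w \<in> surface_boundary W" using segment_in_boundary_W[OF r we v] by blast
      then obtain c where "c \<in> C" "w \<in> c" using Union_C by blast
      then show ?thesis using \<phi>\<delta> w(2) by blast
    qed simp
  qed
  then have sub: "\<phi> ` W \<inter> surface H \<subseteq>
      connected_component_set (surface H) (\<phi> p) \<union> connected_component_set (surface H) (\<phi> p')"
    using comp by blast
  note attach = card_components_attach[OF H.surface_closed H.finite_surface_components
    \<phi>_closed[OF closed_W W_subset] connected_continuous_image[OF \<phi>_continuous[OF W_subset] connected_W] mem sub,
    folded Z]
  have "card (components ?Z) = num_components G" using attach_discs[OF subset_refl] by blast
  then show "connected_component (surface H) (\<phi> p) (\<phi> p') \<Longrightarrow> num_components H = num_components G"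
    "\<not> connected_component (surface H) (\<phi> p) (\<phi> p') \<Longrightarrow> num_components H = num_components G + 1"
    using attach(2,3) unfolding num_components_def by simp_all
qed

text \<open>
  If the two sides of \<open>e\<close> are separated in \<open>H\<close>, then they are separated
  in the boundary of every subgraph with \<open>e\<close>, because that boundary is embedded in
  \<open>H\<close>.
\<close>

lemma merge_if_disconnected:
  assumes sep: "\<not> connected_component (surface H) (\<phi> p) (\<phi> p')" and A: "A \<subseteq> edges G - {e}"
  shows "num_bdry G (insert e A) = num_bdry G A + 1"
proof (rule boundary_merge_removing_edge[OF A _ subset_refl])
  let ?B = "bdry G (insert e A)"
  show "\<not> connected_component ?B p p'"
  proof
    assume "connected_component ?B p p'"
    then obtain K where K: "connected K" "K \<subseteq> ?B" "p \<in> K" "p' \<in> K" unfolding connected_component_def by blast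
    have "surface (spanning_subgraph G (insert e A)) \<subseteq> surface G"
      using A edge by (auto simp: surface_spanning_subgraph surface_def)
    then have "K \<subseteq> surface G" using K(2) surface_boundary_subset by blast
    then have "connected (\<phi> ` K)" using connected_continuous_image[OF \<phi>_continuous K(1)] by blast
    moreover have "\<phi> ` K \<subseteq> surface H"
    proof -
      have "\<phi> ` K \<subseteq> bdry H ((`) \<phi> ` A)"
        unfolding boundary_H[OF A] using K(2) by blast
      also have "\<dots> \<subseteq> surface (spanning_subgraph H ((`) \<phi> ` A))" by (rule surface_boundary_subset)
      also have "\<dots> \<subseteq> surface H"
        using A by (auto simp: H.surface_spanning_subgraph surface_def edges_H)
      finally show ?thesis .
    qed
    ultimately show False using sep K(3,4) unfolding connected_component_def by blast
  qed
qed

text \<open>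
  The case distinction is whether \<open>H\<close> connects the two sides of \<open>e\<close>. In
  both cases the feasible sets of \<open>D/e\<close> turn out to be described by the same
  condition on the boundary of the subgraphs with \<open>e\<close>, which is the condition for the
  feasible sets of \<open>H\<close>.
\<close>

lemma delta_matroid_of_contraction:
  "delta_matroid_of H = relabel ((`) \<phi>) (dm_contract (delta_matroid_of G) e)"
proof -
  let ?D = "delta_matroid_of G"
  have ground: "ground (dm_contract ?D e) = edges G - {e}"
    by (simp add: dm_contract_def restrict_avoiding_def restrict_containing_def)
  have key: "A \<in> feasible (dm_contract ?D e) \<longleftrightarrow>
      A \<subseteq> edges G - {e} \<and> num_bdry G (insert e A) = num_components H" for A
  proof (cases "connected_component (surface H) (\<phi> p) (\<phi> p')")
    case True
    then have k: "num_components H = num_components G" by (rule num_components_H(1))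
    obtain B where B: "B \<subseteq> edges H" "num_bdry H B = num_components H"
      using spanning_quasi_tree_exists[OF H_ribbon] by blast
    then obtain A' where A': "A' \<subseteq> edges G - {e}" "B = (`) \<phi> ` A'"
      unfolding edges_H by (meson subset_imageE)
    then have "insert e A' \<in> feasible ?D"
      using B num_boundary_components_H[OF A'(1)] k edge by (auto simp: mem_feasible)
    then have "\<not> loop ?D e" by (auto simp: loop_def)
    then have "A \<in> feasible (dm_contract ?D e) \<longleftrightarrow> A \<in> feasible (restrict_containing ?D e)"
      by (simp add: dm_contract_def)
    also have "\<dots> \<longleftrightarrow> insert e A \<in> feasible ?D \<and> A \<subseteq> ground ?D - {e}"
      by (rule mem_restrict_containing) (simp add: mem_feasible)
    finally show ?thesis using k edge by (auto simp: mem_feasible)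
  next
    case False
    then have k: "num_components H = num_components G + 1" by (rule num_components_H(2))
    have "e \<notin> F" if F: "F \<in> feasible ?D" for F
    proof
      assume "e \<in> F"
      then have ins: "insert e (F - {e}) = F" by blast
      have F': "F - {e} \<subseteq> edges G - {e}" using F by (auto simp: mem_feasible)
      then have "(`) \<phi> ` (F - {e}) \<subseteq> edges H" by (auto simp: edges_H)
      from num_components_le_spanning[OF H_ribbon this] num_boundary_components_H[OF F']
      show False using F k ins by (simp add: mem_feasible)
    qed
    then have "loop ?D e" using edge by (simp add: loop_def)
    then have "A \<in> feasible (dm_contract ?D e) \<longleftrightarrow> A \<in> feasible ?D \<and> A \<subseteq> edges G - {e}"
      by (simp add: dm_contract_def mem_restrict_avoiding)
    then show ?thesis using merge_if_disconnected[OF False, of A] k by (auto simp: mem_feasible)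
  qed
  have "feasible (delta_matroid_of H) = (`) ((`) \<phi>) ` feasible (dm_contract ?D e)"
  proof
    show "feasible (delta_matroid_of H) \<subseteq> (`) ((`) \<phi>) ` feasible (dm_contract ?D e)"
    proof
      fix B assume "B \<in> feasible (delta_matroid_of H)"
      then have B: "B \<subseteq> edges H" "num_bdry H B = num_components H"
        by (auto simp: mem_feasible)
      then obtain A where A: "A \<subseteq> edges G - {e}" "B = (`) \<phi> ` A" unfolding edges_H by (meson subset_imageE)
      then have "A \<in> feasible (dm_contract ?D e)" using B(2) num_boundary_components_H[OF A(1)] key by simp
      then show "B \<in> (`) ((`) \<phi>) ` feasible (dm_contract ?D e)" using A(2) by blast
    qed
    show "(`) ((`) \<phi>) ` feasible (dm_contract ?D e) \<subseteq> feasible (delta_matroid_of H)"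
    proof
      fix B assume "B \<in> (`) ((`) \<phi>) ` feasible (dm_contract ?D e)"
      then obtain A where A: "A \<in> feasible (dm_contract ?D e)" "B = (`) \<phi> ` A" by blast
      then have A': "A \<subseteq> edges G - {e}" using key by blast
      then have "(`) \<phi> ` A \<subseteq> edges H" by (auto simp: edges_H)
      then show "B \<in> feasible (delta_matroid_of H)"
        using A key[of A] num_boundary_components_H[OF A'] by (simp add: mem_feasible)
    qed
  qed
  then show ?thesis
    unfolding relabel_def ground using edges_H by (simp add: delta_matroid_of_def)
qed

end

lemma (in ribbon) delta_matroid_of_contract_edge:
  assumes e: "e \<in> edges G" and H: "is_contraction \<phi> G e H"
  shows "delta_matroid_of H = relabel ((`) \<phi>) (dm_contract (delta_matroid_of G) e)"
proof -
  define I where "I = incident_vertices G e"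
  define W where "W = e \<union> \<Union>I"
  define C where "C = boundary_components W"
  note H' = H[unfolded is_contraction_def Let_def, folded I_def, folded W_def, folded C_def]
  obtain \<psi> where \<psi>: "homeomorphism (surface G) (\<phi> ` surface G) \<phi> \<psi>"
    using conjunct1[OF H'] by (elim exE) (rule that)
  obtain \<delta> where \<delta>: "\<forall>c\<in>C. disc (\<delta> c) \<and> surface_boundary (\<delta> c) = \<phi> ` c \<and> \<delta> c \<inter> \<phi> ` surface G = \<phi> ` c"
    "\<forall>c\<in>C. \<forall>c'\<in>C. c \<noteq> c' \<longrightarrow> disjnt (\<delta> c) (\<delta> c')"
    "vertices H = (`) \<phi> ` (vertices G - I) \<union> \<delta> ` C" "edges H = (`) \<phi> ` (edges G - {e})"
    using conjunct2[OF H'] by (elim exE conjE) (rule that)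
  obtain s s' t t' p p' q q' where "ribbon_edge G e s s' t t' p p' q q'"
    using ribbon_edge_exists[OF e] .
  then interpret ribbon_edge G e s s' t t' p p' q q' .
  interpret ribbon_contraction G e s s' t t' p p' q q' \<phi> \<psi> H \<delta> I W C
    by unfold_locales (use \<psi> \<delta> in \<open>simp_all add: I_def W_def C_def\<close>)
  show ?thesis by (rule delta_matroid_of_contraction)
qed

theorem proposition5p11:
  fixes G :: "'a::t2_space ribbon" and e :: "'a set"
  assumes "ribbon_graph G" and "e \<in> edges G"
  shows "delta_matroid_of (delete_edge G e) = dm_delete (delta_matroid_of G) e \<and>
         (\<forall>(\<phi> :: 'a \<Rightarrow> 'b::t2_space) H. is_contraction \<phi> G e H \<longrightarrow>
            delta_matroid_of H = relabel ((`) \<phi>) (dm_contract (delta_matroid_of G) e))"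
proof -
  interpret ribbon G by standard (rule assms(1))
  show ?thesis using delta_matroid_of_delete_edge[OF assms] delta_matroid_of_contract_edge[OF assms(2)] by blast
qed

end
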